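(* Let $\mathbb{X}$ be a Banach space with a basis. Suppose that at least one of the spaces $B_{\infty,2}=(\bigoplus_{n=1}^\infty\ell_\infty^n)_2$ and $B_{1,2}=(\bigoplus_{n=1}^\infty\ell_1^n)_2$ is isomorphic to a complemented subspace of $\mathbb{X}$. Then $\mathbb{X}$ has an almost greedy basis $\mathcal{B}$ with $\phi_m[\mathcal{B}]\approx m^{1/2}$ for $m\in\mathbb{N}$ and $L_m[\mathcal{B}]\approx\log m$ for $m\ge2$.
   Context: Banach spaces are real or complex and bases are Schauder bases. Let $\mathcal{B}=(\mathbf{x}_n)_{n=1}^\infty$ be a basis of $\mathbb{X}$ with coordinate functionals $(\mathbf{x}_n^* )_{n=1}^\infty$. For $A\subseteq\mathbb{N}$, the coordinate projection is $S_A[\mathcal{B}](f)=\sum_{n\in A}\mathbf{x}_n^*(f)\,\mathbf{x}_n$ (when well defined), and $\operatorname{supp}(f)=\{n:\mathbf{x}_n^*(f)\neq0\}$. The basis is almost greedy if there is a constant $C$ such that $\|f-S_A[\mathcal{B}](f)\|\le C\|f-S_B[\mathcal{B}](f)\|$ whenever $f\in\mathbb{X}$, $A,B\subseteq\mathbb{N}$, $|B|\le|A|<\infty$, and $|\mathbf{x}_j^*(f)|\le|\mathbf{x}_k^*(f)|$ for all $j\in\mathbb{N}\setminus A$ and $k\in A$. The fundamental function is $\phi_m[\mathcal{B}]=\sup_{|A|\le m}\|\sum_{j\in A}\mathbf{x}_j\|$. The w-conditionality constants are $$L_m[\mathcal{B}]=\sup\left\{\frac{\|S_A[\mathcal{B}](f)\|}{\|f\|}: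 f\ne0,\ \max(\operatorname{supp}(f))\le m,\ A\subseteq\mathbb{N}\right\}.$$ $\ell_r^n$ is $\mathbb{F}^n$ ($\mathbb{F}$ the scalar field) with the $\ell_r$-norm, and $(\bigoplus_n\mathbb{X}_n)_2$ is the direct sum in the $\ell_2$-sense. For families of nonnegative reals, $\alpha_i\lesssim\beta_i$ means there is a constant $C$ with $\alpha_i\le C\beta_i$ for all $i$, and $\alpha_i\approx\beta_i$ means $\alpha_i\lesssim\beta_i$ and $\beta_i\lesssim\alpha_i$. *)

theory Defs
  imports "HOL-Analysis.Analysis"
begin

text \<open>The scalar field is \<open>\<real>\<close> or \<open>\<complex>\<close>. The class says that the type is a copy of one of these two
  fields with its usual absolute value, so that both cases are treated by one statement.\<close>

class real_or_complex = real_normed_field +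
  assumes real_or_complex:
    "(\<forall>z. \<exists>a. z = a *\<^sub>R 1) \<or>
     (\<exists>w. w * w = - 1 \<and> (\<forall>z. \<exists>a b. z = a *\<^sub>R 1 + b *\<^sub>R w \<and> norm z = sqrt (a\<^sup>2 + b\<^sup>2)))"

instance real :: real_or_complex
  by standard auto

instance complex :: real_or_complex
proof
  have "\<exists>a b. z = a *\<^sub>R 1 + b *\<^sub>R \<i> \<and> norm z = sqrt (a\<^sup>2 + b\<^sup>2)" for z :: complex
    by (rule exI[of _ "Re z"], rule exI[of _ "Im z"]) (simp add: complex_eq_iff cmod_def)
  then show "(\<forall>z::complex. \<exists>a. z = a *\<^sub>R 1) \<or>
     (\<exists>w::complex. w * w = - 1 \<and>
        (\<forall>z. \<exists>a b. z = a *\<^sub>R 1 + b *\<^sub>R w \<and> norm z = sqrt (a\<^sup>2 + b\<^sup>2)))"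
    by (intro disjI2 exI[of _ \<i>]) simp
qed

text \<open>A Banach space over \<open>'k\<close>: the library class \<open>banach\<close> only knows real scalars, so the
  multiplication by scalars of \<open>'k\<close> is an explicit parameter, extending the real one.\<close>

locale banach_space_over = vector_space smul
  for smul :: "'k::real_or_complex \<Rightarrow> 'a::banach \<Rightarrow> 'a" +
  assumes smul_of_real: "smul (of_real r) x = r *\<^sub>R x"
    and norm_smul: "norm (smul c x) = norm c * norm x"


section \<open>Bases\<close>

text \<open>Sequences are indexed from \<open>0\<close>; the vector written \<open>x\<^sub>n\<close> with \<open>n \<ge> 1\<close> is \<open>x (n - 1)\<close> here.\<close>

definition schauder_basis :: "('k::real_or_complex \<Rightarrow> 'a::banach \<Rightarrow> 'a) \<Rightarrow> (nat \<Rightarrow> 'a) \<Rightarrow> bool" where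
  "schauder_basis smul x \<longleftrightarrow> (\<forall>f. \<exists>!a. (\<lambda>n. smul (a n) (x n)) sums f)"

definition coord :: "('k::real_or_complex \<Rightarrow> 'a::banach \<Rightarrow> 'a) \<Rightarrow> (nat \<Rightarrow> 'a) \<Rightarrow> nat \<Rightarrow> 'a \<Rightarrow> 'k" where
  "coord smul x n f = (THE a. (\<lambda>n. smul (a n) (x n)) sums f) n"

definition supp :: "('k::real_or_complex \<Rightarrow> 'a::banach \<Rightarrow> 'a) \<Rightarrow> (nat \<Rightarrow> 'a) \<Rightarrow> 'a \<Rightarrow> nat set" where
  "supp smul x f = {n. coord smul x n f \<noteq> 0}"

definition coord_proj ::
  "('k::real_or_complex \<Rightarrow> 'a::banach \<Rightarrow> 'a) \<Rightarrow> (nat \<Rightarrow> 'a) \<Rightarrow> nat set \<Rightarrow> 'a \<Rightarrow> 'a" where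
  "coord_proj smul x A f = (\<Sum>n. if n \<in> A then smul (coord smul x n f) (x n) else 0)"

definition almost_greedy :: "('k::real_or_complex \<Rightarrow> 'a::banach \<Rightarrow> 'a) \<Rightarrow> (nat \<Rightarrow> 'a) \<Rightarrow> bool" where
  "almost_greedy smul x \<longleftrightarrow>
     (\<exists>C::real. \<forall>f A B.
        finite A \<longrightarrow> finite B \<longrightarrow> card B \<le> card A \<longrightarrow>
        (\<forall>j k. j \<notin> A \<longrightarrow> k \<in> A \<longrightarrow> norm (coord smul x j f) \<le> norm (coord smul x k f)) \<longrightarrow>
        norm (f - coord_proj smul x A f) \<le> C * norm (f - coord_proj smul x B f))"

text \<open>The suprema are taken in \<open>ennreal\<close>, so they are not assumed to be finite.\<close>

definition fundamental_function :: "(nat \<Rightarrow> 'a::banach) \<Rightarrow> nat \<Rightarrow> ennreal" where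
  "fundamental_function x m =
     (SUP A\<in>{A. finite A \<and> card A \<le> m}. ennreal (norm (\<Sum>j\<in>A. x j)))"

text \<open>With indices starting at \<open>0\<close>, \<open>max (supp f) \<le> m\<close> reads \<open>supp f \<subseteq> {..<m}\<close>.\<close>

definition conditionality_const ::
  "('k::real_or_complex \<Rightarrow> 'a::banach \<Rightarrow> 'a) \<Rightarrow> (nat \<Rightarrow> 'a) \<Rightarrow> nat \<Rightarrow> ennreal" where
  "conditionality_const smul x m =
     (SUP (f, A)\<in>{(f, A). f \<noteq> 0 \<and> supp smul x f \<subseteq> {..<m}}.
        ennreal (norm (coord_proj smul x A f) / norm f))"

definition lesssim_on :: "'i set \<Rightarrow> ('i \<Rightarrow> ennreal) \<Rightarrow> ('i \<Rightarrow> ennreal) \<Rightarrow> bool" where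
  "lesssim_on I \<alpha> \<beta> \<longleftrightarrow> (\<exists>C::real. \<forall>i\<in>I. \<alpha> i \<le> ennreal C * \<beta> i)"

definition approx_on :: "'i set \<Rightarrow> ('i \<Rightarrow> ennreal) \<Rightarrow> ('i \<Rightarrow> ennreal) \<Rightarrow> bool" where
  "approx_on I \<alpha> \<beta> \<longleftrightarrow> lesssim_on I \<alpha> \<beta> \<and> lesssim_on I \<beta> \<alpha>"


section \<open>The spaces \<open>(\<Oplus>\<^sub>n \<ell>\<^sub>r\<^sup>n)\<^sub>2\<close>\<close>

text \<open>The space of \<open>n\<close>-tuples of scalars consists of the functions on \<open>nat\<close> vanishing outside \<open>{..<n}\<close>; \<open>1 \<le> r \<le> \<infinity>\<close> and \<open>n \<ge> 1\<close>.\<close>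

definition ell_carrier :: "nat \<Rightarrow> (nat \<Rightarrow> 'k::real_or_complex) set" where
  "ell_carrier n = {v. \<forall>i\<ge>n. v i = 0}"

definition ell_norm :: "ereal \<Rightarrow> nat \<Rightarrow> (nat \<Rightarrow> 'k::real_or_complex) \<Rightarrow> real" where
  "ell_norm r n v =
     (if r = \<infinity> then Max ((\<lambda>i. norm (v i)) ` {..<n})
      else (\<Sum>i<n. norm (v i) powr real_of_ereal r) powr (1 / real_of_ereal r))"

text \<open>The block with index \<open>n = 0, 1, \<dots>\<close> is \<open>\<ell>\<^sub>r\<close> of dimension \<open>n + 1\<close>.\<close>

definition B_carrier :: "ereal \<Rightarrow> (nat \<Rightarrow> nat \<Rightarrow> 'k::real_or_complex) set" where
  "B_carrier r = {u. (\<forall>n. u n \<in> ell_carrier (Suc n)) \<and> summable (\<lambda>n. (ell_norm r (Suc n) (u n))\<^sup>2)}"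

definition B_norm :: "ereal \<Rightarrow> (nat \<Rightarrow> nat \<Rightarrow> 'k::real_or_complex) \<Rightarrow> real" where
  "B_norm r u = sqrt (\<Sum>n. (ell_norm r (Suc n) (u n))\<^sup>2)"

definition complemented_subspace ::
  "('k::real_or_complex \<Rightarrow> 'a::banach \<Rightarrow> 'a) \<Rightarrow> 'a set \<Rightarrow> bool" where
  "complemented_subspace smul Y \<longleftrightarrow>
     (\<exists>P. bounded_linear P \<and> (\<forall>c f. P (smul c f) = smul c (P f)) \<and> P \<circ> P = P \<and> range P = Y)"

definition B_isomorphic_to ::
  "ereal \<Rightarrow> ('k::real_or_complex \<Rightarrow> 'a::banach \<Rightarrow> 'a) \<Rightarrow> 'a set \<Rightarrow> bool" where
  "B_isomorphic_to r smul Y \<longleftrightarrow>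
     (\<exists>T :: (nat \<Rightarrow> nat \<Rightarrow> 'k) \<Rightarrow> 'a.
        (\<forall>u\<in>B_carrier r. \<forall>v\<in>B_carrier r. T (\<lambda>n i. u n i + v n i) = T u + T v) \<and>
        (\<forall>c. \<forall>u\<in>B_carrier r. T (\<lambda>n i. c * u n i) = smul c (T u)) \<and>
        (\<exists>c C. 0 < c \<and> (\<forall>u\<in>B_carrier r. c * B_norm r u \<le> norm (T u) \<and> norm (T u) \<le> C * B_norm r u)) \<and>
        T ` B_carrier r = Y)"

end

theory Submission
  imports Defs "HOL-Library.Discrete_Functions"
begin

text \<open>In \<open>\<ell>\<^sub>1\<^sup>N\<close> the vectors \<open>e\<^sub>i - e\<^bsub>i-1\<^esub>\<close>, and in \<open>\<ell>\<^sub>\<infinity>\<^sup>N\<close> the summing vectors, form bases with uniformly bounded partial sums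
  and with conditionality constants of order \<open>N\<close>. Shifting coordinates inside the complemented copy
  of \<open>(\<Oplus>\<^sub>n \<ell>\<^sub>r\<^sup>n)\<^sub>2\<close> splits the space \<open>X\<close> into a copy of \<open>X\<close>, a copy of \<open>(\<Oplus>\<^sub>k \<ell>\<^sub>r\<^sup>N)\<^sub>2\<close> with \<open>N = 2\<^sup>k\<close>,
  and a copy of \<open>\<ell>\<^sub>2\<close>. Interlacing the given basis with the conditional bases of the \<open>\<ell>\<^sub>r\<^sup>N\<close> gives a
  basis \<open>z\<close> of the first two summands whose \<open>k\<close>-th conditionality constant has order \<open>k\<close>.
  A block of \<open>2\<^sup>n\<close> vectors, namely \<open>z\<^sub>n\<close> and \<open>2\<^sup>n - 1\<close> unit vectors of \<open>\<ell>\<^sub>2\<close>, is rotated by an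
  orthogonal matrix that spreads \<open>z\<^sub>n\<close> evenly over the block. As the blocks grow exponentially, the rotated system is
  almost greedy with fundamental function of order \<open>m\<^bsup>1/2\<^esup>\<close>, and its \<open>m\<close>-th
  conditionality constant is comparable to the constant of \<open>z\<close> of index \<open>log m\<close>.\<close>

section \<open>Schauder bases\<close>

text \<open>The given basis is arbitrary: neither its conditionality nor the size of its vectors is
  controlled. The upper bound for the conditionality constants must therefore come from the
  rotation. Inside one block the rotated system is unconditional with a constant independent of the
  block, and a vector supported in \<open>{..<m}\<close> meets only O(log m) blocks. The lower bound
  needs explicit vectors; order k is the largest growth that k uniformly bounded vectors with
  uniformly bounded functionals allow, and the interlaced bases attain it. The rotation is the
  method of Dilworth, Kalton and Kutzarova. A rotated coefficient is a block average plus a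
  deviation. Deviations are square summable, and averages in block n are at most a constant times
  2^(-n/2) times the norm, so averages of a given size occur only in an initial segment. The
  estimates for large coefficients and for greedy sums play these two facts against each other.
  Shifting is used because removing coordinates must leave a space that is still isomorphic to X:
  only then can the given basis be transported to the remaining summand.\<close>

lemma real_or_complex_convergent:
  fixes z :: "nat \<Rightarrow> 'k::real_or_complex"
  assumes "Cauchy z"
  shows "convergent z"
proof -
  consider "\<forall>z::'k. \<exists>a. z = a *\<^sub>R 1"
    | w :: 'k where "\<forall>z. \<exists>a b. z = a *\<^sub>R 1 + b *\<^sub>R w \<and> norm z = sqrt (a\<^sup>2 + b\<^sup>2)"
    using real_or_complex by blast
  then show ?thesis
  proof cases
    case 1
    then obtain h where h: "\<And>y::'k. y = h y *\<^sub>R 1"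
      by metis
    define a where "a n = h (z n)" for n
    have a: "z n = a n *\<^sub>R 1" for n
      unfolding a_def by (rule h)
    have "norm (z m - z n) = \<bar>a m - a n\<bar>" for m n
      by (simp add: a flip: scaleR_left_diff_distrib)
    then have "Cauchy a"
      using assms by (simp add: Cauchy_iff)
    then obtain l where "a \<longlonglongrightarrow> l"
      by (auto simp: Cauchy_convergent_iff convergent_def)
    then have "z \<longlonglongrightarrow> l *\<^sub>R 1"
      unfolding a by (intro tendsto_intros)
    then show ?thesis
      by (rule convergentI)
  next
    case 2
    obtain g h where gh: "\<And>y. y = g y *\<^sub>R 1 + h y *\<^sub>R w"
      "\<And>y. norm y = sqrt ((g y)\<^sup>2 + (h y)\<^sup>2)"
      using 2 by metis
    define p where "p m n = g (z m - z n)" for m n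
    define q where "q m n = h (z m - z n)" for m n
    have p: "z m - z n = p m n *\<^sub>R 1 + q m n *\<^sub>R w" for m n
      unfolding p_def q_def by (rule gh)
    have pq: "norm (z m - z n) = sqrt ((p m n)\<^sup>2 + (q m n)\<^sup>2)" for m n
      unfolding p_def q_def by (rule gh)
    define a where "a n = p n 0" for n
    define b where "b n = q n 0" for n
    have z: "z n = z 0 + (a n *\<^sub>R 1 + b n *\<^sub>R w)" for n
      unfolding a_def b_def p[symmetric] by simp
    have eq: "p m n *\<^sub>R 1 + q m n *\<^sub>R w = (a m - a n) *\<^sub>R 1 + (b m - b n) *\<^sub>R w" for m n
      using p[of m n] z[of m] z[of n] by (simp add: algebra_simps)
    \<comment> \<open>The coordinates \<open>g\<close> and \<open>h\<close> are merely chosen, so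
      coordinates of differences need not be differences of coordinates. If \<open>w\<close> is a
      real multiple of 1, the sequence moves on a real line; otherwise 1 and \<open>w\<close> are
      independent over the reals and coordinates are unique.\<close>
    show ?thesis
    proof (cases "\<exists>r. w = r *\<^sub>R 1")
      case True
      then obtain r where r: "w = r *\<^sub>R 1" by blast
      define d where "d n = a n + b n * r" for n
      have zd: "z n = z 0 + d n *\<^sub>R 1" for n
        using z[of n] unfolding d_def r by (simp add: algebra_simps)
      have "norm (z m - z n) = \<bar>d m - d n\<bar>" for m n
      proof -
        have "z m - z n = (d m - d n) *\<^sub>R 1"
          using zd[of m] zd[of n] by (simp add: algebra_simps)
        then show ?thesis by simp
      qed
      then have "Cauchy d"
        using assms by (simp add: Cauchy_iff)
      then obtain l where l: "d \<longlonglongrightarrow> l"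
        by (auto simp: Cauchy_convergent_iff convergent_def)
      have "(\<lambda>n. z 0 + d n *\<^sub>R 1) \<longlonglongrightarrow> z 0 + l *\<^sub>R 1"
        by (intro tendsto_intros l)
      moreover have "(\<lambda>n. z 0 + d n *\<^sub>R 1) = z"
        by (rule ext) (rule zd[symmetric])
      ultimately show ?thesis
        by (auto simp: convergent_def)
    next
      case False
      have "p m n = a m - a n \<and> q m n = b m - b n" for m n
      proof -
        have e: "(p m n - (a m - a n)) *\<^sub>R 1 = ((b m - b n) - q m n) *\<^sub>R w"
          using eq[of m n] by (simp add: algebra_simps)
        have "(b m - b n) - q m n = 0"
        proof (rule ccontr)
          assume n0: "(b m - b n) - q m n \<noteq> 0"
          then have "w = ((p m n - (a m - a n)) / ((b m - b n) - q m n)) *\<^sub>R 1"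
            using arg_cong[OF e, of "\<lambda>v. (1 / ((b m - b n) - q m n)) *\<^sub>R v"] by simp
          then show False using False by blast
        qed
        then show ?thesis using e by simp
      qed
      then have nrm: "norm (z m - z n) = sqrt ((a m - a n)\<^sup>2 + (b m - b n)\<^sup>2)" for m n
        using pq[of m n] by simp
      have "\<bar>a m - a n\<bar> \<le> norm (z m - z n)" "\<bar>b m - b n\<bar> \<le> norm (z m - z n)" for m n
        by (simp_all add: nrm real_le_rsqrt)
      then have "Cauchy a" "Cauchy b"
        using assms unfolding Cauchy_iff real_norm_def by (meson order_le_less_trans)+
      then obtain l k where l: "a \<longlonglongrightarrow> l" "b \<longlonglongrightarrow> k"
        by (auto simp: Cauchy_convergent_iff convergent_def)
      have "(\<lambda>n. z 0 + (a n *\<^sub>R 1 + b n *\<^sub>R w)) \<longlonglongrightarrow> z 0 + (l *\<^sub>R 1 + k *\<^sub>R w)"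
        by (intro tendsto_intros l)
      moreover have "(\<lambda>n. z 0 + (a n *\<^sub>R 1 + b n *\<^sub>R w)) = z"
        by (rule ext) (rule z[symmetric])
      ultimately show ?thesis
        by (auto simp: convergent_def)
    qed
  qed
qed

text \<open>Needed for the coefficient series in the successive approximation below, whose terms lie
  in the scalar field.\<close>

lemma real_or_complex_summable:
  fixes z :: "nat \<Rightarrow> 'k::real_or_complex"
  assumes "summable (\<lambda>n. norm (z n))"
  shows "summable z"
proof -
  have "Cauchy (\<lambda>n. \<Sum>i<n. z i)"
  proof (rule CauchyI)
    fix e :: real assume e: "0 < e"
    then obtain N where N: "\<And>m n. m \<ge> N \<Longrightarrow> norm (\<Sum>i=m..<n. norm (z i)) < e"
      using assms summable_Cauchy by metis
    have *: "norm ((\<Sum>i<n. z i) - (\<Sum>i<m. z i)) < e" if "m \<ge> N" "n \<ge> m" for m n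
    proof -
      have "(\<Sum>i<n. z i) - (\<Sum>i<m. z i) = (\<Sum>i=m..<n. z i)"
        using sum_diff_nat_ivl[of 0 m n z] that by (simp add: atLeast0LessThan)
      then have "norm ((\<Sum>i<n. z i) - (\<Sum>i<m. z i)) \<le> (\<Sum>i=m..<n. norm (z i))"
        by (simp add: norm_sum)
      then show ?thesis using N[of m n] that by (simp add: sum_nonneg)
    qed
    show "\<exists>M. \<forall>m\<ge>M. \<forall>n\<ge>M. norm ((\<Sum>i<m. z i) - (\<Sum>i<n. z i)) < e"
      by (rule exI[of _ N]) (metis * linear norm_minus_commute)
  qed
  then show ?thesis
    using real_or_complex_convergent summable_iff_convergent by blast
qed

section \<open>Linear functionals, coordinates and a criterion for Schauder bases\<close>

context banach_space_over
begin

text \<open>Algebraic linearity only: the coordinates of a basis are linear by uniqueness of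
  expansions, whereas continuity is a separate matter and is always stated as a norm bound.\<close>

definition functional :: "('a \<Rightarrow> 'k) \<Rightarrow> bool" where
  "functional \<phi> \<longleftrightarrow> (\<forall>f g. \<phi> (f + g) = \<phi> f + \<phi> g) \<and> (\<forall>c f. \<phi> (smul c f) = c * \<phi> f)"

lemma functional_add: "functional \<phi> \<Longrightarrow> \<phi> (f + g) = \<phi> f + \<phi> g"
  and functional_smul: "functional \<phi> \<Longrightarrow> \<phi> (smul c f) = c * \<phi> f"
  by (auto simp: functional_def)

lemma functional_scaleR: "functional \<phi> \<Longrightarrow> \<phi> (r *\<^sub>R f) = r *\<^sub>R \<phi> f"
  by (metis functional_smul smul_of_real scaleR_conv_of_real)

lemma functional_0: "functional \<phi> \<Longrightarrow> \<phi> 0 = 0"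
  using functional_scaleR[of \<phi> 0 0] by simp

lemma functional_diff: "functional \<phi> \<Longrightarrow> \<phi> (f - g) = \<phi> f - \<phi> g"
  using functional_add[of \<phi> "f - g" g] by simp

lemma functional_sum: "functional \<phi> \<Longrightarrow> \<phi> (sum h F) = (\<Sum>i\<in>F. \<phi> (h i))"
  by (induction F rule: infinite_finite_induct) (auto simp: functional_0 functional_add)

lemma functional_bounded_linear:
  assumes "functional \<phi>" "\<And>f. norm (\<phi> f) \<le> K * norm f"
  shows "bounded_linear \<phi>"
  using assms by (intro bounded_linear_intro[where K=K])
    (auto simp: functional_add functional_scaleR mult.commute)

lemma smul_scaleR: "smul (r *\<^sub>R c) f = r *\<^sub>R smul c f" "smul c (r *\<^sub>R f) = r *\<^sub>R smul c f"
  by (metis scale_scale smul_of_real scaleR_conv_of_real)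
    (metis scale_scale smul_of_real mult.commute)

lemma tendsto_smul:
  assumes "(a \<longlongrightarrow> l) F"
  shows "((\<lambda>n. smul (a n) x) \<longlongrightarrow> smul l x) F"
proof (rule Lim_null_comparison[THEN LIM_zero_cancel])
  show "\<forall>\<^sub>F n in F. norm (smul (a n) x - smul l x) \<le> norm (a n - l) * norm x"
    by (simp add: norm_smul flip: scale_left_diff_distrib)
  show "((\<lambda>n. norm (a n - l) * norm x) \<longlongrightarrow> 0) F"
    using assms by (intro tendsto_mult_left_zero) (simp add: LIM_zero tendsto_norm_zero)
qed

lemma tendsto_smul_right:
  assumes "(f \<longlongrightarrow> l) F"
  shows "((\<lambda>n. smul c (f n)) \<longlongrightarrow> smul c l) F"
proof (rule Lim_null_comparison[THEN LIM_zero_cancel])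
  show "\<forall>\<^sub>F n in F. norm (smul c (f n) - smul c l) \<le> norm c * norm (f n - l)"
    by (simp add: norm_smul flip: scale_right_diff_distrib)
  show "((\<lambda>n. norm c * norm (f n - l)) \<longlongrightarrow> 0) F"
    using assms by (intro tendsto_mult_right_zero) (simp add: LIM_zero tendsto_norm_zero)
qed

lemma sums_smul_right: "f sums l \<Longrightarrow> (\<lambda>n. smul c (f n)) sums smul c l"
  unfolding sums_def by (drule tendsto_smul_right[of _ _ _ c]) (simp add: scale_sum_right)

lemma subspace_closure_span: "subspace (closure (span S))"
proof (rule subspaceI)
  show "0 \<in> closure (span S)"
    using span_zero closure_subset by blast
next
  fix f g assume "f \<in> closure (span S)" "g \<in> closure (span S)"
  then obtain u v where u: "\<And>n::nat. u n \<in> span S" "u \<longlonglongrightarrow> f"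
    and v: "\<And>n::nat. v n \<in> span S" "v \<longlonglongrightarrow> g"
    by (metis closure_sequential)
  then show "f + g \<in> closure (span S)"
    unfolding closure_sequential
    by (intro exI[of _ "\<lambda>n. u n + v n"]) (auto intro: span_add tendsto_add)
next
  fix f c assume "f \<in> closure (span S)"
  then obtain u where u: "\<And>n::nat. u n \<in> span S" "u \<longlonglongrightarrow> f"
    by (metis closure_sequential)
  then show "smul c f \<in> closure (span S)"
    unfolding closure_sequential
    by (intro exI[of _ "\<lambda>n. smul c (u n)"]) (auto intro: span_scale tendsto_smul_right)
qed

lemma closure_span_mono:
  assumes "S \<subseteq> closure (span T)"
  shows "closure (span S) \<subseteq> closure (span T)"
  using span_minimal[OF assms subspace_closure_span] closure_minimal by blast

lemma biorthogonal_sum: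
  assumes "\<And>i. functional (b' i)" "\<And>i j. b' i (b j) = (if i = j then 1 else 0)" "finite F"
  shows "b' i (\<Sum>j\<in>F. smul (a j) (b j)) = (if i \<in> F then a i else 0)"
proof -
  have "b' i (\<Sum>j\<in>F. smul (a j) (b j)) = (\<Sum>j\<in>F. if i = j then a j else 0)"
    by (auto simp: functional_sum[OF assms(1)] functional_smul[OF assms(1)] assms(2) intro!: sum.cong)
  then show ?thesis using assms(3) by simp
qed

lemma coord_eqI:
  assumes "schauder_basis smul b" "(\<lambda>n. smul (a n) (b n)) sums f"
  shows "coord smul b n f = a n"
proof -
  have "(THE a. (\<lambda>n. smul (a n) (b n)) sums f) = a"
    using assms unfolding schauder_basis_def by (intro the1_equality) auto
  then show ?thesis by (simp add: coord_def)
qed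

lemma coord_sums:
  assumes "schauder_basis smul b"
  shows "(\<lambda>n. smul (coord smul b n f) (b n)) sums f"
proof -
  obtain a where a: "(\<lambda>n. smul (a n) (b n)) sums f"
    using assms unfolding schauder_basis_def by blast
  then show ?thesis using coord_eqI[OF assms a] by simp
qed

lemma schauder_basis_nonzero:
  assumes "schauder_basis smul x"
  shows "x n \<noteq> 0"
proof
  assume z: "x n = 0"
  have "(\<lambda>m. smul (if m = n then 1 else 0) (x m)) = (\<lambda>m. 0)"
    using z by auto
  then have "(\<lambda>m. smul (if m = n then 1 else 0) (x m)) sums 0"
    by simp
  moreover have "(\<lambda>m. smul 0 (x m)) sums 0"
    by simp
  ultimately have "(1::'k) = 0"
    using coord_eqI[OF assms, of "\<lambda>m. if m = n then 1 else 0" 0 n]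
      coord_eqI[OF assms, of "\<lambda>m. 0" 0 n] by simp
  then show False by simp
qed

lemma functional_coord:
  assumes "schauder_basis smul x"
  shows "functional (coord smul x n)"
  unfolding functional_def
proof (intro conjI allI)
  fix f g
  have "(\<lambda>n. smul (coord smul x n f + coord smul x n g) (x n)) sums (f + g)"
    using sums_add[OF coord_sums[OF assms] coord_sums[OF assms]] by (simp add: scale_left_distrib)
  from coord_eqI[OF assms this]
  show "coord smul x n (f + g) = coord smul x n f + coord smul x n g" .
next
  fix c f
  have "(\<lambda>n. smul (c * coord smul x n f) (x n)) sums (smul c f)"
    using sums_smul_right[OF coord_sums[OF assms], where c=c] by simp
  from coord_eqI[OF assms this]
  show "coord smul x n (smul c f) = c * coord smul x n f" .
qed

text \<open>On the span of \<open>b\<close> the partial sums are eventually stationary; the uniform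
  bound \<open>C\<close> carries convergence over to the closure. Continuity of each
  \<open>b' i\<close> forces the coefficients of any convergent expansion.\<close>

lemma schauder_basisI:
  fixes b :: "nat \<Rightarrow> 'a" and b' :: "nat \<Rightarrow> 'a \<Rightarrow> 'k"
  assumes fn: "\<And>i. functional (b' i)"
    and bio: "\<And>i j. b' i (b j) = (if i = j then 1 else 0)"
    and bd: "\<And>i. \<exists>K. \<forall>f. norm (b' i f) \<le> K * norm f"
    and ps: "\<And>m f. norm (\<Sum>i<m. smul (b' i f) (b i)) \<le> C * norm f"
    and dense: "closure (span (range b)) = UNIV"
  shows "schauder_basis smul b" "coord smul b i f = b' i f"
proof -
  have sums: "(\<lambda>n. smul (b' n f) (b n)) sums f" for f
    unfolding sums_def
  proof (rule LIMSEQ_I)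
    fix e :: real assume e: "0 < e"
    \<comment> \<open>\<open>C\<close> carries no sign hypothesis, hence \<open>max C 0\<close>; the
      summand 1 pays for the error \<open>f - g\<close> itself.\<close>
    define d where "d = e / (2 * (max C 0 + 1))"
    have d: "0 < d" using e by (simp add: d_def)
    have "f \<in> closure (span (range b))" using dense by simp
    then obtain g where g: "g \<in> span (range b)" "norm (f - g) < d"
      using d unfolding closure_approachable dist_norm by (metis norm_minus_commute)
    have "\<exists>N. \<forall>m\<ge>N. (\<Sum>i<m. smul (b' i g) (b i)) = g"
      using g(1)
    proof (induction rule: span_induct_alt)
      case base
      then show ?case by (simp add: functional_0[OF fn])
    next
      case (step c v g)
      then obtain N j where N: "\<forall>m\<ge>N. (\<Sum>i<m. smul (b' i g) (b i)) = g" and j: "v = b j" by blast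
      have "(\<Sum>i<m. smul (b' i (smul c v + g)) (b i)) = smul c v + g" if "m \<ge> max N (Suc j)" for m
      proof -
        have "(\<Sum>i<m. smul (b' i (smul c v + g)) (b i)) =
          (\<Sum>i<m. if i = j then smul c (b i) else 0) + (\<Sum>i<m. smul (b' i g) (b i))"
          unfolding sum.distrib[symmetric]
          by (rule sum.cong) (auto simp: functional_add[OF fn] functional_smul[OF fn] bio j scale_left_distrib)
        then show ?thesis using that N j by simp
      qed
      then show ?case by blast
    qed
    then obtain N where N: "\<And>m. m \<ge> N \<Longrightarrow> (\<Sum>i<m. smul (b' i g) (b i)) = g" by blast
    have "norm ((\<Sum>i<m. smul (b' i f) (b i)) - f) < e" if "m \<ge> N" for m
    proof -
      have "(\<Sum>i<m. smul (b' i f) (b i)) - f = (\<Sum>i<m. smul (b' i (f - g)) (b i)) - (f - g)"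
        using N[OF that] by (simp add: functional_diff[OF fn] scale_left_diff_distrib sum_subtractf)
      then have "norm ((\<Sum>i<m. smul (b' i f) (b i)) - f) \<le> C * norm (f - g) + norm (f - g)"
        using norm_triangle_ineq4 ps[of "f - g" m] by (smt (verit))
      also have "\<dots> \<le> (max C 0 + 1) * norm (f - g)"
        by (simp add: distrib_right mult_right_mono)
      also have "\<dots> \<le> (max C 0 + 1) * d"
        using g(2) by (intro mult_left_mono) auto
      also have "\<dots> < e"
      proof -
        have "max C 0 + 1 > 0" by simp
        then have "(max C 0 + 1) * d = e / 2" unfolding d_def by (simp add: field_simps)
        then show ?thesis using e by simp
      qed
      finally show ?thesis .
    qed
    then show "\<exists>N. \<forall>m\<ge>N. norm ((\<Sum>i<m. smul (b' i f) (b i)) - f) < e" by blast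
  qed
  have uniq: "a = (\<lambda>n. b' n f)" if a: "(\<lambda>n. smul (a n) (b n)) sums f" for a f
  proof
    fix j
    obtain K where K: "\<And>f. norm (b' j f) \<le> K * norm f" using bd by blast
    have "(\<lambda>m. b' j (\<Sum>i<m. smul (a i) (b i))) \<longlonglongrightarrow> b' j f"
      by (rule bounded_linear.tendsto[OF functional_bounded_linear[OF fn K] a[unfolded sums_def]])
    moreover have "\<forall>\<^sub>F m in sequentially. b' j (\<Sum>i<m. smul (a i) (b i)) = a j"
      using eventually_gt_at_top[of j] by eventually_elim (simp add: biorthogonal_sum[OF fn bio])
    ultimately have "(\<lambda>m. a j) \<longlonglongrightarrow> b' j f"
      using tendsto_cong by force
    then show "a j = b' j f" by (simp add: LIMSEQ_const_iff)
  qed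
  show sb: "schauder_basis smul b"
    unfolding schauder_basis_def using sums uniq by metis
  show "coord smul b i f = b' i f"
    using coord_eqI[OF sb sums] .
qed

text \<open>The vectors of finite \<open>sup\<^sub>m \<parallel>S\<^sub>m f\<parallel>\<close> exhaust the space, so by Baire one of the balls for this larger norm is dense in
  a ball; successive approximation then produces the expansion of any given vector.\<close>

lemma schauder_basis_partial_sums_bounded:
  assumes sb: "schauder_basis smul x"
  obtains C where "\<And>m f. norm (\<Sum>i<m. smul (coord smul x i f) (x i)) \<le> C * norm f"
proof -
  define S where "S m f = (\<Sum>i<m. smul (coord smul x i f) (x i))" for m f
  define K where "K n = {f. \<forall>m. norm (S m f) \<le> real n}" for n
  note fn = functional_coord[OF sb]
  have S_add: "S m (f + g) = S m f + S m g" for m f g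
    by (simp add: S_def functional_add[OF fn] scale_left_distrib sum.distrib)
  have S_diff: "S m (f - g) = S m f - S m g" for m f g
    by (simp add: S_def functional_diff[OF fn] scale_left_diff_distrib sum_subtractf)
  have S_scaleR: "S m (r *\<^sub>R f) = r *\<^sub>R S m f" for m r f
    by (simp add: S_def functional_scaleR[OF fn] smul_scaleR scaleR_sum_right)
  have S_lim: "(\<lambda>m. S m f) \<longlonglongrightarrow> f" for f
    using coord_sums[OF sb, of f] unfolding sums_def S_def .
  have UN: "(\<Union>n. closure (K n)) = UNIV"
  proof -
    have "f \<in> (\<Union>n. closure (K n))" for f
    proof -
      obtain B where B: "\<And>m. norm (S m f) \<le> B"
        using convergent_imp_Bseq[OF convergentI[OF S_lim]] by (metis BseqD)
      obtain n where "B \<le> real n" using real_arch_simple by blast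
      then have "f \<in> K n" using B order_trans by (fastforce simp: K_def)
      then show ?thesis using closure_subset by blast
    qed
    then show ?thesis by blast
  qed
  have "\<exists>n. interior (closure (K n)) \<noteq> {}"
  proof (rule ccontr)
    assume "\<not> ?thesis"
    then have "euclidean interior_of (\<Union> (range (\<lambda>n. closure (K n)))) = {}"
      by (intro Baire_category_alt)
        (auto simp: completely_metrizable_space_euclidean)
    then show False using UN by simp
  qed
  then obtain n f0 e where e: "e > 0" and ball: "ball f0 e \<subseteq> closure (K n)"
    by (metis ex_in_conv mem_interior)
  \<comment> \<open>Subtracting an approximant of the centre \<open>f0\<close> from one of
    \<open>f0 + y\<close> moves the ball to the origin and doubles the bound
    \<open>n\<close>.\<close>
  have dense: "\<exists>g. (\<forall>m. norm (S m g) \<le> 2 * real n) \<and> norm (y - g) < d" if "norm y < e" "0 < d" for y d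
  proof -
    have "f0 + y \<in> closure (K n)" "f0 \<in> closure (K n)"
      using ball e that by (auto simp: subset_iff dist_norm)
    then obtain g h where g: "g \<in> K n" "norm (g - (f0 + y)) < d / 2" and h: "h \<in> K n" "norm (h - f0) < d / 2"
      unfolding closure_approachable dist_norm using \<open>0 < d\<close> by (metis half_gt_zero)
    have "norm (S m (g - h)) \<le> 2 * real n" for m
      using g(1) h(1) norm_triangle_ineq4[of "S m g" "S m h"] unfolding K_def S_diff
      by (smt (verit) mem_Collect_eq)
    moreover have yeq: "y - (g - h) = (h - f0) - (g - (f0 + y))" by simp
    have "norm (y - (g - h)) < d"
      unfolding yeq using norm_triangle_ineq4[of "h - f0" "g - (f0 + y)"] g(2) h(2) by linarith
    ultimately show ?thesis by blast
  qed
  \<comment> \<open>Scaling \<open>y\<close> to norm \<open>e / 2\<close> and back turns the bound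
    \<open>2 * n\<close> into \<open>4 * n / e\<close> times the norm of \<open>y\<close>.\<close>
  define L where "L = 4 * real n / e"
  have L: "L \<ge> 0" using e by (simp add: L_def)
  have approx: "\<exists>g. (\<forall>m. norm (S m g) \<le> L * norm y) \<and> norm (y - g) \<le> norm y / 2" for y
  proof (cases "y = 0")
    case True
    then show ?thesis using S_scaleR[of _ 0 0] by (intro exI[of _ 0]) auto
  next
    case False
    define r where "r = e / (2 * norm y)"
    have r: "r > 0" using e False by (simp add: r_def)
    have "norm (r *\<^sub>R y) < e" using e False by (simp add: r_def)
    then obtain g where g: "\<And>m. norm (S m g) \<le> 2 * real n" "norm (r *\<^sub>R y - g) < r * (norm y / 2)"
      using dense[of "r *\<^sub>R y" "r * (norm y / 2)"] r False by auto
    have "norm (S m ((1 / r) *\<^sub>R g)) \<le> L * norm y" for m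
    proof -
      have "norm (S m ((1 / r) *\<^sub>R g)) = norm (S m g) / r"
        using r by (simp add: S_scaleR divide_inverse)
      also have "\<dots> \<le> 2 * real n / r"
        using g(1) r by (simp add: divide_right_mono)
      also have "\<dots> = L * norm y"
        using e False by (simp add: r_def L_def)
      finally show ?thesis .
    qed
    moreover have "norm (y - (1 / r) *\<^sub>R g) \<le> norm y / 2"
    proof -
      have "y - (1 / r) *\<^sub>R g = (1 / r) *\<^sub>R (r *\<^sub>R y - g)"
        using r by (simp add: scaleR_diff_right)
      then have "norm (y - (1 / r) *\<^sub>R g) = norm (r *\<^sub>R y - g) / r"
        using r by (simp add: divide_inverse)
      also have "\<dots> \<le> r * (norm y / 2) / r"
        using g(2) r by (intro divide_right_mono) auto
      finally show ?thesis using r by simp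
    qed
    ultimately show ?thesis by blast
  qed
  then obtain G where G: "\<And>y m. norm (S m (G y)) \<le> L * norm y" "\<And>y. norm (y - G y) \<le> norm y / 2"
    by metis
  have "norm (S m f) \<le> 2 * L * norm f" for m f
  proof -
    define r where "r k = ((\<lambda>y. y - G y) ^^ k) f" for k
    define g where "g k = G (r k)" for k
    define M where "M k = L * norm f * (1/2) ^ k" for k :: nat
    have r_Suc: "r (Suc k) = r k - g k" for k by (simp add: r_def g_def)
    have r_bd: "norm (r k) \<le> norm f * (1/2) ^ k" for k
    proof (induction k)
      case (Suc k)
      have "norm (r (Suc k)) \<le> norm (r k) / 2" unfolding r_Suc g_def by (rule G(2))
      then show ?case using Suc by simp
    qed (simp add: r_def)
    have Sg: "norm (S m (g k)) \<le> M k" for m k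
    proof -
      have "norm (S m (g k)) \<le> L * norm (r k)" unfolding g_def by (rule G(1))
      also have "\<dots> \<le> L * (norm f * (1/2) ^ k)" using r_bd L by (rule mult_left_mono)
      finally show ?thesis by (simp add: M_def)
    qed
    have "(\<lambda>k. L * norm f * (1/2) ^ k) sums (L * norm f * (1 / (1 - 1/2)))"
      by (intro sums_mult geometric_sums) simp
    then have M: "summable M" "suminf M = 2 * L * norm f"
      unfolding M_def by (auto simp: sums_iff)
    have g_le: "norm (g k) \<le> M k" for k
      by (rule LIMSEQ_le_const2[OF tendsto_norm[OF S_lim]]) (use Sg in blast)
    have "(\<Sum>k<N. g k) = f - r N" for N
      by (induction N) (simp_all add: r_Suc, simp add: r_def)
    moreover have "r \<longlonglongrightarrow> 0"
      by (rule Lim_null_comparison[of _ "\<lambda>k. norm f * (1/2) ^ k"])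
        (auto intro!: always_eventually r_bd tendsto_mult_right_zero LIMSEQ_power_zero)
    ultimately have g_sums: "g sums f"
      using tendsto_diff[OF tendsto_const[of f]] unfolding sums_def by force
    have sumS: "summable (\<lambda>k. S m (g k))" for m
      using Sg by (intro summable_comparison_test'[OF M(1), of 0]) auto
    have S_le: "norm (\<Sum>k. S m (g k)) \<le> 2 * L * norm f" for m
      using norm_suminf_le[OF Sg M(1)] M(2) by simp
    \<comment> \<open>One term of an expansion is a difference of two partial sums, so its
      coefficient inherits the geometric decay of \<open>M k\<close>. This produces the candidate
      coefficients \<open>a i\<close> of \<open>f\<close> before any continuity of the coordinates
      is known.\<close>
    have co: "summable (\<lambda>k. coord smul x i (g k))" for i
    proof (rule real_or_complex_summable)
      have "norm (coord smul x i (g k)) \<le> (2 / norm (x i)) * M k" for k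
      proof -
        have "smul (coord smul x i (g k)) (x i) = S (Suc i) (g k) - S i (g k)"
          by (simp add: S_def)
        then have "norm (coord smul x i (g k)) * norm (x i) \<le> M k + M k"
          using Sg[of "Suc i" k] Sg[of i k] norm_triangle_ineq4 unfolding norm_smul[symmetric]
          by (smt (verit))
        then show ?thesis using schauder_basis_nonzero[OF sb] by (simp add: field_simps)
      qed
      then show "summable (\<lambda>k. norm (coord smul x i (g k)))"
        by (intro summable_comparison_test'[OF summable_mult[OF M(1), of "2 / norm (x i)"], of 0]) simp_all
    qed
    define a where "a i = (\<Sum>k. coord smul x i (g k))" for i
    have Sa: "(\<Sum>i<m. smul (a i) (x i)) = (\<Sum>k. S m (g k))" for m
    proof -
      have "(\<lambda>k. smul (coord smul x i (g k)) (x i)) sums smul (a i) (x i)" for i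
        using tendsto_smul[OF summable_LIMSEQ[OF co[of i]], of "x i"]
        unfolding sums_def a_def by (simp add: scale_sum_left)
      then have "(\<lambda>k. S m (g k)) sums (\<Sum>i<m. smul (a i) (x i))"
        unfolding S_def by (intro sums_sum)
      then show ?thesis by (simp add: sums_iff)
    qed
    \<comment> \<open>The bound \<open>M k\<close> does not depend on \<open>m\<close>, so the
      limits in \<open>N\<close> and \<open>m\<close> may be exchanged. The exchange shows that the
      candidate coefficients do expand \<open>f\<close>; uniqueness then identifies them with its
      coordinates.\<close>
    have "uniform_limit UNIV (\<lambda>N m. \<Sum>k<N. S m (g k)) (\<lambda>m. \<Sum>k. S m (g k)) sequentially"
      using Sg M by (intro Weierstrass_m_test) auto
    then have "(\<lambda>m. \<Sum>k. S m (g k)) \<longlonglongrightarrow> (\<Sum>k. g k)"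
    proof (rule swap_uniform_limit'[rotated 2])
      show "\<forall>\<^sub>F N in sequentially. (\<lambda>m. \<Sum>k<N. S m (g k)) \<longlonglongrightarrow> (\<Sum>k<N. g k)"
        by (intro always_eventually allI tendsto_sum S_lim)
      show "(\<lambda>N. \<Sum>k<N. g k) \<longlonglongrightarrow> (\<Sum>k. g k)"
        using sums_summable[OF g_sums] by (rule summable_LIMSEQ)
    qed auto
    then have "(\<lambda>i. smul (a i) (x i)) sums f"
      using g_sums by (simp add: sums_def[of "\<lambda>i. smul (a i) (x i)"] Sa sums_iff)
    then have "coord smul x i f = a i" for i
      using coord_eqI[OF sb] by blast
    then have "S m f = (\<Sum>k. S m (g k))"
      unfolding S_def[of m f] using Sa by simp
    then show ?thesis using S_le by simp
  qed
  then show ?thesis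
    unfolding S_def by (rule that)
qed

end

section \<open>Dyadic blocks\<close>

text \<open>As \<open>Suc i\<close> runs through 1, 2, ..., the blocks are consecutive intervals of
  lengths 1, 2, 4, .... Thus \<open>lead n\<close> is both the first index of \<open>block n\<close>
  and the total number of indices in the earlier blocks.\<close>

definition blk :: "nat \<Rightarrow> nat" where "blk i = floor_log (Suc i)"

definition block :: "nat \<Rightarrow> nat set" where "block n = {2 ^ n - 1..<2 ^ Suc n - 1}"

definition lead :: "nat \<Rightarrow> nat" where "lead n = 2 ^ n - 1"

lemma blk_bounds: "2 ^ blk i \<le> Suc i" "Suc i < 2 * 2 ^ blk i"
  unfolding blk_def by (simp_all add: floor_log_exp2_le floor_log_exp2_gt)

lemma blk_eqI: "2 ^ n \<le> Suc i \<Longrightarrow> Suc i < 2 * 2 ^ n \<Longrightarrow> blk i = n"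
  unfolding blk_def by (rule floor_log_eqI) auto

lemma lead_Suc: "lead (Suc n) = lead n + 2 ^ n" and Suc_lead: "Suc (lead n) = 2 ^ n"
  by (simp_all add: lead_def mult_2)

lemma block_altdef: "block n = {lead n..<lead (Suc n)}"
  by (simp add: block_def lead_def)

lemma mem_block_iff: "i \<in> block n \<longleftrightarrow> blk i = n"
proof
  assume "i \<in> block n"
  then have "2 ^ n \<le> Suc i" "Suc i < 2 * 2 ^ n"
    using Suc_lead[of n] Suc_lead[of "Suc n"] unfolding block_altdef by auto
  then show "blk i = n" by (rule blk_eqI)
next
  assume "blk i = n"
  then show "i \<in> block n"
    using blk_bounds[of i] Suc_lead[of n] Suc_lead[of "Suc n"] unfolding block_altdef by auto
qed

lemma blk_lead [simp]: "blk (lead n) = n"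
  by (rule blk_eqI) (simp_all add: Suc_lead)

lemma lead_mem_block [simp]: "lead n \<in> block n"
  by (simp add: mem_block_iff)

lemma finite_block [simp]: "finite (block n)" and card_block [simp]: "card (block n) = 2 ^ n"
  by (simp_all add: block_altdef lead_Suc)

lemma inj_lead: "inj lead"
  by (metis blk_lead injI)

lemma lead_mono: "m \<le> n \<Longrightarrow> lead m \<le> lead n"
  by (simp add: lead_def diff_le_mono)

lemma le_lead: "n \<le> lead n"
  unfolding lead_def using less_exp[of n] by linarith

lemma less_lead_iff: "i < lead M \<longleftrightarrow> blk i < M"
proof
  assume "i < lead M"
  then have "2 ^ blk i < (2::nat) ^ M"
    using blk_bounds(1)[of i] Suc_lead[of M] by linarith
  then show "blk i < M" by simp
next
  assume "blk i < M"
  then have "lead (Suc (blk i)) \<le> lead M"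
    by (intro lead_mono) simp
  then show "i < lead M"
    using blk_bounds(2)[of i] Suc_lead[of "Suc (blk i)"] by simp
qed

lemma finite_subset_lead:
  assumes "finite F" obtains M where "F \<subseteq> {..<lead M}"
proof -
  obtain M where "F \<subseteq> {..<M}" using assms finite_nat_iff_bounded by blast
  then show ?thesis using le_lead[of M] by (intro that[of M]) auto
qed

lemma lessThan_lead_Suc: "{..<lead (Suc M)} = {..<lead M} \<union> block M" "{..<lead M} \<inter> block M = {}"
  by (auto simp: block_altdef lead_Suc)

lemma sum_lessThan_lead: "(\<Sum>i<lead M. g i) = (\<Sum>n<M. \<Sum>i\<in>block n. g i)"
proof (induction M)
  case (Suc M)
  then show ?case by (simp add: lessThan_lead_Suc sum.union_disjoint)
qed (simp add: lead_def)

lemma sum_lead_split: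
  "(\<Sum>i<lead M. g i) = (\<Sum>n<M. g (lead n)) + (\<Sum>i\<in>{..<lead M} - range lead. g i)"
proof -
  have "{..<lead M} \<inter> range lead = lead ` {..<M}"
    by (auto simp: less_lead_iff)
  then have "(\<Sum>i\<in>{..<lead M} \<inter> range lead. g i) = (\<Sum>n<M. g (lead n))"
    using inj_lead by (simp add: sum.reindex inj_on_subset)
  then show ?thesis
    using sum.Int_Diff[of "{..<lead M}" g "range lead"] by simp
qed

lemma block_Diff_lead: "block n - {lead n} = block n - range lead"
  by (auto simp: mem_block_iff)

section \<open>A Householder matrix\<close>

text \<open>The reflection of \<open>\<ell>\<^sub>2(block n)\<close> that interchanges the unit vector at \<open>lead n\<close> and the
  normalised constant vector. For \<open>n = 0\<close> both vectors coincide, and the division by \<open>0\<close> makes the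
  matrix the identity.\<close>

definition wt :: "nat \<Rightarrow> real" where "wt n = 1 / sqrt (2 ^ n)"

definition hvec :: "nat \<Rightarrow> nat \<Rightarrow> real" where
  "hvec n i = (if i = lead n then 1 else 0) - wt n"

definition hh :: "nat \<Rightarrow> nat \<Rightarrow> nat \<Rightarrow> real" where
  "hh n i j = (if i = j then 1 else 0) - hvec n i * hvec n j / (1 - wt n)"

lemma wt_pos: "0 < wt n" and wt_le_1: "wt n \<le> 1" and wt_sq: "(wt n)\<^sup>2 = 1 / 2 ^ n"
  by (simp_all add: wt_def power_divide)

lemma wt_0 [simp]: "wt 0 = 1"
  by (simp add: wt_def)

lemma wt_less_1: "n > 0 \<Longrightarrow> wt n < 1"
  by (simp add: wt_def)

lemma hh_sym: "hh n i j = hh n j i"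
  by (simp add: hh_def)

text \<open>This is why \<open>hh\<close> has the denominator \<open>1 - wt n\<close>: the
  reflection along a vector v is I - 2 v v^T / |v|^2.\<close>

lemma sum_hvec_sq: "(\<Sum>i\<in>block n. (hvec n i)\<^sup>2) = 2 * (1 - wt n)"
proof -
  have "(\<Sum>i\<in>block n. (hvec n i)\<^sup>2) =
      (\<Sum>i\<in>block n. (if i = lead n then 1 - 2 * wt n else 0) + (wt n)\<^sup>2)"
    by (rule sum.cong) (auto simp: hvec_def power2_diff)
  also have "\<dots> = 1 - 2 * wt n + 2 ^ n * (wt n)\<^sup>2"
    by (simp add: sum.distrib)
  finally show ?thesis by (simp add: wt_sq)
qed

text \<open>The unit vector at \<open>lead n\<close> is reflected to the normalised constant vector;
  through this column the weight \<open>wt n\<close> enters the estimates of the rotated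
  system.\<close>

lemma hh_lead: "i \<in> block n \<Longrightarrow> hh n i (lead n) = wt n"
proof (cases "n = 0")
  case True
  assume "i \<in> block n"
  then have "i = lead n" using True by (simp add: block_def lead_def)
  then show ?thesis using True by (simp add: hh_def)
next
  case False
  then show ?thesis
    using wt_less_1[of n] by (simp add: hh_def hvec_def)
qed

lemma hh_square:
  assumes "i \<in> block n" "k \<in> block n"
  shows "(\<Sum>j\<in>block n. hh n i j * hh n j k) = (if i = k then 1 else 0)"
proof -
  define q where "q = 1 - wt n"
  have "(\<Sum>j\<in>block n. hh n i j * hh n j k) =
      (\<Sum>j\<in>block n. (if j = i then (if i = k then 1 else 0) else 0) - (if j = i then hvec n i * hvec n k / q else 0)
         - (if j = k then hvec n i * hvec n k / q else 0) + hvec n i * hvec n k / q\<^sup>2 * (hvec n j)\<^sup>2)"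
    by (rule sum.cong) (auto simp: hh_def q_def[symmetric] algebra_simps power2_eq_square)
  also have "\<dots> = (if i = k then 1 else 0) - 2 * (hvec n i * hvec n k / q) + hvec n i * hvec n k / q\<^sup>2 * (2 * q)"
    using assms by (simp add: sum.distrib sum_subtractf sum_hvec_sq q_def flip: sum_distrib_left sum_divide_distrib)
  also have "\<dots> = (if i = k then 1 else 0)"
    by (simp add: power2_eq_square)
  finally show ?thesis .
qed

text \<open>The entries \<open>a j\<close> lie in a normed space without inner product, so
  orthogonality is replaced by a bound independent of \<open>n\<close>: the matrix is the identity
  minus a rank one term, and Cauchy-Schwarz bounds that term by 2 in the l2 sense, which gives (1 +
  2)^2 = 9.\<close>

lemma hh_bound:
  fixes a :: "nat \<Rightarrow> 'v::real_normed_vector"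
  shows "(\<Sum>i\<in>block n. (norm (\<Sum>j\<in>block n. hh n i j *\<^sub>R a j))\<^sup>2) \<le> 9 * (\<Sum>j\<in>block n. (norm (a j))\<^sup>2)"
proof -
  define q where "q = 1 - wt n"
  define W where "W = (\<Sum>j\<in>block n. hvec n j *\<^sub>R a j)"
  define S where "S = (\<Sum>j\<in>block n. (norm (a j))\<^sup>2)"
  have q: "q \<ge> 0" using wt_le_1 by (simp add: q_def)
  have W: "(norm W)\<^sup>2 \<le> 2 * q * S"
  proof -
    have "norm W \<le> (\<Sum>j\<in>block n. \<bar>hvec n j\<bar> * norm (a j))"
      unfolding W_def by (rule order_trans[OF norm_sum]) simp
    then have "(norm W)\<^sup>2 \<le> (\<Sum>j\<in>block n. \<bar>hvec n j\<bar> * norm (a j))\<^sup>2"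
      by (intro power_mono) auto
    also have "\<dots> \<le> (\<Sum>j\<in>block n. \<bar>hvec n j\<bar>\<^sup>2) * (\<Sum>j\<in>block n. (norm (a j))\<^sup>2)"
      by (rule Cauchy_Schwarz_ineq_sum)
    finally show ?thesis by (simp add: sum_hvec_sq S_def q_def)
  qed
  have row: "(norm (\<Sum>j\<in>block n. hh n i j *\<^sub>R a j))\<^sup>2 \<le> 3 * (norm (a i))\<^sup>2 + (3/2) * ((hvec n i)\<^sup>2 / q\<^sup>2 * (norm W)\<^sup>2)"
    if "i \<in> block n" for i
  proof -
    have "(\<Sum>j\<in>block n. hh n i j *\<^sub>R a j) = (\<Sum>j\<in>block n. (if j = i then a j else 0) - (hvec n i / q) *\<^sub>R (hvec n j *\<^sub>R a j))"
      by (rule sum.cong) (auto simp: hh_def q_def scaleR_left_diff_distrib)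
    also have "\<dots> = a i - (hvec n i / q) *\<^sub>R W"
      using that by (simp add: sum_subtractf W_def scaleR_sum_right)
    finally have "norm (\<Sum>j\<in>block n. hh n i j *\<^sub>R a j) \<le> norm (a i) + \<bar>hvec n i / q\<bar> * norm W"
      using norm_triangle_ineq4[of "a i" "(hvec n i / q) *\<^sub>R W"] by simp
    then have "(norm (\<Sum>j\<in>block n. hh n i j *\<^sub>R a j))\<^sup>2 \<le> (norm (a i) + \<bar>hvec n i / q\<bar> * norm W)\<^sup>2"
      by (intro power_mono) auto
    \<comment> \<open>The weights 3 and 3/2 are optimal for summands of sizes 1 and 2: they give 3 *
      1 + (3/2) * 4 = 9.\<close>
    also have "\<dots> \<le> 3 * (norm (a i))\<^sup>2 + (3/2) * (\<bar>hvec n i / q\<bar> * norm W)\<^sup>2"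
    proof -
      have "(x + y)\<^sup>2 \<le> 3 * x\<^sup>2 + (3/2) * y\<^sup>2" for x y :: real
        using zero_le_power2[of "2 * x - y"] by (simp add: power2_eq_square algebra_simps)
      then show ?thesis .
    qed
    finally show ?thesis by (simp add: power_mult_distrib power_divide)
  qed
  have "(\<Sum>i\<in>block n. (norm (\<Sum>j\<in>block n. hh n i j *\<^sub>R a j))\<^sup>2)
      \<le> (\<Sum>i\<in>block n. 3 * (norm (a i))\<^sup>2 + (3/2) * ((hvec n i)\<^sup>2 / q\<^sup>2 * (norm W)\<^sup>2))"
    by (rule sum_mono) (rule row)
  also have "\<dots> = 3 * S + (3/2) * (2 * q / q\<^sup>2 * (norm W)\<^sup>2)"
    by (simp add: sum.distrib S_def sum_hvec_sq q_def flip: sum_distrib_left sum_distrib_right sum_divide_distrib)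
  also have "\<dots> \<le> 3 * S + 6 * S"
  proof (cases "q = 0")
    case True
    then show ?thesis by (simp add: S_def sum_nonneg)
  next
    case False
    then have "2 * q / q\<^sup>2 * (norm W)\<^sup>2 \<le> 2 * q / q\<^sup>2 * (2 * q * S)"
      using W q by (intro mult_left_mono) auto
    also have "\<dots> = 4 * S" using False by (simp add: power2_eq_square)
    finally show ?thesis by simp
  qed
  finally show ?thesis by (simp add: S_def)
qed

section \<open>Sums of antitone weights\<close>

text \<open>The largest element of a set of \<open>m + 1\<close> naturals is at least
  \<open>m\<close>, so moving it to position \<open>m\<close> can only increase an antitone
  weight.\<close>

lemma sum_antimono_le_initial:
  fixes g :: "nat \<Rightarrow> real"
  assumes "antimono g" "finite F"
  shows "sum g F \<le> sum g {..<card F}"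
  using assms(2)
proof (induction "card F" arbitrary: F)
  case (Suc m)
  have F: "F \<noteq> {}" "finite F" using Suc by auto
  define x where "x = Max F"
  have x: "x \<in> F" using F by (simp add: x_def)
  have c: "card (F - {x}) = m" using Suc F x by simp
  have "F \<subseteq> {..x}" using F by (auto simp: x_def)
  then have "card F \<le> Suc x" using card_mono[of "{..x}" F] by simp
  then have "m \<le> x" using Suc by simp
  then have "g x \<le> g m" using assms(1) by (simp add: antimonoD)
  moreover have "sum g (F - {x}) \<le> sum g {..<m}" using Suc(1)[of "F - {x}"] c F by simp
  moreover have "sum g F = g x + sum g (F - {x})" using F x by (simp add: sum.remove)
  ultimately show ?case using Suc(2)[symmetric] by simp
qed simp

lemma sum_inverse_sqrt_le: "(\<Sum>i<m. 1 / sqrt (real (Suc i))) \<le> 2 * sqrt (real m)"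
proof (induction m)
  case (Suc m)
  have "1 / sqrt (real (Suc m)) \<le> 2 * (sqrt (real (Suc m)) - sqrt (real m))"
  proof -
    define u where "u = sqrt (real (Suc m))"
    define v where "v = sqrt (real m)"
    have uv: "u > 0" "v \<ge> 0" "v \<le> u" "u * u - v * v = 1"
      by (auto simp: u_def v_def)
    have "1 = (u - v) * (u + v)" using uv(4) by (simp add: algebra_simps)
    also have "\<dots> \<le> (u - v) * (2 * u)" using uv by (intro mult_left_mono) auto
    finally have "1 / u \<le> 2 * (u - v)"
      using uv(1) by (simp only: pos_divide_le_eq)
    then show ?thesis unfolding u_def v_def .
  qed
  then show ?case using Suc by simp
qed simp

lemma wt_blk_le: "wt (blk i) \<le> sqrt 2 / sqrt (real (Suc i))"
proof -
  have "real (Suc i) \<le> real (2 * 2 ^ blk i)"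
    using blk_bounds(2)[of i] by (intro of_nat_mono) simp
  then have "real (Suc i) \<le> 2 * 2 ^ blk i"
    by (simp only: of_nat_mult of_nat_numeral of_nat_power)
  then have "sqrt (real (Suc i)) \<le> sqrt 2 * sqrt (2 ^ blk i)"
    by (simp flip: real_sqrt_mult)
  then show ?thesis
    by (simp add: wt_def field_simps)
qed

text \<open>Here the exponential growth of the blocks pays off: \<open>wt (blk i)\<close> is of
  order \<open>1 / sqrt (Suc i)\<close>, and the worst set of given size is an initial segment. The
  constant 3 absorbs 2 sqrt 2.\<close>

lemma sum_wt_blk_le:
  assumes "finite F"
  shows "(\<Sum>i\<in>F. wt (blk i)) \<le> 3 * sqrt (real (card F))"
proof -
  have "antimono (\<lambda>i. 1 / sqrt (real (Suc i)))"
    by (auto intro!: antimonoI simp: frac_le)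
  then have "(\<Sum>i\<in>F. 1 / sqrt (real (Suc i))) \<le> 2 * sqrt (real (card F))"
    using sum_antimono_le_initial[OF _ assms] sum_inverse_sqrt_le[of "card F"] by (meson order_trans)
  then have "sqrt 2 * (\<Sum>i\<in>F. 1 / sqrt (real (Suc i))) \<le> sqrt 2 * (2 * sqrt (real (card F)))"
    by (intro mult_left_mono) auto
  moreover have "(\<Sum>i\<in>F. wt (blk i)) \<le> sqrt 2 * (\<Sum>i\<in>F. 1 / sqrt (real (Suc i)))"
    unfolding sum_distrib_left by (rule sum_mono) (use wt_blk_le in simp)
  moreover have "sqrt 2 * (2 * sqrt (real (card F))) \<le> 3 * sqrt (real (card F))"
  proof -
    have "sqrt 2 * 2 \<le> (3::real)"
      by (rule power2_le_imp_le) (simp_all add: power_mult_distrib)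
    then show ?thesis by (metis mult.assoc mult_right_mono real_sqrt_ge_zero of_nat_0_le_iff)
  qed
  ultimately show ?thesis by linarith
qed

section \<open>Systems made of a conditional basis and of an orthonormal sequence\<close>

text \<open>The vectors \<open>c (lead n)\<close> form a basic sequence and the remaining ones are equivalent to the unit
  vector basis of \<open>\<ell>\<^sub>2\<close>; each block contains exactly one of the former.\<close>

locale dkk = banach_space_over smul for smul :: "'k::real_or_complex \<Rightarrow> 'a::banach \<Rightarrow> 'a" +
  fixes c :: "nat \<Rightarrow> 'a" and c' :: "nat \<Rightarrow> 'a \<Rightarrow> 'k" and K :: real
  assumes fn: "functional (c' i)"
    and bio: "c' i (c j) = (if i = j then 1 else 0)"
    and c'_le: "norm (c' i f) \<le> K * norm f"
    and c_le: "norm (c i) \<le> K"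
    and l2_lower: "finite F \<Longrightarrow> F \<inter> range lead = {} \<Longrightarrow> (\<Sum>i\<in>F. (norm (c' i f))\<^sup>2) \<le> (K * norm f)\<^sup>2"
    and l2_upper: "finite F \<Longrightarrow> F \<inter> range lead = {} \<Longrightarrow>
      norm (\<Sum>i\<in>F. smul (a i) (c i)) \<le> K * sqrt (\<Sum>i\<in>F. (norm (a i))\<^sup>2)"
    and lead_sums: "norm (\<Sum>n<M. smul (c' (lead n) f) (c (lead n))) \<le> K * norm f"
    and dense: "closure (span (range c)) = UNIV"
begin

definition b :: "nat \<Rightarrow> 'a" where
  "b i = (\<Sum>j\<in>block (blk i). hh (blk i) i j *\<^sub>R c j)"

text \<open>The dual system is rotated by the same matrix as \<open>b\<close>, since
  \<open>hh\<close> is symmetric and its own inverse.\<close>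

definition b' :: "nat \<Rightarrow> 'a \<Rightarrow> 'k" where
  "b' i f = (\<Sum>j\<in>block (blk i). hh (blk i) i j *\<^sub>R c' j f)"

text \<open>The subtracted term is the average of the coefficients \<open>b' i f\<close> over the
  block of \<open>i\<close>, because \<open>c' (lead n) f\<close> is \<open>wt n\<close> times their
  sum and \<open>wt n\<close> squared is 1 / 2^n.\<close>

definition dev :: "nat \<Rightarrow> 'a \<Rightarrow> 'k" where
  "dev i f = b' i f - wt (blk i) *\<^sub>R c' (lead (blk i)) f"

lemma K_ge_1: "1 \<le> K"
proof -
  have "0 \<le> K" using c_le[of 0] norm_ge_zero order_trans by blast
  have "1 = norm (c' 0 (c 0))" by (simp add: bio)
  also have "\<dots> \<le> K * norm (c 0)" by (rule c'_le)
  also have "\<dots> \<le> K * K" using c_le \<open>0 \<le> K\<close> by (intro mult_left_mono)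
  finally have "1 \<le> K * K" .
  then show ?thesis using mult_left_mono[of K 1 K] \<open>0 \<le> K\<close> by (cases "K \<le> 1") auto
qed

lemma fn_b': "functional (b' i)"
  unfolding functional_def b'_def
  by (simp add: functional_add[OF fn] functional_smul[OF fn] scaleR_add_right sum.distrib sum_distrib_left)

lemma c'_b: "c' j (b i) = (if blk i = blk j then of_real (hh (blk i) i j) else 0)"
proof -
  have "c' j (b i) = (\<Sum>k\<in>block (blk i). if k = j then of_real (hh (blk i) i j) else 0)"
    unfolding b_def functional_sum[OF fn] functional_scaleR[OF fn] bio
    by (rule sum.cong) (auto simp: of_real_def)
  then show ?thesis by (auto simp: mem_block_iff)
qed

lemma bio_b: "b' i (b k) = (if i = k then 1 else 0)"
proof -
  have "b' i (b k) = (\<Sum>j\<in>block (blk i). if blk i = blk k then of_real (hh (blk i) i j * hh (blk i) j k) else 0)"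
    unfolding b'_def by (rule sum.cong)
      (auto simp: c'_b mem_block_iff scaleR_conv_of_real hh_sym[of _ k])
  also have "\<dots> = (if i = k then 1 else 0)"
  proof (cases "blk i = blk k")
    case True
    then have "(\<Sum>j\<in>block (blk i). if blk i = blk k then of_real (hh (blk i) i j * hh (blk i) j k) else 0) =
        (of_real (\<Sum>j\<in>block (blk i). hh (blk i) i j * hh (blk i) j k) :: 'k)"
      by (simp add: of_real_sum)
    also have "\<dots> = of_real (if i = k then 1 else 0)"
      using True by (subst hh_square) (auto simp: mem_block_iff)
    finally show ?thesis by simp
  qed auto
  finally show ?thesis .
qed

lemma c'_eq:
  assumes "j \<in> block n"
  shows "c' j f = (\<Sum>i\<in>block n. hh n j i *\<^sub>R b' i f)"
proof -
  have "(\<Sum>i\<in>block n. hh n j i *\<^sub>R b' i f) = (\<Sum>i\<in>block n. \<Sum>k\<in>block n. (hh n j i * hh n i k) *\<^sub>R c' k f)"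
    unfolding b'_def by (rule sum.cong) (auto simp: mem_block_iff scaleR_sum_right)
  also have "\<dots> = (\<Sum>k\<in>block n. (\<Sum>i\<in>block n. hh n j i * hh n i k) *\<^sub>R c' k f)"
    by (subst sum.swap) (simp add: scaleR_sum_left)
  also have "\<dots> = (\<Sum>k\<in>block n. if j = k then c' k f else 0)"
    using assms by (intro sum.cong) (auto simp: hh_square)
  finally show ?thesis using assms by simp
qed

section \<open>Norm estimates for sums of the rotated vectors\<close>

lemma synthesis_block:
  "(\<Sum>i\<in>block n. smul (a i) (b i)) = (\<Sum>j\<in>block n. smul (\<Sum>i\<in>block n. hh n j i *\<^sub>R a i) (c j))"
proof -
  have "(\<Sum>i\<in>block n. smul (a i) (b i)) = (\<Sum>i\<in>block n. \<Sum>j\<in>block n. smul (hh n j i *\<^sub>R a i) (c j))"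
    unfolding b_def by (rule sum.cong) (auto simp: mem_block_iff scale_sum_right smul_scaleR hh_sym[of _ i for i])
  also have "\<dots> = (\<Sum>j\<in>block n. \<Sum>i\<in>block n. smul (hh n j i *\<^sub>R a i) (c j))"
    by (rule sum.swap)
  finally show ?thesis by (simp add: scale_sum_left)
qed

lemma synthesis_lead:
  "(\<Sum>i<lead M. smul (a i) (b i)) =
    (\<Sum>j<lead M. smul (\<Sum>i\<in>block (blk j). hh (blk j) j i *\<^sub>R a i) (c j))"
  unfolding sum_lessThan_lead synthesis_block by (intro sum.cong) (auto simp: mem_block_iff)

text \<open>After undoing the rotation, the coefficient at \<open>lead n\<close> is a
  \<open>wt n\<close>-weighted sum over the block and is treated by the triangle inequality. The
  other coefficients are square summable, and \<open>hh_bound\<close> contributes the factor 3 =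
  sqrt 9.\<close>

lemma norm_sum_b_le:
  assumes F: "finite F"
  shows "norm (\<Sum>i\<in>F. smul (a i) (b i)) \<le>
    K * ((\<Sum>i\<in>F. norm (a i) * wt (blk i)) + 3 * sqrt (\<Sum>i\<in>F. (norm (a i))\<^sup>2))"
proof -
  obtain M where M: "F \<subseteq> {..<lead M}" using finite_subset_lead[OF F] .
  \<comment> \<open>The rotation mixes whole blocks, so the coefficients are extended by zero to
    full blocks.\<close>
  define a0 where "a0 i = (if i \<in> F then a i else 0)" for i
  define \<alpha> where "\<alpha> j = (\<Sum>i\<in>block (blk j). hh (blk j) j i *\<^sub>R a0 i)" for j
  have restr: "(\<Sum>i<lead M. h i (a0 i)) = (\<Sum>i\<in>F. h i (a i))" if "\<And>i. h i 0 = 0" for h :: "nat \<Rightarrow> 'k \<Rightarrow> 'z::comm_monoid_add"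
    using M F by (intro sum.mono_neutral_cong_right) (auto simp: a0_def that)
  have "(\<Sum>i\<in>F. smul (a i) (b i)) = (\<Sum>i<lead M. smul (a0 i) (b i))"
    using restr[of "\<lambda>i y. smul y (b i)"] by simp
  also have "\<dots> = (\<Sum>j<lead M. smul (\<alpha> j) (c j))"
    by (simp add: synthesis_lead \<alpha>_def)
  also have "\<dots> = (\<Sum>n<M. smul (\<alpha> (lead n)) (c (lead n))) + (\<Sum>j\<in>{..<lead M} - range lead. smul (\<alpha> j) (c j))"
    by (rule sum_lead_split)
  also have "norm \<dots> \<le> K * (\<Sum>i\<in>F. norm (a i) * wt (blk i)) + K * (3 * sqrt (\<Sum>i\<in>F. (norm (a i))\<^sup>2))"
  proof (rule norm_triangle_mono)
    have "norm (\<Sum>n<M. smul (\<alpha> (lead n)) (c (lead n))) \<le> (\<Sum>n<M. K * (\<Sum>i\<in>block n. norm (a0 i) * wt (blk i)))"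
    proof (rule order_trans[OF norm_sum], rule sum_mono)
      fix n
      have "norm (smul (\<alpha> (lead n)) (c (lead n))) \<le> norm (\<alpha> (lead n)) * K"
        unfolding norm_smul using c_le by (intro mult_left_mono) auto
      moreover have "norm (\<alpha> (lead n)) \<le> (\<Sum>i\<in>block n. norm (a0 i) * wt (blk i))"
        unfolding \<alpha>_def blk_lead
        by (rule sum_norm_le) (use wt_pos in \<open>auto simp: hh_sym[of _ "lead n"] hh_lead mem_block_iff less_imp_le\<close>)
      ultimately show "norm (smul (\<alpha> (lead n)) (c (lead n))) \<le> K * (\<Sum>i\<in>block n. norm (a0 i) * wt (blk i))"
        using K_ge_1 by (smt (verit) mult.commute mult_left_mono)
    qed
    also have "\<dots> = K * (\<Sum>i<lead M. norm (a0 i) * wt (blk i))"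
      by (simp add: sum_lessThan_lead sum_distrib_left)
    finally show "norm (\<Sum>n<M. smul (\<alpha> (lead n)) (c (lead n))) \<le> K * (\<Sum>i\<in>F. norm (a i) * wt (blk i))"
      using restr[of "\<lambda>i y. norm y * wt (blk i)"] by simp
  next
    have "(\<Sum>j\<in>{..<lead M} - range lead. (norm (\<alpha> j))\<^sup>2) \<le> (\<Sum>j<lead M. (norm (\<alpha> j))\<^sup>2)"
      by (rule sum_mono2) auto
    also have "\<dots> = (\<Sum>n<M. \<Sum>j\<in>block n. (norm (\<Sum>i\<in>block n. hh n j i *\<^sub>R a0 i))\<^sup>2)"
      unfolding sum_lessThan_lead \<alpha>_def by (intro sum.cong) (auto simp: mem_block_iff)
    also have "\<dots> \<le> (\<Sum>n<M. 9 * (\<Sum>j\<in>block n. (norm (a0 j))\<^sup>2))"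
      by (intro sum_mono hh_bound)
    also have "\<dots> = 9 * (\<Sum>j<lead M. (norm (a0 j))\<^sup>2)"
      by (simp add: sum_lessThan_lead sum_distrib_left)
    also have "\<dots> = 9 * (\<Sum>i\<in>F. (norm (a i))\<^sup>2)"
      using restr[of "\<lambda>i y. (norm y)\<^sup>2"] by simp
    finally have "sqrt (\<Sum>j\<in>{..<lead M} - range lead. (norm (\<alpha> j))\<^sup>2) \<le> sqrt (9 * (\<Sum>i\<in>F. (norm (a i))\<^sup>2))"
      by simp
    also have "\<dots> = 3 * sqrt (\<Sum>i\<in>F. (norm (a i))\<^sup>2)"
      by (simp add: real_sqrt_mult)
    finally have "K * sqrt (\<Sum>j\<in>{..<lead M} - range lead. (norm (\<alpha> j))\<^sup>2) \<le> K * (3 * sqrt (\<Sum>i\<in>F. (norm (a i))\<^sup>2))"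
      using K_ge_1 by (intro mult_left_mono) auto
    then show "norm (\<Sum>j\<in>{..<lead M} - range lead. smul (\<alpha> j) (c j)) \<le> K * (3 * sqrt (\<Sum>i\<in>F. (norm (a i))\<^sup>2))"
      using l2_upper[of "{..<lead M} - range lead" \<alpha>] by force
  qed
  finally show ?thesis by (simp add: distrib_left)
qed

text \<open>Upper half of democracy, with varying coefficients: each of the two terms of
  \<open>norm_sum_b_le\<close> is at most \<open>3 * t * sqrt (card F)\<close>.\<close>

lemma norm_sum_b_le_max:
  assumes F: "finite F" and a: "\<And>i. i \<in> F \<Longrightarrow> norm (a i) \<le> t" and t: "0 \<le> t"
  shows "norm (\<Sum>i\<in>F. smul (a i) (b i)) \<le> 6 * K * t * sqrt (card F)"
proof -
  have "(\<Sum>i\<in>F. norm (a i) * wt (blk i)) \<le> (\<Sum>i\<in>F. t * wt (blk i))"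
    by (intro sum_mono mult_right_mono a) (use wt_pos in \<open>auto simp: less_imp_le\<close>)
  also have "\<dots> \<le> t * (3 * sqrt (card F))"
    unfolding sum_distrib_left[symmetric] using sum_wt_blk_le[OF F] t by (intro mult_left_mono) auto
  finally have 1: "(\<Sum>i\<in>F. norm (a i) * wt (blk i)) \<le> 3 * t * sqrt (card F)" by simp
  have "(\<Sum>i\<in>F. (norm (a i))\<^sup>2) \<le> (\<Sum>i\<in>F. t\<^sup>2)"
    using a by (intro sum_mono power_mono) auto
  then have "sqrt (\<Sum>i\<in>F. (norm (a i))\<^sup>2) \<le> sqrt (card F * t\<^sup>2)"
    by simp
  also have "\<dots> = t * sqrt (card F)" using t by (simp add: real_sqrt_mult)
  finally have 2: "3 * sqrt (\<Sum>i\<in>F. (norm (a i))\<^sup>2) \<le> 3 * t * sqrt (card F)" by simp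
  have "K * ((\<Sum>i\<in>F. norm (a i) * wt (blk i)) + 3 * sqrt (\<Sum>i\<in>F. (norm (a i))\<^sup>2)) \<le> K * (6 * t * sqrt (card F))"
    using 1 2 K_ge_1 by (intro mult_left_mono) auto
  then show ?thesis using norm_sum_b_le[OF F, of a] by (simp add: mult.assoc mult.left_commute)
qed

text \<open>Subtracting the average deletes exactly the coordinate at \<open>lead n\<close> before
  the rotation, so the deviations are the rotated coefficients of the l2 part of
  \<open>f\<close>.\<close>

lemma sum_dev_le:
  assumes F: "finite F"
  shows "(\<Sum>i\<in>F. (norm (dev i f))\<^sup>2) \<le> 9 * (K * norm f)\<^sup>2"
proof -
  obtain M where M: "F \<subseteq> {..<lead M}" using finite_subset_lead[OF F] .
  define \<beta> where "\<beta> j = (if j \<in> range lead then 0 else c' j f)" for j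
  have dev: "dev i f = (\<Sum>j\<in>block n. hh n i j *\<^sub>R \<beta> j)" if "i \<in> block n" for i n
  proof -
    have "blk i = n" using that by (simp add: mem_block_iff)
    then have "b' i f = hh n i (lead n) *\<^sub>R c' (lead n) f + (\<Sum>j\<in>block n - {lead n}. hh n i j *\<^sub>R c' j f)"
      unfolding b'_def by (simp add: sum.remove[of _ "lead n"])
    moreover have "(\<Sum>j\<in>block n. hh n i j *\<^sub>R \<beta> j) = hh n i (lead n) *\<^sub>R \<beta> (lead n) + (\<Sum>j\<in>block n - {lead n}. hh n i j *\<^sub>R \<beta> j)"
      by (simp add: sum.remove[of _ "lead n"])
    moreover have "(\<Sum>j\<in>block n - {lead n}. hh n i j *\<^sub>R \<beta> j) = (\<Sum>j\<in>block n - {lead n}. hh n i j *\<^sub>R c' j f)"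
      unfolding block_Diff_lead by (rule sum.cong) (auto simp: \<beta>_def)
    ultimately show ?thesis
      using \<open>blk i = n\<close> that by (simp add: dev_def \<beta>_def hh_lead)
  qed
  have "(\<Sum>i\<in>F. (norm (dev i f))\<^sup>2) \<le> (\<Sum>i<lead M. (norm (dev i f))\<^sup>2)"
    using M by (intro sum_mono2) auto
  also have "\<dots> = (\<Sum>n<M. \<Sum>i\<in>block n. (norm (\<Sum>j\<in>block n. hh n i j *\<^sub>R \<beta> j))\<^sup>2)"
    unfolding sum_lessThan_lead by (intro sum.cong) (auto simp: dev)
  also have "\<dots> \<le> (\<Sum>n<M. 9 * (\<Sum>j\<in>block n. (norm (\<beta> j))\<^sup>2))"
    by (intro sum_mono hh_bound)
  also have "\<dots> = 9 * (\<Sum>j<lead M. (norm (\<beta> j))\<^sup>2)"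
    by (simp add: sum_lessThan_lead sum_distrib_left)
  also have "(\<Sum>j<lead M. (norm (\<beta> j))\<^sup>2) = (\<Sum>j\<in>{..<lead M} - range lead. (norm (c' j f))\<^sup>2)"
    by (rule sum.mono_neutral_cong_right) (auto simp: \<beta>_def)
  also have "9 * \<dots> \<le> 9 * (K * norm f)\<^sup>2"
    using l2_lower[of "{..<lead M} - range lead" f] by auto
  finally show ?thesis by simp
qed

text \<open>A single block contains one coordinate outside the l2 part, and that one is bounded;
  hence the factor 18 = 9 * 2.\<close>

lemma sum_b'_block_le: "(\<Sum>i\<in>block n. (norm (b' i f))\<^sup>2) \<le> 18 * (K * norm f)\<^sup>2"
proof -
  have "(\<Sum>i\<in>block n. (norm (b' i f))\<^sup>2) = (\<Sum>i\<in>block n. (norm (\<Sum>j\<in>block n. hh n i j *\<^sub>R c' j f))\<^sup>2)"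
    by (rule sum.cong) (auto simp: b'_def mem_block_iff)
  also have "\<dots> \<le> 9 * (\<Sum>j\<in>block n. (norm (c' j f))\<^sup>2)"
    by (rule hh_bound)
  also have "(\<Sum>j\<in>block n. (norm (c' j f))\<^sup>2) = (norm (c' (lead n) f))\<^sup>2 + (\<Sum>j\<in>block n - range lead. (norm (c' j f))\<^sup>2)"
    unfolding block_Diff_lead[symmetric] by (simp add: sum.remove[of _ "lead n"])
  also have "9 * \<dots> \<le> 9 * ((K * norm f)\<^sup>2 + (K * norm f)\<^sup>2)"
    using l2_lower[of "block n - range lead" f] power_mono[OF c'_le[of "lead n" f], of 2]
    by (intro mult_left_mono add_mono) auto
  finally show ?thesis by simp
qed

lemma norm_b'_le: "norm (b' i f) \<le> 5 * K * norm f"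
proof (rule power2_le_imp_le)
  have "(norm (b' i f))\<^sup>2 \<le> (\<Sum>i\<in>block (blk i). (norm (b' i f))\<^sup>2)"
    by (rule member_le_sum) (auto simp: mem_block_iff)
  also have "\<dots> \<le> 18 * (K * norm f)\<^sup>2" by (rule sum_b'_block_le)
  also have "\<dots> \<le> (5 * K * norm f)\<^sup>2" by (simp add: power_mult_distrib)
  finally show "(norm (b' i f))\<^sup>2 \<le> (5 * K * norm f)\<^sup>2" .
qed (use K_ge_1 in auto)

text \<open>Uniform unconditionality inside a block: the squares of the weights over one block add
  up to 1, so Cauchy-Schwarz turns the weighted l1 term into the l2 term. The constant comes from 5
  + 3 * 5 = 20.\<close>

lemma norm_block_sum_le:
  assumes "F \<subseteq> block n"
  shows "norm (\<Sum>i\<in>F. smul (b' i f) (b i)) \<le> 20 * K\<^sup>2 * norm f"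
proof -
  have F: "finite F" by (rule finite_subset[OF assms finite_block])
  define S where "S = (\<Sum>i\<in>F. (norm (b' i f))\<^sup>2)"
  have "S \<le> 18 * (K * norm f)\<^sup>2"
    using sum_b'_block_le[of f n] sum_mono2[OF finite_block assms, of "\<lambda>i. (norm (b' i f))\<^sup>2"] by (simp add: S_def)
  also have "\<dots> \<le> (5 * K * norm f)\<^sup>2" by (simp add: power_mult_distrib)
  finally have S: "sqrt S \<le> 5 * K * norm f"
    using K_ge_1 by (intro real_le_lsqrt) auto
  have "(\<Sum>i\<in>F. norm (b' i f) * wt (blk i))\<^sup>2 \<le> S * (\<Sum>i\<in>F. (wt (blk i))\<^sup>2)"
    unfolding S_def by (rule Cauchy_Schwarz_ineq_sum)
  also have "(\<Sum>i\<in>F. (wt (blk i))\<^sup>2) \<le> (\<Sum>i\<in>block n. (wt (blk i))\<^sup>2)"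
    using assms by (intro sum_mono2) auto
  also have "\<dots> = (\<Sum>i\<in>block n. (wt n)\<^sup>2)"
    by (rule sum.cong) (auto simp: mem_block_iff)
  also have "\<dots> = 1" by (simp add: wt_sq)
  finally have "(\<Sum>i\<in>F. norm (b' i f) * wt (blk i)) \<le> sqrt S"
    by (simp add: real_le_rsqrt S_def sum_nonneg mult_left_mono)
  then have "(\<Sum>i\<in>F. norm (b' i f) * wt (blk i)) + 3 * sqrt S \<le> 20 * K * norm f"
    using S by simp
  then have "K * ((\<Sum>i\<in>F. norm (b' i f) * wt (blk i)) + 3 * sqrt S) \<le> K * (20 * K * norm f)"
    using K_ge_1 by (intro mult_left_mono) auto
  then show ?thesis
    using norm_sum_b_le[OF F, of "\<lambda>i. b' i f"] by (simp add: S_def power2_eq_square mult.assoc mult.left_commute)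
qed

text \<open>On full blocks the rotation cancels, and the sum is a partial sum of the unrotated
  system. A general partial sum then differs from one of these by part of a single block.\<close>

lemma norm_lead_sum_le: "norm (\<Sum>i<lead M. smul (b' i f) (b i)) \<le> 2 * K\<^sup>2 * norm f"
proof -
  have "(\<Sum>i<lead M. smul (b' i f) (b i)) = (\<Sum>j<lead M. smul (c' j f) (c j))"
    unfolding synthesis_lead by (intro sum.cong refl) (simp add: c'_eq[of _ "blk _"] mem_block_iff)
  also have "\<dots> = (\<Sum>n<M. smul (c' (lead n) f) (c (lead n))) + (\<Sum>j\<in>{..<lead M} - range lead. smul (c' j f) (c j))"
    by (rule sum_lead_split)
  also have "norm \<dots> \<le> K\<^sup>2 * norm f + K\<^sup>2 * norm f"
  proof (rule norm_triangle_mono)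
    have "1 * norm f \<le> K * norm f" using K_ge_1 by (rule mult_right_mono) simp
    then have "K * norm f \<le> K * (K * norm f)" using K_ge_1 by (intro mult_left_mono) auto
    then show "norm (\<Sum>n<M. smul (c' (lead n) f) (c (lead n))) \<le> K\<^sup>2 * norm f"
      using lead_sums[of f M] by (simp add: power2_eq_square)
    have "sqrt (\<Sum>j\<in>{..<lead M} - range lead. (norm (c' j f))\<^sup>2) \<le> K * norm f"
      using l2_lower[of "{..<lead M} - range lead" f] K_ge_1 by (intro real_le_lsqrt) auto
    then have "K * sqrt (\<Sum>j\<in>{..<lead M} - range lead. (norm (c' j f))\<^sup>2) \<le> K * (K * norm f)"
      using K_ge_1 by (intro mult_left_mono) auto
    then show "norm (\<Sum>j\<in>{..<lead M} - range lead. smul (c' j f) (c j)) \<le> K\<^sup>2 * norm f"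
      using l2_upper[of "{..<lead M} - range lead" "\<lambda>j. c' j f"]
      unfolding power2_eq_square[of K] by (simp add: Int_commute mult.assoc)
  qed
  finally show ?thesis by (simp add: algebra_simps)
qed

lemma norm_partial_sum_le: "norm (\<Sum>i<m. smul (b' i f) (b i)) \<le> 22 * K\<^sup>2 * norm f"
proof -
  have "lead (blk m) \<le> m"
    using mem_block_iff[of m "blk m"] by (simp add: block_altdef)
  then have "(\<Sum>i<m. smul (b' i f) (b i)) =
      (\<Sum>i<lead (blk m). smul (b' i f) (b i)) + (\<Sum>i\<in>{lead (blk m)..<m}. smul (b' i f) (b i))"
    unfolding atLeast0LessThan[symmetric] by (simp add: sum.atLeastLessThan_concat)
  also have "norm \<dots> \<le> 2 * K\<^sup>2 * norm f + 20 * K\<^sup>2 * norm f"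
    using mem_block_iff[of m "blk m"]
    by (intro norm_triangle_mono norm_lead_sum_le norm_block_sum_le[of _ "blk m"]) (auto simp: block_altdef)
  finally show ?thesis by (simp add: algebra_simps)
qed

lemma dense_b: "closure (span (range b)) = UNIV"
proof -
  have "range c \<subseteq> span (range b)"
  proof clarify
    fix j
    have "(\<Sum>i\<in>block (blk j). hh (blk j) j i *\<^sub>R b i) = (\<Sum>i\<in>block (blk j). \<Sum>k\<in>block (blk j). (hh (blk j) j i * hh (blk j) i k) *\<^sub>R c k)"
      unfolding b_def by (rule sum.cong) (auto simp: mem_block_iff scaleR_sum_right)
    also have "\<dots> = (\<Sum>k\<in>block (blk j). (\<Sum>i\<in>block (blk j). hh (blk j) j i * hh (blk j) i k) *\<^sub>R c k)"
      by (subst sum.swap) (simp add: scaleR_sum_left)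
    also have "\<dots> = (\<Sum>k\<in>block (blk j). if j = k then c k else 0)"
      by (intro sum.cong) (auto simp: hh_square mem_block_iff)
    also have "\<dots> = c j" by (simp add: mem_block_iff)
    finally have "c j = (\<Sum>i\<in>block (blk j). smul (of_real (hh (blk j) j i)) (b i))"
      by (simp add: smul_of_real)
    also have "\<dots> \<in> span (range b)"
      by (intro span_sum span_scale span_base) auto
    finally show "c j \<in> span (range b)" .
  qed
  then have "closure (span (range c)) \<subseteq> closure (span (range b))"
    by (intro closure_span_mono) (use closure_subset in blast)
  then show ?thesis using dense by auto
qed

lemma basis_b: "schauder_basis smul b" and coord_b: "coord smul b i f = b' i f"
  using schauder_basisI[OF fn_b' bio_b _ norm_partial_sum_le dense_b] norm_b'_le by blast+

section \<open>Large coefficients and the almost greedy property\<close>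

lemma coord_proj_b: "coord_proj smul b A f = (\<Sum>i\<in>A \<inter> F. smul (b' i f) (b i))"
  if "finite F" "A \<inter> supp smul b f \<subseteq> F"
proof -
  have "coord_proj smul b A f = (\<Sum>i\<in>A \<inter> F. if i \<in> A then smul (coord smul b i f) (b i) else 0)"
    unfolding coord_proj_def
    using that by (intro suminf_finite) (auto simp: supp_def)
  then show ?thesis by (simp add: coord_b)
qed

text \<open>Lower half of democracy. At each index either the deviation or the block average is at
  least \<open>t / 2\<close>. Indices of the first kind are counted by square summability; those of
  the second kind lie in blocks that are not too large. The squared constants add up to 36 + 8 = 44,
  below 7^2.\<close>

lemma card_large_coeffs_le:
  assumes F: "finite F" and t: "0 \<le> t" and le: "\<And>i. i \<in> F \<Longrightarrow> t \<le> norm (b' i f)"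
  shows "t * sqrt (card F) \<le> 7 * K * norm f"
proof (cases "t = 0")
  case True
  then show ?thesis using K_ge_1 by simp
next
  case False
  then have t: "t > 0" using t by simp
  define F1 where "F1 = {i \<in> F. t / 2 \<le> norm (dev i f)}"
  define F2 where "F2 = F - F1"
  define Q where "Q = (K * norm f)\<^sup>2"
  have fin: "finite F1" "finite F2" using F by (auto simp: F1_def F2_def)
  have "card F1 * (t / 2)\<^sup>2 \<le> (\<Sum>i\<in>F1. (norm (dev i f))\<^sup>2)"
    using t by (intro sum_bounded_below[of F1 "(t/2)\<^sup>2", simplified] power_mono) (auto simp: F1_def)
  also have "\<dots> \<le> 9 * Q" unfolding Q_def by (rule sum_dev_le[OF fin(1)])
  finally have 1: "card F1 * t\<^sup>2 \<le> 36 * Q" by (simp add: power_divide)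
  have 2: "card F2 * t\<^sup>2 \<le> 8 * Q"
  proof (cases "F2 = {}")
    case True
    then show ?thesis by (simp add: Q_def)
  next
    case False
    \<comment> \<open>One index suffices: the largest one bounds the cardinality by the size of its
      block, and the block average there bounds that size.\<close>
    define i where "i = Max F2"
    have i: "i \<in> F2" using False fin by (simp add: i_def)
    have "F2 \<subseteq> {..i}" using fin by (auto simp: i_def)
    then have "card F2 \<le> Suc i" using card_mono[of "{..i}" F2] by simp
    also have "\<dots> \<le> 2 * 2 ^ blk i" using blk_bounds(2)[of i] by simp
    finally have "real (card F2) \<le> real (2 * 2 ^ blk i)"
      by (rule of_nat_mono)
    then have c: "real (card F2) \<le> 2 * 2 ^ blk i"
      by (simp only: of_nat_mult of_nat_numeral of_nat_power)
    have "t \<le> norm (b' i f)" "norm (dev i f) < t / 2" using i le by (auto simp: F2_def F1_def)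
    moreover have "norm (b' i f) \<le> norm (dev i f) + norm (wt (blk i) *\<^sub>R c' (lead (blk i)) f)"
      unfolding dev_def by (metis diff_add_cancel norm_triangle_ineq)
    ultimately have "t / 2 \<le> wt (blk i) * norm (c' (lead (blk i)) f)"
      using wt_pos[of "blk i"] by simp
    also have "\<dots> \<le> wt (blk i) * (K * norm f)"
      using wt_pos[of "blk i"] c'_le by (intro mult_left_mono) auto
    finally have "(t / 2)\<^sup>2 \<le> (wt (blk i) * (K * norm f))\<^sup>2"
      using t by (intro power_mono) auto
    then have "t\<^sup>2 * 2 ^ blk i \<le> 4 * Q"
      unfolding Q_def power_mult_distrib[of "wt _"] wt_sq by (simp add: power_divide field_simps)
    moreover have "card F2 * t\<^sup>2 \<le> 2 * 2 ^ blk i * t\<^sup>2"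
      using c by (intro mult_right_mono) auto
    ultimately show ?thesis by (simp add: mult.commute mult.left_commute)
  qed
  have "card F = card F1 + card F2"
    unfolding F2_def using F by (simp add: F1_def card_Diff_subset card_mono)
  then have "card F * t\<^sup>2 \<le> 44 * Q" using 1 2 by (simp add: distrib_right)
  moreover have "(t * sqrt (card F))\<^sup>2 = card F * t\<^sup>2" "(7 * K * norm f)\<^sup>2 = 49 * Q" "Q \<ge> 0"
    by (simp_all add: Q_def power_mult_distrib)
  ultimately have "(t * sqrt (card F))\<^sup>2 \<le> (7 * K * norm f)\<^sup>2"
    by linarith
  then show ?thesis
    by (rule power2_le_imp_le) (use K_ge_1 in simp)
qed

text \<open>Up to a fixed block the greedy set is the complement of few small coefficients; beyond it the
  block averages are at most \<open>t / 2\<close>, so that the coefficients \<open>\<ge> t\<close> are controlled by \<open>dev\<close>.\<close>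

lemma norm_greedy_sum_le:
  assumes A: "finite A" and t: "0 \<le> t" and ge: "\<And>i. i \<in> A \<Longrightarrow> t \<le> norm (b' i g)"
    and le: "\<And>i. i \<notin> A \<Longrightarrow> norm (b' i g) \<le> t"
  shows "norm (\<Sum>i\<in>A. smul (b' i g) (b i)) \<le> 56 * K\<^sup>2 * norm g"
proof (cases "t = 0")
  case True
  \<comment> \<open>No threshold is available to divide by, but all coefficients outside
    \<open>A\<close> vanish, so the sum is \<open>g\<close> itself.\<close>
  have "(\<lambda>i. smul (b' i g) (b i)) sums g"
    using coord_sums[OF basis_b, of g] by (simp add: coord_b)
  moreover have "(\<lambda>i. smul (b' i g) (b i)) sums (\<Sum>i\<in>A. smul (b' i g) (b i))"
    using A le True by (intro sums_finite) auto
  ultimately have eq: "(\<Sum>i\<in>A. smul (b' i g) (b i)) = g" using sums_unique2 by blast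
  have "1 * 1 \<le> K * K" using K_ge_1 by (intro mult_mono) auto
  then have "1 * norm g \<le> (56 * K\<^sup>2) * norm g"
    by (intro mult_right_mono) (auto simp: power2_eq_square)
  then show ?thesis by (simp add: eq)
next
  case False
  then have t: "t > 0" using t by simp
  define L where "L = K * norm g"
  have L: "L \<ge> 0" using K_ge_1 by (simp add: L_def)
  \<comment> \<open>\<open>P M\<close> says that \<open>wt M * L\<close> is below
    \<open>t / 2\<close>, where \<open>wt M * L\<close> bounds the average of the coefficients of
    \<open>g\<close> over block \<open>M\<close>.\<close>
  define P where "P M \<longleftrightarrow> (2 * L)\<^sup>2 < 2 ^ M * t\<^sup>2" for M :: nat
  have "\<exists>M. P M"
  proof -
    obtain M where "(2 * L)\<^sup>2 / t\<^sup>2 < 2 ^ M" using real_arch_pow[of 2] by auto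
    then show ?thesis using t unfolding P_def by (auto simp: divide_less_eq)
  qed
  \<comment> \<open>Minimality keeps the initial segment short: \<open>P\<close> fails just before
    \<open>M\<close>, so \<open>lead M\<close> is at most a constant times
    \<open>(L / t)^2\<close>.\<close>
  define M where "M = (LEAST M. P M)"
  have M: "P M" unfolding M_def using \<open>\<exists>M. P M\<close> by (rule LeastI_ex)
  have lead_M: "t * sqrt (lead M) \<le> 3 * L"
  proof (cases M)
    case 0
    then show ?thesis using L by (simp add: lead_def)
  next
    case (Suc N)
    then have "\<not> P N" using not_less_Least[of N P] by (simp add: M_def)
    then have N: "2 ^ N * t\<^sup>2 \<le> 4 * L\<^sup>2" by (simp add: P_def)
    have "real (lead M) \<le> 2 * 2 ^ N" by (simp add: Suc lead_def)
    then have "real (lead M) * t\<^sup>2 \<le> 2 * 2 ^ N * t\<^sup>2" by (intro mult_right_mono) auto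
    also have "\<dots> \<le> 9 * L\<^sup>2" using N zero_le_power2[of L] by linarith
    finally have "(t * sqrt (lead M))\<^sup>2 \<le> (3 * L)\<^sup>2"
      by (simp add: power_mult_distrib mult.commute)
    then show ?thesis by (rule power2_le_imp_le) (use L in simp)
  qed
  define H where "H = A - {..<lead M}"
  have finH: "finite H" using A by (simp add: H_def)
  \<comment> \<open>The second estimate turns the weighted l1 sum of the coefficients, after
    multiplication by \<open>L\<close>, into a sum of squares of deviations.\<close>
  have dev_ge: "norm (b' i g) \<le> 2 * norm (dev i g) \<and> norm (b' i g) * wt (blk i) * L \<le> 2 * (norm (dev i g))\<^sup>2"
    if i: "i \<in> H" for i
  proof -
    have "M \<le> blk i" using i by (simp add: H_def less_lead_iff not_less[symmetric])
    then have "2 ^ M * t\<^sup>2 \<le> 2 ^ blk i * t\<^sup>2" by (intro mult_right_mono power_increasing) auto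
    then have "(2 * L)\<^sup>2 \<le> 2 ^ blk i * t\<^sup>2" using M by (simp add: P_def)
    then have "(2 * (wt (blk i) * L))\<^sup>2 \<le> t\<^sup>2"
      by (simp add: power_mult_distrib wt_sq field_simps)
    then have wL: "2 * (wt (blk i) * L) \<le> t" by (rule power2_le_imp_le) (use t in simp)
    have "norm (b' i g) \<le> norm (dev i g) + norm (wt (blk i) *\<^sub>R c' (lead (blk i)) g)"
      unfolding dev_def by (metis diff_add_cancel norm_triangle_ineq)
    moreover have "norm (wt (blk i) *\<^sub>R c' (lead (blk i)) g) \<le> wt (blk i) * L"
      using wt_pos[of "blk i"] c'_le by (auto simp: L_def intro!: mult_left_mono)
    moreover have ti: "t \<le> norm (b' i g)" using i ge by (simp add: H_def)
    ultimately have d: "norm (b' i g) \<le> 2 * norm (dev i g)" using wL by linarith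
    have "norm (b' i g) * wt (blk i) * L \<le> norm (b' i g) * (t / 2)"
      using wL by (simp add: mult.assoc mult_left_mono)
    also have "\<dots> \<le> (2 * norm (dev i g)) * (norm (dev i g))"
      using d ti t by (intro mult_mono) auto
    finally show ?thesis using d by (simp add: power2_eq_square)
  qed
  have low: "norm (\<Sum>i\<in>A \<inter> {..<lead M}. smul (b' i g) (b i)) \<le> 20 * K\<^sup>2 * norm g"
  proof -
    \<comment> \<open>The complement is easier to estimate than the greedy set: its coefficients are
      at most \<open>t\<close>, and there are at most \<open>lead M\<close> of them.\<close>
    have "(\<Sum>i\<in>A \<inter> {..<lead M}. smul (b' i g) (b i)) =
        (\<Sum>i<lead M. smul (b' i g) (b i)) - (\<Sum>i\<in>{..<lead M} - A. smul (b' i g) (b i))"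
      using sum.Int_Diff[of "{..<lead M}" "\<lambda>i. smul (b' i g) (b i)" A] by (simp add: Int_commute)
    also have "norm \<dots> \<le> 2 * K\<^sup>2 * norm g + 6 * K * t * sqrt (card ({..<lead M} - A))"
      using le t by (intro norm_triangle_le_diff add_mono norm_lead_sum_le norm_sum_b_le_max) auto
    also have "6 * K * t * sqrt (card ({..<lead M} - A)) \<le> 6 * K * t * sqrt (lead M)"
      using K_ge_1 t card_mono[of "{..<lead M}" "{..<lead M} - A"] by (intro mult_left_mono) auto
    also have "\<dots> \<le> 6 * K * (3 * L)"
      using lead_M K_ge_1 mult_left_mono[of "t * sqrt (lead M)" "3 * L" "6 * K"] by (simp add: mult.assoc)
    finally show ?thesis by (simp add: L_def power2_eq_square algebra_simps)
  qed
  have high: "norm (\<Sum>i\<in>H. smul (b' i g) (b i)) \<le> 36 * K\<^sup>2 * norm g"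
  proof (cases "L = 0")
    case True
    then have "g = 0" using K_ge_1 by (auto simp: L_def)
    then show ?thesis by (simp add: functional_0[OF fn_b'])
  next
    case False
    then have L: "L > 0" using L by simp
    have "(\<Sum>i\<in>H. norm (b' i g) * wt (blk i)) * L \<le> (\<Sum>i\<in>H. 2 * (norm (dev i g))\<^sup>2)"
      unfolding sum_distrib_right using dev_ge by (intro sum_mono) blast
    also have "\<dots> \<le> 18 * L\<^sup>2"
      using sum_dev_le[OF finH, of g] by (simp add: L_def flip: sum_distrib_left)
    finally have "(\<Sum>i\<in>H. norm (b' i g) * wt (blk i)) * L \<le> (18 * L) * L"
      by (simp add: power2_eq_square)
    then have 1: "(\<Sum>i\<in>H. norm (b' i g) * wt (blk i)) \<le> 18 * L"
      using L by (rule mult_right_le_imp_le)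
    have "(\<Sum>i\<in>H. (norm (b' i g))\<^sup>2) \<le> (\<Sum>i\<in>H. (2 * norm (dev i g))\<^sup>2)"
      using dev_ge by (intro sum_mono power_mono) auto
    also have "\<dots> \<le> 36 * L\<^sup>2"
      using sum_dev_le[OF finH, of g] by (simp add: L_def power_mult_distrib flip: sum_distrib_left)
    finally have "sqrt (\<Sum>i\<in>H. (norm (b' i g))\<^sup>2) \<le> 6 * L"
      using L by (intro real_le_lsqrt) (auto simp: power_mult_distrib)
    then have "K * ((\<Sum>i\<in>H. norm (b' i g) * wt (blk i)) + 3 * sqrt (\<Sum>i\<in>H. (norm (b' i g))\<^sup>2)) \<le> K * (36 * L)"
      using 1 K_ge_1 by (intro mult_left_mono) auto
    then show ?thesis
      using norm_sum_b_le[OF finH, of "\<lambda>i. b' i g"] by (simp add: L_def power2_eq_square algebra_simps)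
  qed
  have "(\<Sum>i\<in>A. smul (b' i g) (b i)) = (\<Sum>i\<in>A \<inter> {..<lead M}. smul (b' i g) (b i)) + (\<Sum>i\<in>H. smul (b' i g) (b i))"
    unfolding H_def by (rule sum.Int_Diff[OF A])
  also have "norm \<dots> \<le> 20 * K\<^sup>2 * norm g + 36 * K\<^sup>2 * norm g"
    by (intro norm_triangle_mono low high)
  finally show ?thesis by (simp add: algebra_simps)
qed

text \<open>With g = f - S_B f one has f - S_A f = g + S_{B-A} f - S_{A-B} g. The set
  \<open>A - B\<close> is greedy for \<open>g\<close>, whose coefficients vanish on
  \<open>B\<close>. On \<open>B - A\<close> the coefficients are at most those on
  \<open>A - B\<close>, and there are no more of them, so both halves of democracy apply. The
  constant is 1 + 6 * 7 + 56 = 99.\<close>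

lemma almost_greedy_b: "almost_greedy smul b"
proof -
  have "norm (f - coord_proj smul b A f) \<le> 99 * K\<^sup>2 * norm (f - coord_proj smul b B f)"
    if A: "finite A" and B: "finite B" and card: "card B \<le> card A"
      and greedy: "\<And>j k. j \<notin> A \<Longrightarrow> k \<in> A \<Longrightarrow> norm (coord smul b j f) \<le> norm (coord smul b k f)"
    for f A B
  proof -
    define S where "S F f = (\<Sum>i\<in>F. smul (b' i f) (b i))" for F f
    have proj: "coord_proj smul b F f = S F f" if "finite F" for F
      using coord_proj_b[of F F f] that by (simp add: S_def)
    define g where "g = f - S B f"
    have g: "b' i g = (if i \<in> B then 0 else b' i f)" for i
      by (simp add: g_def S_def functional_diff[OF fn_b'] biorthogonal_sum[OF fn_b' bio_b B])
    have S_AB: "S (A - B) g = S (A - B) f"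
      unfolding S_def by (rule sum.cong) (auto simp: g)
    have split: "f - S A f = g + S (B - A) f - S (A - B) g"
      unfolding S_AB using sum.Int_Diff[OF A, of "\<lambda>i. smul (b' i f) (b i)" B]
        sum.Int_Diff[OF B, of "\<lambda>i. smul (b' i f) (b i)" A]
      by (simp add: g_def S_def Int_commute)
    have K2: "1 \<le> K\<^sup>2" using K_ge_1 by simp
    then have ng: "norm g \<le> K\<^sup>2 * norm g" using mult_right_mono[of 1 "K\<^sup>2" "norm g"] by simp
    have card': "card (B - A) \<le> card (A - B)"
      using card_le_sym_Diff[OF B A card] .
    have "norm (S (B - A) f) \<le> 42 * K\<^sup>2 * norm g \<and> norm (S (A - B) g) \<le> 56 * K\<^sup>2 * norm g"
    proof (cases "A - B = {}")
      case True
      then have "A - B = {} \<and> B - A = {}" using card' B by (metis card.empty card_0_eq finite_Diff le_zero_eq)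
      then have "S (B - A) f = 0" "S (A - B) g = 0" unfolding S_def by (simp_all only: sum.empty)
      then show ?thesis by simp
    next
      case False
      define t where "t = Min ((\<lambda>i. norm (b' i f)) ` (A - B))"
      have "t \<in> (\<lambda>i. norm (b' i f)) ` (A - B)"
        unfolding t_def using A False by (intro Min_in) auto
      then obtain k where k: "k \<in> A - B" "t = norm (b' k f)" by blast
      have t: "0 \<le> t" using k by simp
      have le: "norm (b' i f) \<le> t" if "i \<notin> A" for i
        using greedy[OF that, of k] k by (simp add: coord_b)
      have ge: "t \<le> norm (b' i f)" if "i \<in> A - B" for i
        unfolding t_def using A that by (intro Min_le) auto
      have "norm (S (B - A) f) \<le> 6 * K * t * sqrt (card (B - A))"
        unfolding S_def using B le t by (intro norm_sum_b_le_max) auto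
      also have "\<dots> \<le> 6 * K * (t * sqrt (card (A - B)))"
        using card' K_ge_1 t by (simp add: mult_left_mono)
      also have "t * sqrt (card (A - B)) \<le> 7 * K * norm g"
        using A t ge by (intro card_large_coeffs_le) (auto simp: g)
      finally have "norm (S (B - A) f) \<le> 42 * K\<^sup>2 * norm g"
        using K_ge_1 by (simp add: power2_eq_square mult.assoc mult_left_mono)
      moreover have "norm (S (A - B) g) \<le> 56 * K\<^sup>2 * norm g"
        unfolding S_def
      proof (rule norm_greedy_sum_le[OF _ t])
        fix i assume "i \<notin> A - B"
        then show "norm (b' i g) \<le> t" using le t by (auto simp: g)
      qed (use A ge in \<open>auto simp: g\<close>)
      ultimately show ?thesis ..
    qed
    then have "norm (f - S A f) \<le> norm g + 42 * K\<^sup>2 * norm g + 56 * K\<^sup>2 * norm g"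
      unfolding split by (intro norm_triangle_le_diff add_mono norm_triangle_mono) auto
    also have "\<dots> \<le> 99 * K\<^sup>2 * norm g" using ng by linarith
    finally show ?thesis by (simp add: proj[OF A] proj[OF B] g_def)
  qed
  then show ?thesis unfolding almost_greedy_def by blast
qed

section \<open>The fundamental function and the conditionality constants of the rotated
  basis\<close>

lemma fundamental_function_b:
  "approx_on {1..} (fundamental_function b) (\<lambda>m. ennreal (real m powr (1 / 2)))"
proof -
  have "fundamental_function b m \<le> ennreal (6 * K) * ennreal (real m powr (1 / 2))" for m
    unfolding fundamental_function_def
  proof (rule SUP_least)
    fix A :: "nat set" assume "A \<in> {A. finite A \<and> card A \<le> m}"
    then have A: "finite A" "card A \<le> m" by auto
    have "norm (\<Sum>j\<in>A. b j) \<le> 6 * K * 1 * sqrt (card A)"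
      using norm_sum_b_le_max[OF A(1), of "\<lambda>_. 1" 1] by simp
    also have "\<dots> \<le> 6 * K * real m powr (1 / 2)"
      using A K_ge_1 by (simp add: powr_half_sqrt)
    finally show "ennreal (norm (\<Sum>j\<in>A. b j)) \<le> ennreal (6 * K) * ennreal (real m powr (1 / 2))"
      using K_ge_1 by (simp flip: ennreal_mult)
  qed
  moreover have "ennreal (real m powr (1 / 2)) \<le> ennreal (7 * K) * fundamental_function b m" for m
  proof -
    define f where "f = (\<Sum>j<m. b j)"
    have f: "f = (\<Sum>j<m. smul 1 (b j))" by (simp add: f_def)
    have "1 * sqrt (card {..<m}) \<le> 7 * K * norm f"
      by (rule card_large_coeffs_le) (auto simp only: f biorthogonal_sum[OF fn_b' bio_b finite_lessThan] norm_one if_True)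
    then have "ennreal (real m powr (1 / 2)) \<le> ennreal (7 * K) * ennreal (norm f)"
      using K_ge_1 by (simp add: powr_half_sqrt flip: ennreal_mult)
    also have "\<dots> \<le> ennreal (7 * K) * fundamental_function b m"
      unfolding fundamental_function_def f_def by (intro mult_left_mono SUP_upper) auto
    finally show ?thesis .
  qed
  ultimately show ?thesis
    unfolding approx_on_def lesssim_on_def by blast
qed

text \<open>The support meets at most \<open>floor_log m + 1\<close> blocks, and projections inside
  one block cost \<open>20 * K^2\<close>, whatever the conditionality of the vectors
  \<open>c (lead n)\<close>.\<close>

lemma conditionality_const_b_le:
  assumes m: "m \<ge> 2"
  shows "conditionality_const smul b m \<le> ennreal (40 * K\<^sup>2 / ln 2) * ennreal (ln m)"
  unfolding conditionality_const_def
proof (rule SUP_least, clarify)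
  fix f A assume f: "f \<noteq> 0" and supp: "supp smul b f \<subseteq> {..<m}"
  define n where "n = floor_log m"
  define M where "M = Suc n"
  have "m < 2 * 2 ^ n" unfolding n_def by (rule floor_log_exp2_gt)
  then have "m \<le> lead M" by (simp add: M_def lead_def)
  then have "coord_proj smul b A f = (\<Sum>i\<in>A \<inter> {..<lead M}. smul (b' i f) (b i))"
    using supp by (intro coord_proj_b) auto
  also have "\<dots> = (\<Sum>i<lead M. if i \<in> A then smul (b' i f) (b i) else 0)"
    by (rule sum.mono_neutral_cong_left) auto
  also have "\<dots> = (\<Sum>k<M. \<Sum>i\<in>A \<inter> block k. smul (b' i f) (b i))"
    unfolding sum_lessThan_lead by (intro sum.cong refl sum.mono_neutral_cong_right) auto
  also have "norm \<dots> \<le> (\<Sum>k<M. 20 * K\<^sup>2 * norm f)"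
    by (intro sum_norm_le norm_block_sum_le) auto
  finally have 1: "norm (coord_proj smul b A f) \<le> M * (20 * K\<^sup>2 * norm f)"
    by simp
  have "real (2 ^ n) \<le> real m" unfolding n_def using m by (intro of_nat_mono floor_log_exp2_le) auto
  then have "ln (2 ^ n) \<le> ln (real m)" using m by (subst ln_le_cancel_iff) auto
  moreover have "ln 2 \<le> ln (real m)" using m by (subst ln_le_cancel_iff) auto
  ultimately have "M * ln 2 \<le> 2 * ln (real m)"
    by (simp add: M_def ln_realpow distrib_right)
  then have "M \<le> 2 * ln (real m) / ln 2" by (simp add: pos_le_divide_eq)
  then have "M * (20 * K\<^sup>2) \<le> 2 * ln (real m) / ln 2 * (20 * K\<^sup>2)"
    by (rule mult_right_mono) simp
  moreover have "norm (coord_proj smul b A f) / norm f \<le> M * (20 * K\<^sup>2)"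
    using 1 f by (simp add: divide_le_eq mult.assoc)
  ultimately have "norm (coord_proj smul b A f) / norm f \<le> 40 * K\<^sup>2 / ln 2 * ln m"
    by (simp add: mult_ac)
  then show "ennreal (norm (coord_proj smul b A f) / norm f) \<le> ennreal (40 * K\<^sup>2 / ln 2) * ennreal (ln m)"
    using m by (simp flip: ennreal_mult)
qed

text \<open>A vector \<open>\<Sum>\<^sub>n s\<^sub>n c (lead n)\<close> with \<open>n < k\<close> is supported in \<open>k\<close> blocks, that is, in \<open>{..<lead k}\<close>,
  which turns linear growth of the constants of \<open>c \<circ> lead\<close> into logarithmic growth.\<close>

lemma conditionality_const_b_ge:
  assumes k: "lead k \<le> m" and A: "A \<subseteq> {..<k}"
    and nz: "(\<Sum>n<k. smul (s n) (c (lead n))) \<noteq> 0"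
    and le: "d * norm (\<Sum>n<k. smul (s n) (c (lead n))) \<le> norm (\<Sum>n\<in>A. smul (s n) (c (lead n)))"
  shows "ennreal d \<le> conditionality_const smul b m"
proof -
  define f where "f = (\<Sum>n<k. smul (s n) (c (lead n)))"
  \<comment> \<open>A vector at a leading index has constant coefficients on its block.\<close>
  have bl: "b' i (c (lead n)) = (if blk i = n then of_real (wt n) else 0)" for i n
  proof -
    have "b' i (c (lead n)) = (\<Sum>j\<in>block (blk i). if j = lead n then of_real (hh (blk i) i (lead n)) else 0)"
      unfolding b'_def by (rule sum.cong) (auto simp: bio of_real_def)
    then show ?thesis by (auto simp: mem_block_iff hh_lead)
  qed
  have bf: "b' i f = (if blk i < k then s (blk i) * of_real (wt (blk i)) else 0)" for i
  proof -
    have "b' i f = (\<Sum>n<k. if blk i = n then s n * of_real (wt n) else 0)"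
      unfolding f_def functional_sum[OF fn_b'] functional_smul[OF fn_b'] bl by (rule sum.cong) auto
    then show ?thesis by simp
  qed
  have supp: "supp smul b f \<subseteq> {..<lead k}"
    by (auto simp: supp_def coord_b bf less_lead_iff split: if_splits)
  \<comment> \<open>A union of whole blocks: projecting the rotated system onto it amounts to
    projecting the vectors \<open>c (lead n)\<close> onto \<open>A\<close>.\<close>
  define A' where "A' = {i. blk i \<in> A}"
  have "coord_proj smul b A' f = (\<Sum>i\<in>A' \<inter> {..<lead k}. smul (b' i f) (b i))"
    using supp by (intro coord_proj_b) auto
  also have "\<dots> = (\<Sum>i<lead k. if i \<in> A' then smul (b' i f) (b i) else 0)"
    by (rule sum.mono_neutral_cong_left) auto
  also have "\<dots> = (\<Sum>n<k. if n \<in> A then smul (s n) (c (lead n)) else 0)"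
    unfolding sum_lessThan_lead
  proof (rule sum.cong[OF refl])
    fix n assume n: "n \<in> {..<k}"
    have "(\<Sum>i\<in>block n. if i \<in> A' then smul (b' i f) (b i) else 0) =
        (if n \<in> A then (\<Sum>i\<in>block n. smul (s n * of_real (wt n)) (b i)) else 0)"
      using n by (auto simp: A'_def mem_block_iff bf intro!: sum.cong sum.neutral)
    also have "(\<Sum>i\<in>block n. smul (s n * of_real (wt n)) (b i)) =
        (\<Sum>j\<in>block n. smul (\<Sum>i\<in>block n. hh n j i *\<^sub>R (s n * of_real (wt n))) (c j))"
      by (rule synthesis_block)
    also have "\<dots> = (\<Sum>j\<in>block n. if j = lead n then smul (s n) (c j) else 0)"
    proof (rule sum.cong[OF refl])
      fix j assume j: "j \<in> block n"
      have "(\<Sum>i\<in>block n. hh n j i *\<^sub>R (s n * of_real (wt n))) = (\<Sum>i\<in>block n. hh n j i * hh n i (lead n)) *\<^sub>R s n"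
        unfolding scaleR_sum_left by (rule sum.cong) (auto simp: hh_lead scaleR_conv_of_real)
      also have "\<dots> = (if j = lead n then 1 else 0) *\<^sub>R s n"
        using j by (simp add: hh_square)
      finally show "smul (\<Sum>i\<in>block n. hh n j i *\<^sub>R (s n * of_real (wt n))) (c j) = (if j = lead n then smul (s n) (c j) else 0)"
        by simp
    qed
    also have "\<dots> = smul (s n) (c (lead n))" by simp
    finally show "(\<Sum>i\<in>block n. if i \<in> A' then smul (b' i f) (b i) else 0) = (if n \<in> A then smul (s n) (c (lead n)) else 0)" .
  qed
  also have "\<dots> = (\<Sum>n\<in>A. smul (s n) (c (lead n)))"
    using A by (intro sum.mono_neutral_cong_right) auto
  finally have "d * norm f \<le> norm (coord_proj smul b A' f)"
    using le by (simp add: f_def)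
  then have "d \<le> norm (coord_proj smul b A' f) / norm f"
    using nz by (simp add: f_def pos_le_divide_eq)
  then have "ennreal d \<le> ennreal (norm (coord_proj smul b A' f) / norm f)"
    by (rule ennreal_leI)
  also have "\<dots> \<le> conditionality_const smul b m"
    unfolding conditionality_const_def using supp k nz
    by (intro SUP_upper2[of "(f, A')"]) (auto simp: f_def)
  finally show ?thesis .
qed

text \<open>With \<open>k = floor_log m\<close> the first \<open>k\<close> blocks fit below
  \<open>m\<close>, and \<open>ln m\<close> is at most \<open>1 + k\<close>, hence at most
  \<open>2 * k\<close>.\<close>

lemma conditionality_const_b:
  assumes \<delta>: "\<delta> > 0"
    and cond: "\<And>k. k \<ge> 1 \<Longrightarrow> \<exists>s A. A \<subseteq> {..<k} \<and> (\<Sum>n<k. smul (s n) (c (lead n))) \<noteq> 0 \<and>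
      \<delta> * k * norm (\<Sum>n<k. smul (s n) (c (lead n))) \<le> norm (\<Sum>n\<in>A. smul (s n) (c (lead n)))"
  shows "approx_on {2..} (conditionality_const smul b) (\<lambda>m. ennreal (ln (real m)))"
proof -
  have "ennreal (ln m) \<le> ennreal (2 / \<delta>) * conditionality_const smul b m" if m: "m \<ge> 2" for m
  proof -
    define k where "k = floor_log m"
    have k: "k \<ge> 1" "2 ^ k \<le> m" "m < 2 * 2 ^ k"
      using m floor_log_rec[of m] floor_log_exp2_le[of m] floor_log_exp2_gt[of m] by (auto simp: k_def)
    then have lk: "lead k \<le> m" by (simp add: lead_def)
    obtain s A where sA: "A \<subseteq> {..<k}" "(\<Sum>n<k. smul (s n) (c (lead n))) \<noteq> 0"
      "\<delta> * k * norm (\<Sum>n<k. smul (s n) (c (lead n))) \<le> norm (\<Sum>n\<in>A. smul (s n) (c (lead n)))"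
      using cond[OF k(1)] by blast
    have 1: "ennreal (\<delta> * k) \<le> conditionality_const smul b m"
      using conditionality_const_b_ge[OF lk sA] .
    have "real m \<le> real (2 * 2 ^ k)" using k(3) by (intro of_nat_mono) simp
    then have "ln (real m) \<le> ln (2 * 2 ^ k)" using m by (subst ln_le_cancel_iff) auto
    also have "\<dots> = ln 2 + k * ln 2" by (simp add: ln_mult ln_realpow)
    also have "\<dots> \<le> 1 + real k"
      using ln_2_less_1 mult_left_mono[of "ln 2" 1 "real k"] by simp
    also have "\<dots> \<le> 2 / \<delta> * (\<delta> * k)" using k(1) \<delta> by simp
    finally have "ennreal (ln m) \<le> ennreal (2 / \<delta> * (\<delta> * k))"
      by (rule ennreal_leI)
    also have "\<dots> = ennreal (2 / \<delta>) * ennreal (\<delta> * k)" using \<delta> by (intro ennreal_mult) auto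
    also have "\<dots> \<le> ennreal (2 / \<delta>) * conditionality_const smul b m"
      by (intro mult_left_mono 1) auto
    finally show ?thesis .
  qed
  then show ?thesis
    unfolding approx_on_def lesssim_on_def using conditionality_const_b_le by (metis atLeast_iff)
qed

end

section \<open>Conditional bases of the spaces of tuples\<close>

lemma ell_norm_1: "ell_norm 1 n v = (\<Sum>i<n. norm (v i))"
  by (simp add: ell_norm_def one_ereal_def sum_nonneg)

lemma ell_norm_infty: "ell_norm \<infinity> n v = Max ((\<lambda>i. norm (v i)) ` {..<n})"
  by (simp add: ell_norm_def)

text \<open>For \<open>r = 1\<close> the basis is \<open>e\<^sub>i - e\<^bsub>i-1\<^esub>\<close>, for \<open>r = \<infinity>\<close> it is the summing basis; they are dual
  to each other.\<close>

definition cvec :: "ereal \<Rightarrow> nat \<Rightarrow> nat \<Rightarrow> nat \<Rightarrow> 'k::real_or_complex" where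
  "cvec r N i j =
    (if r = 1 then (if j = i then 1 else 0) - (if Suc j = i then 1 else 0)
     else if i \<le> j \<and> j < N then 1 else 0)"

definition cfun :: "ereal \<Rightarrow> nat \<Rightarrow> nat \<Rightarrow> (nat \<Rightarrow> 'k::real_or_complex) \<Rightarrow> 'k" where
  "cfun r N i v =
    (if r = 1 then (\<Sum>j\<in>{i..<N}. v j) else v i - (if i = 0 then 0 else v (i - 1)))"

locale ell_exponent =
  fixes r :: ereal
  assumes r: "r = 1 \<or> r = \<infinity>"
begin

text \<open>For dimension 0 and \<open>r = \<infinity>\<close> the norm is the maximum of an empty
  set, which carries no information; hence the positivity of \<open>n\<close> here and
  below.\<close>

lemma ell_norm_nonneg: "n > 0 \<Longrightarrow> 0 \<le> ell_norm r n v"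
proof -
  assume n: "n > 0"
  have "norm (v 0) \<le> Max ((\<lambda>i. norm (v i)) ` {..<n})"
    using n by (intro Max_ge) auto
  then have "0 \<le> Max ((\<lambda>i. norm (v i)) ` {..<n})"
    by (rule order_trans[OF norm_ge_zero])
  then show ?thesis using r by (auto simp: ell_norm_1 ell_norm_infty sum_nonneg)
qed

lemma norm_coordinate_le: "i < n \<Longrightarrow> norm (v i) \<le> ell_norm r n v"
  using r by (auto simp: ell_norm_1 ell_norm_infty intro!: member_le_sum Max_ge)

lemma ell_norm_infty_le:
  assumes "n > 0" "\<And>i. i < n \<Longrightarrow> norm (v i) \<le> K"
  shows "ell_norm \<infinity> n v \<le> K"
  unfolding ell_norm_infty by (rule Max.boundedI) (use assms in auto)

lemma norm_coordinate_le_infty: "i < n \<Longrightarrow> norm (v i) \<le> ell_norm \<infinity> n v"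
  by (auto simp: ell_norm_infty)

lemma ell_norm_mono:
  assumes "n > 0" "\<And>i. i < n \<Longrightarrow> norm (u i) \<le> norm (v i)"
  shows "ell_norm r n u \<le> ell_norm r n v"
  using r
proof
  assume "r = 1"
  then show ?thesis using assms by (auto simp: ell_norm_1 intro!: sum_mono)
next
  assume r: "r = \<infinity>"
  have "norm (u i) \<le> ell_norm \<infinity> n v" if "i < n" for i
    using assms(2)[OF that] norm_coordinate_le_infty[OF that, of v] by linarith
  then show ?thesis using assms(1) r by (auto intro!: ell_norm_infty_le)
qed

lemma ell_norm_triangle:
  assumes "n > 0"
  shows "ell_norm r n (\<lambda>i. u i + v i) \<le> ell_norm r n u + ell_norm r n v"
  using r
proof
  assume "r = 1"
  then show ?thesis by (simp add: ell_norm_1 norm_triangle_ineq sum_mono flip: sum.distrib)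
next
  assume r: "r = \<infinity>"
  have "norm (u i + v i) \<le> ell_norm r n u + ell_norm r n v" if "i < n" for i
    using norm_coordinate_le[OF that, of u] norm_coordinate_le[OF that, of v] norm_triangle_ineq[of "u i" "v i"] by linarith
  then show ?thesis using assms r by (auto intro!: ell_norm_infty_le)
qed

lemma ell_norm_scale:
  assumes "n > 0"
  shows "ell_norm r n (\<lambda>i. c * v i) = norm c * ell_norm r n v"
  using r
proof
  assume "r = 1"
  then show ?thesis by (simp add: ell_norm_1 norm_mult sum_distrib_left)
next
  assume r: "r = \<infinity>"
  have "mono (\<lambda>x. norm c * x)" by (auto intro!: monoI mult_left_mono)
  then have "norm c * Max ((\<lambda>i. norm (v i)) ` {..<n}) = Max ((\<lambda>x. norm c * x) ` (\<lambda>i. norm (v i)) ` {..<n})"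
    using assms by (intro mono_Max_commute) auto
  then show ?thesis using r by (simp add: ell_norm_infty norm_mult image_image)
qed

lemma ell_norm_cong:
  assumes "\<And>i. i < n \<Longrightarrow> u i = v i"
  shows "ell_norm r n u = ell_norm r n v"
  using r
proof
  assume "r = 1"
  then show ?thesis using assms by (auto simp: ell_norm_1 intro!: sum.cong)
next
  assume "r = \<infinity>"
  moreover have "(\<lambda>i. norm (u i)) ` {..<n} = (\<lambda>i. norm (v i)) ` {..<n}"
    using assms by (intro image_cong) auto
  ultimately show ?thesis by (simp add: ell_norm_infty)
qed

lemma ell_norm_0: "n > 0 \<Longrightarrow> ell_norm r n (\<lambda>i. 0) = 0"
  using ell_norm_scale[of n 0 "\<lambda>i. 0"] by simp

lemma ell_norm_extend:
  assumes n: "n > 0" "n \<le> m" and v: "\<And>i. n \<le> i \<Longrightarrow> i < m \<Longrightarrow> v i = 0"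
  shows "ell_norm r m v = ell_norm r n v"
  using r
proof
  assume r: "r = 1"
  have "(\<Sum>i<m. norm (v i)) = (\<Sum>i<n. norm (v i))"
    using n v by (intro sum.mono_neutral_right) auto
  then show ?thesis by (simp add: ell_norm_1 r)
next
  assume r: "r = \<infinity>"
  have "norm (v i) \<le> ell_norm r n v" if "i < m" for i
    using norm_coordinate_le[of i n v] v[of i] ell_norm_nonneg[OF n(1), of v] that by (cases "i < n") auto
  then have "ell_norm r m v \<le> ell_norm r n v"
    using n r by (auto intro!: ell_norm_infty_le)
  moreover have "ell_norm r n v \<le> ell_norm r m v"
    using n r by (auto intro!: ell_norm_infty_le norm_coordinate_le_infty)
  ultimately show ?thesis by simp
qed

lemma ell_norm_single:
  assumes "i < n"
  shows "ell_norm r n (\<lambda>j. if j = i then a else 0) = norm a"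
proof (rule antisym)
  have n: "n > 0" using assms by simp
  show "ell_norm r n (\<lambda>j. if j = i then a else 0) \<le> norm a"
    using r
  proof
    assume "r = 1"
    moreover have "(\<Sum>j<n. norm (if j = i then a else 0)) = (\<Sum>j<n. if j = i then norm a else 0)"
      by (rule sum.cong) auto
    ultimately show ?thesis using assms by (simp add: ell_norm_1)
  next
    assume "r = \<infinity>"
    then show ?thesis using n by (auto intro!: ell_norm_infty_le)
  qed
  show "norm a \<le> ell_norm r n (\<lambda>j. if j = i then a else 0)"
    using norm_coordinate_le[OF assms, of "\<lambda>j. if j = i then a else 0"] by simp
qed

lemma cfun_add: "cfun r N i (\<lambda>j. u j + v j) = cfun r N i u + cfun r N i v"
  by (simp add: cfun_def sum.distrib)

lemma cfun_scale: "cfun r N i (\<lambda>j. c * v j) = c * cfun r N i v"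
  by (simp add: cfun_def sum_distrib_left right_diff_distrib)

lemma cfun_cong: "i < N \<Longrightarrow> (\<And>j. j < N \<Longrightarrow> u j = v j) \<Longrightarrow> cfun r N i u = cfun r N i v"
  by (auto simp: cfun_def intro!: sum.cong)

lemma cvec_0: "i < N \<Longrightarrow> N \<le> j \<Longrightarrow> cvec r N i j = 0"
  by (auto simp: cvec_def)

lemma cfun_cvec: "i < N \<Longrightarrow> i' < N \<Longrightarrow> cfun r N i (cvec r N i' :: nat \<Rightarrow> 'k::real_or_complex) = (if i = i' then 1 else 0)"
proof (cases "r = 1")
  case True
  assume i: "i < N" "i' < N"
  have eq: "(if Suc j = i' then 1 else 0) = (if i' \<noteq> 0 \<and> j = i' - 1 then 1 else 0 :: 'k)" for j
    by auto
  show ?thesis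
    using i True by (cases i') (auto simp: cfun_def cvec_def eq sum_subtractf)
next
  case False
  assume i: "i < N" "i' < N"
  then show ?thesis
    using False by (auto simp: cfun_def cvec_def)
qed

text \<open>Telescoping: the coordinates before \<open>m - 1\<close> are kept, the coordinate
  \<open>m - 1\<close> receives the sum of the whole tail, and the later ones vanish.\<close>

lemma cvec_partial_sum_1:
  fixes v :: "nat \<Rightarrow> 'k::real_or_complex"
  assumes "r = 1" "m \<le> N" "j < N"
  shows "(\<Sum>i<m. cfun r N i v * cvec r N i j) = (if Suc j < m then v j else if Suc j = m then \<Sum>i\<in>{j..<N}. v i else 0)"
proof -
  have "(\<Sum>i<m. cfun r N i v * cvec r N i j) =
      (\<Sum>i<m. (if i = j then cfun r N i v else 0) - (if i = Suc j then cfun r N i v else 0))"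
    using assms by (intro sum.cong) (auto simp: cvec_def)
  also have "\<dots> = (if j < m then cfun r N j v else 0) - (if Suc j < m then cfun r N (Suc j) v else 0)"
    by (simp add: sum_subtractf)
  also have "cfun r N j v = v j + cfun r N (Suc j) v"
    using assms by (simp add: cfun_def sum.atLeast_Suc_lessThan)
  finally show ?thesis
    using assms by (auto simp: cfun_def sum.atLeast_Suc_lessThan)
qed

text \<open>Dually, the coordinates up to \<open>m - 1\<close> are kept and the last of them is
  continued as a constant.\<close>

lemma cvec_partial_sum_infty:
  fixes v :: "nat \<Rightarrow> 'k::real_or_complex"
  assumes "r = \<infinity>" "m \<le> N" "j < N"
  shows "(\<Sum>i<m. cfun r N i v * cvec r N i j) = (if m = 0 then 0 else v (min j (m - 1)))"
  using \<open>m \<le> N\<close>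
proof (induction m)
  case (Suc m)
  then have "(\<Sum>i<Suc m. cfun r N i v * cvec r N i j) =
      (if m = 0 then 0 else v (min j (m - 1))) + (if m \<le> j then v m - (if m = 0 then 0 else v (m - 1)) else 0)"
    using assms by (simp add: cfun_def cvec_def)
  then show ?case by (auto simp: min_def)
qed simp

text \<open>Neither collecting a tail in one coordinate of l1 nor repeating a coordinate of
  l_infinity increases the norm. The bound 1 is independent of \<open>N\<close>, so these bases can
  be joined over all dimensions.\<close>

lemma ell_norm_partial_sum_le:
  fixes v :: "nat \<Rightarrow> 'k::real_or_complex"
  assumes N: "N > 0" and m: "m \<le> N"
  shows "ell_norm r N (\<lambda>j. \<Sum>i<m. cfun r N i v * cvec r N i j) \<le> ell_norm r N v"
  using r
proof
  assume r: "r = 1"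
  have "ell_norm r N (\<lambda>j. \<Sum>i<m. cfun r N i v * cvec r N i j) =
      (\<Sum>j<N. norm (if Suc j < m then v j else if Suc j = m then \<Sum>i\<in>{j..<N}. v i else 0))"
    unfolding ell_norm_1[of N, folded r] by (intro sum.cong refl) (simp only: cvec_partial_sum_1[OF r m] lessThan_iff)
  also have "\<dots> \<le> (\<Sum>j<N. norm (v j))"
  proof (cases m)
    case (Suc p)
    have "(\<Sum>j<N. norm (if Suc j < m then v j else if Suc j = m then \<Sum>i\<in>{j..<N}. v i else 0)) =
      (\<Sum>j<N. (if j < p then norm (v j) else 0) + (if j = p then norm (\<Sum>i\<in>{p..<N}. v i) else 0))"
      by (rule sum.cong) (auto simp: Suc)
    also have "\<dots> = (\<Sum>j<p. norm (v j)) + norm (\<Sum>i\<in>{p..<N}. v i)"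
    proof -
      have "(\<Sum>j<N. if j < p then norm (v j) else 0) = (\<Sum>j<p. norm (v j))"
        using m Suc by (intro sum.mono_neutral_cong_right) auto
      then show ?thesis using m Suc by (simp add: sum.distrib)
    qed
    also have "\<dots> \<le> (\<Sum>j<p. norm (v j)) + (\<Sum>i\<in>{p..<N}. norm (v i))"
      by (intro add_left_mono norm_sum)
    also have "\<dots> = (\<Sum>j<N. norm (v j))"
      using m Suc by (simp add: sum.atLeastLessThan_concat flip: atLeast0LessThan)
    finally show ?thesis .
  qed (simp add: sum_nonneg)
  finally show ?thesis by (simp add: r ell_norm_1)
next
  assume r: "r = \<infinity>"
  have "norm (\<Sum>i<m. cfun r N i v * cvec r N i j) \<le> ell_norm r N v" if j: "j < N" for j
    using cvec_partial_sum_infty[OF r m j, of v] m j N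
    by (auto intro!: norm_coordinate_le ell_norm_nonneg)
  then show ?thesis using N r by (auto intro!: ell_norm_infty_le)
qed

lemma cvec_expansion:
  assumes "j < N"
  shows "(\<Sum>i<N. cfun r N i v * cvec r N i j) = v j"
  using r
proof
  assume "r = 1"
  from cvec_partial_sum_1[OF this order_refl assms, of v] show ?thesis
    using assms by (cases "N = Suc j") auto
next
  assume "r = \<infinity>"
  from cvec_partial_sum_infty[OF this order_refl assms, of v] show ?thesis
    using assms by (auto simp: min_def)
qed

lemma norm_cfun_le:
  assumes "i < N"
  shows "norm (cfun r N i v) \<le> 2 * ell_norm r N v"
  using r
proof
  assume r: "r = 1"
  have "norm (cfun r N i v) \<le> (\<Sum>j\<in>{i..<N}. norm (v j))"
    by (simp add: cfun_def r norm_sum)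
  also have "\<dots> \<le> (\<Sum>j<N. norm (v j))"
    by (rule sum_mono2) auto
  finally have "norm (cfun r N i v) \<le> ell_norm r N v" by (simp add: r ell_norm_1)
  then show ?thesis using ell_norm_nonneg[of N v] assms by simp
next
  assume r: "r = \<infinity>"
  have "norm (cfun r N i v) \<le> norm (v i) + norm (if i = 0 then 0 else v (i - 1))"
    unfolding cfun_def using r by (simp only: norm_triangle_ineq4 if_False) (simp add: norm_triangle_ineq4)
  moreover have "norm (if i = 0 then 0 else v (i - 1)) \<le> ell_norm r N v"
    using norm_coordinate_le[of "i - 1" N v] ell_norm_nonneg[of N v] assms by auto
  ultimately show ?thesis using norm_coordinate_le[OF assms, of v] by simp
qed

lemma ell_norm_cvec_le:
  assumes "i < N"
  shows "ell_norm r N (cvec r N i :: nat \<Rightarrow> 'k::real_or_complex) \<le> 2"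
  using r
proof
  assume r: "r = 1"
  have "ell_norm r N (cvec r N i :: nat \<Rightarrow> 'k) \<le>
      ell_norm r N (\<lambda>j. if j = i then 1 else 0 :: 'k) + ell_norm r N (\<lambda>j. if Suc j = i then - 1 else 0 :: 'k)"
  proof -
    have "(cvec r N i :: nat \<Rightarrow> 'k) = (\<lambda>j. (if j = i then 1 else 0) + (if Suc j = i then - 1 else 0))"
      by (auto simp: cvec_def r)
    then show ?thesis using assms by (simp only:) (rule ell_norm_triangle, simp)
  qed
  also have "ell_norm r N (\<lambda>j. if j = i then 1 else 0 :: 'k) = 1"
    using ell_norm_single[OF assms, of "1::'k"] by simp
  also have "ell_norm r N (\<lambda>j. if Suc j = i then - 1 else 0 :: 'k) \<le> 1"
  proof (cases i)
    case 0
    then show ?thesis using assms by (simp add: ell_norm_0)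
  next
    case (Suc p)
    then show ?thesis using ell_norm_single[of p N "- 1::'k"] assms by simp
  qed
  finally show ?thesis by simp
next
  assume "r = \<infinity>"
  then show ?thesis using assms by (auto simp: cvec_def intro!: ell_norm_infty_le)
qed

text \<open>In l1 the sum of all vectors telescopes to one unit vector, while the even ones alone
  leave entries 1 and -1 in all coordinates except possibly the last. In l_infinity alternating
  signs keep the running sums in {0, 1}, while the even terms accumulate in the last
  coordinate.\<close>

lemma cvec_conditional:
  assumes N: "N > 0"
  obtains a :: "nat \<Rightarrow> 'k::real_or_complex" and A where "A \<subseteq> {..<N}"
    "ell_norm r N (\<lambda>j. \<Sum>i<N. a i * cvec r N i j) = 1"
    "N \<le> 2 * ell_norm r N (\<lambda>j. \<Sum>i\<in>A. a i * cvec r N i j)"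
proof -
  define A where "A = {i. i < N \<and> even i}"
  show thesis
    using r
  proof
    assume r: "r = 1"
    have full: "(\<Sum>i<N. 1 * cvec r N i j) = (if j = N - 1 then 1 else 0 :: 'k)" if "j < N" for j
    proof -
      have "(\<Sum>i<N. 1 * cvec r N i j) = (\<Sum>i<N. (if i = j then 1 else 0) - (if i = Suc j then 1 else 0 :: 'k))"
        by (rule sum.cong) (auto simp: cvec_def r)
      also have "\<dots> = 1 - (if Suc j < N then 1 else 0)"
        using that by (simp add: sum_subtractf)
      finally show ?thesis using that by auto
    qed
    have "ell_norm r N (\<lambda>j. \<Sum>i<N. 1 * cvec r N i j :: 'k) = ell_norm r N (\<lambda>j. if j = N - 1 then 1 else 0 :: 'k)"
      by (rule ell_norm_cong) (rule full)
    also have "\<dots> = 1" using N by (subst ell_norm_single) auto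
    finally have 1: "ell_norm r N (\<lambda>j. \<Sum>i<N. 1 * cvec r N i j :: 'k) = 1" .
    have half: "(\<Sum>i\<in>A. 1 * cvec r N i j :: 'k) =
        (if even j then 1 else 0) - (if odd j \<and> Suc j < N then 1 else 0)" if "j < N" for j
    proof -
      have "(\<Sum>i\<in>A. 1 * cvec r N i j) = (\<Sum>i\<in>A. (if i = j then 1 else 0) - (if i = Suc j then 1 else 0 :: 'k))"
        by (rule sum.cong) (auto simp: cvec_def r)
      also have "\<dots> = (if even j then 1 else 0) - (if odd j \<and> Suc j < N then 1 else 0)"
        using that by (simp add: sum_subtractf A_def)
      finally show ?thesis .
    qed
    \<comment> \<open>The first \<open>N - 1\<close> coordinates contribute \<open>N - 1\<close>,
      which is at least \<open>N / 2\<close> once \<open>N\<close> is at least 2; dimension 1 is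
      checked by hand.\<close>
    have "real N \<le> 2 * (\<Sum>j<N. norm (\<Sum>i\<in>A. 1 * cvec r N i j :: 'k))"
    proof (cases "N = 1")
      case True
      have "(\<Sum>i\<in>A. 1 * cvec r N i 0 :: 'k) = 1" by (subst half[OF N]) simp
      then show ?thesis using True by simp
    next
      case False
      have "real (N - 1) = (\<Sum>j<N - 1. norm (\<Sum>i\<in>A. 1 * cvec r N i j :: 'k))"
        using half by (subst sum.cong[OF refl, of _ _ "\<lambda>_. 1"]) auto
      also have "\<dots> \<le> (\<Sum>j<N. norm (\<Sum>i\<in>A. 1 * cvec r N i j :: 'k))"
        by (rule sum_mono2) auto
      finally show ?thesis using N False by (simp add: of_nat_diff)
    qed
    then have 2: "N \<le> 2 * ell_norm r N (\<lambda>j. \<Sum>i\<in>A. 1 * cvec r N i j :: 'k)"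
      by (simp add: ell_norm_1 r)
    show thesis
      using that[of A "\<lambda>_. 1"] 1 2 by (auto simp: A_def)
  next
    assume r: "r = \<infinity>"
    have alt: "(\<Sum>i\<le>j. (- 1) ^ i) = (if even j then 1 else 0 :: 'k)" for j
      by (induction j) auto
    have full: "(\<Sum>i<N. (- 1) ^ i * cvec r N i j) = (if even j then 1 else 0 :: 'k)" if "j < N" for j
    proof -
      have "(\<Sum>i<N. (- 1) ^ i * cvec r N i j) = (\<Sum>i\<le>j. (- 1) ^ i :: 'k)"
        using that r by (intro sum.mono_neutral_cong_right) (auto simp: cvec_def)
      then show ?thesis by (simp add: alt)
    qed
    have "ell_norm r N (\<lambda>j. \<Sum>i<N. (- 1) ^ i * cvec r N i j :: 'k) \<le> 1"
      using N r full by (auto intro!: ell_norm_infty_le)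
    moreover have "1 \<le> ell_norm r N (\<lambda>j. \<Sum>i<N. (- 1) ^ i * cvec r N i j :: 'k)"
      using norm_coordinate_le[OF N, of "\<lambda>j. \<Sum>i<N. (- 1) ^ i * cvec r N i j :: 'k"] full[OF N] by simp
    ultimately have 1: "ell_norm r N (\<lambda>j. \<Sum>i<N. (- 1) ^ i * cvec r N i j :: 'k) = 1" by simp
    have "(\<Sum>i\<in>A. (- 1) ^ i * cvec r N i (N - 1)) = (\<Sum>i\<in>A. 1 :: 'k)"
      using r N by (intro sum.cong) (auto simp: A_def cvec_def)
    then have "norm (\<Sum>i\<in>A. (- 1) ^ i * cvec r N i (N - 1) :: 'k) = card A" by simp
    then have "card A \<le> ell_norm r N (\<lambda>j. \<Sum>i\<in>A. (- 1) ^ i * cvec r N i j :: 'k)"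
      using norm_coordinate_le[of "N - 1" N "\<lambda>j. \<Sum>i\<in>A. (- 1) ^ i * cvec r N i j :: 'k"] N by simp
    moreover have "N \<le> 2 * card A"
    proof -
      have "{..<N} \<subseteq> A \<union> Suc ` A"
      proof
        fix i assume "i \<in> {..<N}"
        then show "i \<in> A \<union> Suc ` A" by (cases i) (auto simp: A_def)
      qed
      then have "card {..<N} \<le> card (A \<union> Suc ` A)"
        by (intro card_mono) (auto simp: A_def)
      also have "\<dots> \<le> card A + card (Suc ` A)" by (rule card_Un_le)
      also have "card (Suc ` A) = card A" by (rule card_image) simp
      finally show ?thesis by simp
    qed
    ultimately have 2: "N \<le> 2 * ell_norm r N (\<lambda>j. \<Sum>i\<in>A. (- 1) ^ i * cvec r N i j :: 'k)" by linarith
    show thesis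
      using that[of A "\<lambda>i. (- 1) ^ i"] 1 2 by (auto simp: A_def)
  qed
qed

end

section \<open>Shifting blocks of coordinates\<close>

text \<open>Row \<open>n\<close> of a vector in \<open>(\<Oplus>\<^sub>n \<ell>\<^sub>r\<^sup>n\<^sup>+\<^sup>1)\<^sub>2\<close> belongs to the chain of the exponent of \<open>2\<close> in \<open>n + 1\<close>,
  and \<open>n + gap n\<close> is the next start_row of this chain. The operator \<open>shift\<close> moves the first \<open>width n\<close>
  coordinates along the chains; it frees the first \<open>2\<^sup>k\<close> coordinates in the rows \<open>start_row k\<close>, and one
  more when \<open>k\<close> is not of the form \<open>lead n\<close>.\<close>

definition chain :: "nat \<Rightarrow> nat" where "chain n = multiplicity (2::nat) (Suc n)"

definition gap :: "nat \<Rightarrow> nat" where "gap n = 2 * 2 ^ chain n"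

text \<open>The vectors of the l2 summand will be numbered by the indices outside
  \<open>range lead\<close>, since the indices in \<open>range lead\<close> belong to the
  conditional basis. This decides for which \<open>k\<close> an additional coordinate is
  moved.\<close>

definition width :: "nat \<Rightarrow> nat" where
  "width n = (case chain n of 0 \<Rightarrow> 0 | Suc k \<Rightarrow> 2 ^ k + (if k \<in> range lead then 0 else 1))"

definition chain_start :: "nat \<Rightarrow> bool" where "chain_start n \<longleftrightarrow> Suc n = 2 ^ chain n"

definition start_row :: "nat \<Rightarrow> nat" where "start_row k = lead (Suc k)"

lemma chain_eqI: "Suc n = 2 ^ a * (2 * j + 1) \<Longrightarrow> chain n = a"
  unfolding chain_def
proof (rule multiplicity_eqI)
  assume n: "Suc n = 2 ^ a * (2 * j + 1)"
  show "2 ^ a dvd Suc n" unfolding n by (rule dvd_triv_left)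
  have "2 ^ a * 2 dvd 2 ^ a * (2 * j + 1) \<longleftrightarrow> 2 dvd 2 * j + 1"
    by (rule dvd_times_left_cancel_iff) simp
  moreover have "\<not> 2 dvd 2 * j + 1" by simp
  ultimately show "\<not> 2 ^ Suc a dvd Suc n" unfolding n power_Suc2 by blast
qed

lemma chain_decompose: obtains j where "Suc n = 2 ^ chain n * (2 * j + 1)"
proof -
  obtain y where y: "Suc n = 2 ^ chain n * y" "\<not> 2 dvd y"
    using multiplicity_decompose'[of "Suc n" "2::nat"] unfolding chain_def by auto
  then obtain j where "y = 2 * j + 1" by (elim oddE) auto
  then show ?thesis using y that by blast
qed

lemma width_le: "width n \<le> Suc n"
proof (cases "chain n")
  case (Suc k)
  obtain j where j: "Suc n = 2 ^ chain n * (2 * j + 1)" by (rule chain_decompose)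
  have "(1::nat) \<le> 2 ^ k" by simp
  then have "width n \<le> 2 ^ chain n * 1" unfolding width_def Suc by simp
  also have "\<dots> \<le> Suc n" unfolding j by (intro mult_left_mono) auto
  finally show ?thesis .
qed (simp add: width_def)

lemma chain_next: "chain (n + gap n) = chain n" "\<not> chain_start (n + gap n)"
proof -
  obtain j where "Suc n = 2 ^ chain n * (2 * j + 1)" by (rule chain_decompose)
  then have "Suc (n + gap n) = 2 ^ chain n * (2 * (j + 1) + 1)" by (simp add: gap_def algebra_simps)
  then show c: "chain (n + gap n) = chain n" by (rule chain_eqI)
  have "2 ^ chain n < Suc (n + gap n)" by (simp add: gap_def)
  then show "\<not> chain_start (n + gap n)" by (simp add: chain_start_def c)
qed

lemma chain_previous:
  assumes "\<not> chain_start n"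
  shows "gap n \<le> n" "chain (n - gap n) = chain n"
proof -
  obtain j where j: "Suc n = 2 ^ chain n * (2 * j + 1)" by (rule chain_decompose)
  then obtain i where i: "j = Suc i"
    using assms by (cases j) (auto simp: chain_start_def)
  have eq: "Suc n = 2 ^ chain n * (2 * i + 1) + gap n"
    using j i by (simp add: gap_def algebra_simps)
  moreover have "2 ^ chain n * (2 * i + 1) \<noteq> 0" by simp
  ultimately show "gap n \<le> n" by linarith
  then have "Suc (n - gap n) = 2 ^ chain n * (2 * i + 1)" using eq by linarith
  then show "chain (n - gap n) = chain n" by (rule chain_eqI)
qed

lemma gap_next: "gap (n + gap n) = gap n" and width_next: "width (n + gap n) = width n"
  by (simp_all add: gap_def[of "_ + _"] width_def chain_next) (simp add: gap_def)

lemma gap_previous: "\<not> chain_start n \<Longrightarrow> gap (n - gap n) = gap n"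
  and width_previous: "\<not> chain_start n \<Longrightarrow> width (n - gap n) = width n"
  by (simp_all add: gap_def[of "_ - _"] width_def chain_previous) (simp add: gap_def)

lemma inj_next: "inj (\<lambda>n. n + gap n)"
proof (rule injI)
  fix m n assume eq: "m + gap m = n + gap n"
  then have "gap m = gap n" using gap_next[of m] gap_next[of n] by simp
  then show "m = n" using eq by simp
qed

lemma inj_previous: "inj_on (\<lambda>n. n - gap n) {n. \<not> chain_start n}"
proof (rule inj_onI)
  fix m n assume mn: "m \<in> {n. \<not> chain_start n}" "n \<in> {n. \<not> chain_start n}"
    and eq: "m - gap m = n - gap n"
  then have "gap m = gap n" using gap_previous[of m] gap_previous[of n] by simp
  then show "m = n" using eq chain_previous(1)[of m] chain_previous(1)[of n] mn by simp
qed

lemma chain_start_row: "chain_start (start_row k)"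
  and width_row: "width (start_row k) = 2 ^ k + (if k \<in> range lead then 0 else 1)"
proof -
  have c: "chain (start_row k) = Suc k"
    by (rule chain_eqI[of _ _ 0]) (simp add: start_row_def Suc_lead)
  show "chain_start (start_row k)" unfolding chain_start_def c by (simp add: start_row_def Suc_lead)
  show "width (start_row k) = 2 ^ k + (if k \<in> range lead then 0 else 1)" by (simp add: width_def c)
qed

lemma inj_row: "inj start_row"
  using inj_lead by (auto simp: start_row_def inj_def)

lemma start_row_eq_iff [simp]: "start_row k = start_row l \<longleftrightarrow> k = l"
  using inj_row by (auto simp: inj_def)

lemma chain_start_cases:
  assumes "chain_start n" "width n > 0" obtains k where "n = start_row k"
proof -
  obtain k where "chain n = Suc k" using assms(2) by (cases "chain n") (auto simp: width_def)
  then have "n = start_row k" using assms(1) unfolding chain_start_def start_row_def lead_def by simp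
  then show ?thesis by (rule that)
qed

lemma pow_less_row: "2 ^ k < Suc (start_row k)"
  by (simp add: start_row_def Suc_lead)

text \<open>A left inverse of \<open>shift\<close>. The remaining part, the identity minus
  \<open>shift\<close> after \<open>unshift\<close>, is \<open>freed\<close>; so the coordinates
  emptied by the shift form a complement of its range.\<close>

definition unshift :: "(nat \<Rightarrow> nat \<Rightarrow> 'k) \<Rightarrow> nat \<Rightarrow> nat \<Rightarrow> 'k" where
  "unshift u n i = u (if i < width n then n + gap n else n) i"

definition shift :: "(nat \<Rightarrow> nat \<Rightarrow> 'k::zero) \<Rightarrow> nat \<Rightarrow> nat \<Rightarrow> 'k" where
  "shift u n i = (if i < width n then if chain_start n then 0 else u (n - gap n) i else u n i)"

definition freed :: "(nat \<Rightarrow> nat \<Rightarrow> 'k::zero) \<Rightarrow> nat \<Rightarrow> nat \<Rightarrow> 'k" where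
  "freed u n i = (if i < width n \<and> chain_start n then u n i else 0)"

lemma unshift_shift: "unshift (shift u) = u"
  by (intro ext) (auto simp: unshift_def shift_def gap_next width_next chain_next)

lemma shift_unshift: "shift (unshift u) n i + freed u n i = (u n i :: 'k::monoid_add)"
  by (auto simp: unshift_def shift_def freed_def gap_previous width_previous chain_previous)

lemma unshift_freed: "unshift (freed u) = (\<lambda>n i. 0)"
  by (intro ext) (auto simp: unshift_def freed_def width_next chain_next)

lemma shift_row: "j < width (start_row k) \<Longrightarrow> shift u (start_row k) j = 0"
  by (simp add: shift_def chain_start_row)

section \<open>The spaces of sequences of tuples\<close>

context ell_exponent
begin

lemma B_carrierI:
  assumes rows: "\<And>n. u n \<in> ell_carrier (Suc n)" and K: "0 \<le> K"
    and bd: "\<And>M. (\<Sum>n<M. (ell_norm r (Suc n) (u n))\<^sup>2) \<le> K\<^sup>2"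
  shows "u \<in> B_carrier r" "B_norm r u \<le> K"
proof -
  have s: "summable (\<lambda>n. (ell_norm r (Suc n) (u n))\<^sup>2)"
    by (rule summableI_nonneg_bounded[OF _ bd]) simp
  then show "u \<in> B_carrier r" using rows by (simp add: B_carrier_def)
  have "(\<Sum>n. (ell_norm r (Suc n) (u n))\<^sup>2) \<le> K\<^sup>2"
    by (rule suminf_le_const[OF s bd])
  then show "B_norm r u \<le> K" unfolding B_norm_def using K by (rule real_le_lsqrt[rotated])
qed

lemma B_carrier_row: "u \<in> B_carrier r \<Longrightarrow> u n \<in> ell_carrier (Suc n)"
  by (simp add: B_carrier_def)

lemma B_norm_nonneg: "u \<in> B_carrier r \<Longrightarrow> 0 \<le> B_norm r u"
  by (auto simp: B_norm_def B_carrier_def intro: suminf_nonneg)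

lemma sum_row_norms_le:
  assumes "u \<in> B_carrier r" "finite F"
  shows "(\<Sum>n\<in>F. (ell_norm r (Suc n) (u n))\<^sup>2) \<le> (B_norm r u)\<^sup>2"
proof -
  have s: "summable (\<lambda>n. (ell_norm r (Suc n) (u n))\<^sup>2)" using assms by (simp add: B_carrier_def)
  have "(\<Sum>n\<in>F. (ell_norm r (Suc n) (u n))\<^sup>2) \<le> (\<Sum>n. (ell_norm r (Suc n) (u n))\<^sup>2)"
    using s assms by (intro sum_le_suminf) auto
  also have "\<dots> = (B_norm r u)\<^sup>2"
    unfolding B_norm_def using s by (simp add: suminf_nonneg)
  finally show ?thesis .
qed

lemma row_norm_le: "u \<in> B_carrier r \<Longrightarrow> ell_norm r (Suc n) (u n) \<le> B_norm r u"
  using sum_row_norms_le[of u "{n}"] by (auto intro: power2_le_imp_le B_norm_nonneg)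

text \<open>Each row of \<open>v\<close> is controlled by the same row of \<open>u\<close> and at
  most one other row, selected injectively by \<open>g\<close>, so every row of \<open>u\<close> is
  counted at most twice. With \<open>G = {}\<close> this covers operators that act inside the
  rows.\<close>

lemma B_dominated:
  assumes u: "u \<in> B_carrier r" and rows: "\<And>n. v n \<in> ell_carrier (Suc n)" and g: "inj_on g G"
    and le: "\<And>n. ell_norm r (Suc n) (v n) \<le>
      (if n \<in> G then ell_norm r (Suc (g n)) (u (g n)) else 0) + ell_norm r (Suc n) (u n)"
  shows "v \<in> B_carrier r" "B_norm r v \<le> 2 * B_norm r u"
proof -
  have "(\<Sum>n<M. (ell_norm r (Suc n) (v n))\<^sup>2) \<le> (2 * B_norm r u)\<^sup>2" for M
  proof -
    have "(\<Sum>n<M. (ell_norm r (Suc n) (v n))\<^sup>2) \<le>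
        (\<Sum>n<M. 2 * (if n \<in> G then (ell_norm r (Suc (g n)) (u (g n)))\<^sup>2 else 0) + 2 * (ell_norm r (Suc n) (u n))\<^sup>2)"
    proof (rule sum_mono)
      fix n
      have "(ell_norm r (Suc n) (v n))\<^sup>2 \<le>
          ((if n \<in> G then ell_norm r (Suc (g n)) (u (g n)) else 0) + ell_norm r (Suc n) (u n))\<^sup>2"
        using le ell_norm_nonneg by (intro power_mono) auto
      also have "\<dots> \<le> 2 * (if n \<in> G then ell_norm r (Suc (g n)) (u (g n)) else 0)\<^sup>2 + 2 * (ell_norm r (Suc n) (u n))\<^sup>2"
      proof -
        have "(x + y)\<^sup>2 \<le> 2 * x\<^sup>2 + 2 * y\<^sup>2" for x y :: real
          using zero_le_power2[of "x - y"] by (simp add: power2_eq_square algebra_simps)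
        then show ?thesis .
      qed
      finally show "(ell_norm r (Suc n) (v n))\<^sup>2 \<le>
          2 * (if n \<in> G then (ell_norm r (Suc (g n)) (u (g n)))\<^sup>2 else 0) + 2 * (ell_norm r (Suc n) (u n))\<^sup>2"
        by (simp split: if_splits)
    qed
    also have "\<dots> = 2 * (\<Sum>n\<in>{..<M} \<inter> G. (ell_norm r (Suc (g n)) (u (g n)))\<^sup>2) + 2 * (\<Sum>n<M. (ell_norm r (Suc n) (u n))\<^sup>2)"
      by (simp add: sum.distrib sum.inter_restrict flip: sum_distrib_left)
    also have "(\<Sum>n\<in>{..<M} \<inter> G. (ell_norm r (Suc (g n)) (u (g n)))\<^sup>2) = (\<Sum>n\<in>g ` ({..<M} \<inter> G). (ell_norm r (Suc n) (u n))\<^sup>2)"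
      using g by (subst sum.reindex) (auto intro: inj_on_subset)
    also have "2 * \<dots> + 2 * (\<Sum>n<M. (ell_norm r (Suc n) (u n))\<^sup>2) \<le> 2 * (B_norm r u)\<^sup>2 + 2 * (B_norm r u)\<^sup>2"
      by (intro add_mono mult_left_mono sum_row_norms_le[OF u]) auto
    finally show ?thesis by (simp add: power_mult_distrib)
  qed
  then show "v \<in> B_carrier r" "B_norm r v \<le> 2 * B_norm r u"
    using B_carrierI[of v "2 * B_norm r u"] rows B_norm_nonneg[OF u] by auto
qed

lemma B_carrier_add:
  assumes "u \<in> B_carrier r" "v \<in> B_carrier r"
  shows "(\<lambda>n i. u n i + v n i) \<in> B_carrier r"
proof (rule B_carrierI)
  show "0 \<le> 2 * (B_norm r u + B_norm r v)" using assms[THEN B_norm_nonneg] by simp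
  fix M
  have "(\<Sum>n<M. (ell_norm r (Suc n) (\<lambda>i. u n i + v n i))\<^sup>2) \<le>
      (\<Sum>n<M. 2 * (ell_norm r (Suc n) (u n))\<^sup>2 + 2 * (ell_norm r (Suc n) (v n))\<^sup>2)"
  proof (rule sum_mono)
    fix n
    have "(ell_norm r (Suc n) (\<lambda>i. u n i + v n i))\<^sup>2 \<le> (ell_norm r (Suc n) (u n) + ell_norm r (Suc n) (v n))\<^sup>2"
      by (intro power_mono ell_norm_triangle ell_norm_nonneg) auto
    also have "\<dots> \<le> 2 * (ell_norm r (Suc n) (u n))\<^sup>2 + 2 * (ell_norm r (Suc n) (v n))\<^sup>2"
      using zero_le_power2[of "ell_norm r (Suc n) (u n) - ell_norm r (Suc n) (v n)"]
      by (simp add: power2_eq_square algebra_simps)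
    finally show "(ell_norm r (Suc n) (\<lambda>i. u n i + v n i))\<^sup>2 \<le>
      2 * (ell_norm r (Suc n) (u n))\<^sup>2 + 2 * (ell_norm r (Suc n) (v n))\<^sup>2" .
  qed
  also have "\<dots> \<le> 2 * (B_norm r u)\<^sup>2 + 2 * (B_norm r v)\<^sup>2"
    unfolding sum.distrib sum_distrib_left[symmetric]
    by (intro add_mono mult_left_mono sum_row_norms_le assms) auto
  also have "\<dots> \<le> (2 * (B_norm r u + B_norm r v))\<^sup>2"
    using assms[THEN B_norm_nonneg] by (simp add: power2_eq_square algebra_simps)
  finally show "(\<Sum>n<M. (ell_norm r (Suc n) (\<lambda>i. u n i + v n i))\<^sup>2) \<le> (2 * (B_norm r u + B_norm r v))\<^sup>2" .
qed (use assms in \<open>auto simp: B_carrier_def ell_carrier_def\<close>)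

lemma B_carrier_scale:
  assumes "u \<in> B_carrier r"
  shows "(\<lambda>n i. c * u n i) \<in> B_carrier r"
proof (rule B_carrierI)
  show "0 \<le> norm c * B_norm r u" using B_norm_nonneg[OF assms] by simp
  fix M
  have "(\<Sum>n<M. (ell_norm r (Suc n) (\<lambda>i. c * u n i))\<^sup>2) = (norm c)\<^sup>2 * (\<Sum>n<M. (ell_norm r (Suc n) (u n))\<^sup>2)"
    by (simp add: ell_norm_scale power_mult_distrib sum_distrib_left)
  also have "\<dots> \<le> (norm c)\<^sup>2 * (B_norm r u)\<^sup>2"
    by (intro mult_left_mono sum_row_norms_le assms) auto
  finally show "(\<Sum>n<M. (ell_norm r (Suc n) (\<lambda>i. c * u n i))\<^sup>2) \<le> (norm c * B_norm r u)\<^sup>2"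
    by (simp add: power_mult_distrib)
qed (use assms in \<open>auto simp: B_carrier_def ell_carrier_def\<close>)

lemma B_carrier_single:
  assumes "w \<in> ell_carrier (Suc n)"
  shows "(\<lambda>m i. if m = n then w i else 0) \<in> B_carrier r"
    "B_norm r (\<lambda>m i. if m = n then w i else 0) = ell_norm r (Suc n) w"
proof -
  have eq: "(\<lambda>m. (ell_norm r (Suc m) (\<lambda>i. if m = n then w i else 0))\<^sup>2) =
      (\<lambda>m. if m = n then (ell_norm r (Suc m) w)\<^sup>2 else 0)"
    by (auto simp: ell_norm_0)
  have "(\<lambda>m. if m = n then (ell_norm r (Suc m) w)\<^sup>2 else 0) sums (ell_norm r (Suc n) w)\<^sup>2"
    using sums_single[of n "\<lambda>m. (ell_norm r (Suc m) w)\<^sup>2"] by simp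
  then have s: "(\<lambda>m. (ell_norm r (Suc m) (\<lambda>i. if m = n then w i else 0))\<^sup>2) sums (ell_norm r (Suc n) w)\<^sup>2"
    unfolding eq .
  show "(\<lambda>m i. if m = n then w i else 0) \<in> B_carrier r"
    using assms sums_summable[OF s] by (auto simp: B_carrier_def ell_carrier_def)
  show "B_norm r (\<lambda>m i. if m = n then w i else 0) = ell_norm r (Suc n) w"
    unfolding B_norm_def sums_unique[OF s, symmetric] by (simp add: ell_norm_nonneg)
qed

lemma B_carrier_0: "(\<lambda>n i. 0) \<in> B_carrier r"
  by (rule B_carrierI(1)[of _ 0]) (simp_all add: ell_carrier_def ell_norm_0)

lemma B_tail:
  assumes u: "u \<in> B_carrier r"
  shows "(\<lambda>n i. if n < M then 0 else u n i) \<in> B_carrier r"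
    "(\<lambda>M. B_norm r (\<lambda>n i. if n < M then 0 else u n i)) \<longlonglongrightarrow> 0"
proof -
  let ?a = "\<lambda>n. (ell_norm r (Suc n) (u n))\<^sup>2"
  have s: "summable ?a" using u by (simp add: B_carrier_def)
  have t: "(\<lambda>n. (ell_norm r (Suc n) (\<lambda>i. if n < M then 0 else u n i))\<^sup>2) sums (suminf ?a - (\<Sum>n<M. ?a n))" for M
  proof -
    have eq: "(\<lambda>n. (ell_norm r (Suc n) (\<lambda>i. if n < M then 0 else u n i))\<^sup>2) =
        (\<lambda>n. ?a n - (if n \<in> {..<M} then ?a n else 0))"
      by (auto simp: ell_norm_0)
    show ?thesis unfolding eq
      by (intro sums_diff summable_sums[OF s] sums_If_finite_set) auto
  qed
  show "(\<lambda>n i. if n < M then 0 else u n i) \<in> B_carrier r" for M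
    using u sums_summable[OF t] by (auto simp: B_carrier_def ell_carrier_def)
  have eq: "B_norm r (\<lambda>n i. if n < M then 0 else u n i) = sqrt (suminf ?a - (\<Sum>n<M. ?a n))" for M
    unfolding B_norm_def sums_unique[OF t, symmetric] ..
  have "(\<lambda>M. sqrt (suminf ?a - (\<Sum>n<M. ?a n))) \<longlonglongrightarrow> sqrt (suminf ?a - suminf ?a)"
    by (intro tendsto_intros summable_LIMSEQ s)
  then show "(\<lambda>M. B_norm r (\<lambda>n i. if n < M then 0 else u n i)) \<longlonglongrightarrow> 0"
    unfolding eq by simp
qed

text \<open>A piece of a row can be moved to a row of another dimension without increasing its norm,
  since zero entries do not affect the norm.\<close>

lemma B_cut_row:
  assumes u: "u \<in> B_carrier r" and w: "w \<le> Suc n" "w \<le> Suc m"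
  shows "ell_norm r (Suc n) (\<lambda>i. if i < w then u m i else 0) \<le> ell_norm r (Suc m) (u m)"
proof (cases "w = 0")
  case True
  then show ?thesis by (simp add: ell_norm_0 ell_norm_nonneg)
next
  case False
  have "ell_norm r (Suc n) (\<lambda>i. if i < w then u m i else 0) = ell_norm r w (\<lambda>i. if i < w then u m i else 0)"
    using w False by (intro ell_norm_extend) auto
  also have "\<dots> = ell_norm r (Suc m) (\<lambda>i. if i < w then u m i else 0)"
    using w False by (intro ell_norm_extend[symmetric]) auto
  also have "\<dots> \<le> ell_norm r (Suc m) (u m)"
    by (rule ell_norm_mono) auto
  finally show ?thesis .
qed

lemma unshift_bounded:
  assumes u: "u \<in> B_carrier r"
  shows "unshift u \<in> B_carrier r" "B_norm r (unshift u) \<le> 2 * B_norm r u"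
proof -
  have rows: "unshift u n \<in> ell_carrier (Suc n)" for n
    using width_le[of n] B_carrier_row[OF u, of n] by (auto simp: ell_carrier_def unshift_def)
  have le: "ell_norm r (Suc n) (unshift u n) \<le>
      (if n \<in> UNIV then ell_norm r (Suc (n + gap n)) (u (n + gap n)) else 0) + ell_norm r (Suc n) (u n)" for n
  proof -
    have "unshift u n = (\<lambda>i. (if i < width n then u (n + gap n) i else 0) + (if i < width n then 0 else u n i))"
      by (auto simp: unshift_def)
    then have "ell_norm r (Suc n) (unshift u n) \<le>
        ell_norm r (Suc n) (\<lambda>i. if i < width n then u (n + gap n) i else 0) +
        ell_norm r (Suc n) (\<lambda>i. if i < width n then 0 else u n i)"
      by (simp only:) (rule ell_norm_triangle, simp)
    moreover have "ell_norm r (Suc n) (\<lambda>i. if i < width n then u (n + gap n) i else 0) \<le> ell_norm r (Suc (n + gap n)) (u (n + gap n))"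
      using width_le[of n] by (intro B_cut_row[OF u]) auto
    moreover have "ell_norm r (Suc n) (\<lambda>i. if i < width n then 0 else u n i) \<le> ell_norm r (Suc n) (u n)"
      by (rule ell_norm_mono) auto
    ultimately show ?thesis by simp
  qed
  show "unshift u \<in> B_carrier r" "B_norm r (unshift u) \<le> 2 * B_norm r u"
    using B_dominated[OF u rows inj_next le] by auto
qed

lemma shift_bounded:
  assumes u: "u \<in> B_carrier r"
  shows "shift u \<in> B_carrier r" "B_norm r (shift u) \<le> 2 * B_norm r u"
proof -
  have rows: "shift u n \<in> ell_carrier (Suc n)" for n
    using width_le[of n] B_carrier_row[OF u, of n] by (auto simp: ell_carrier_def shift_def)
  have le: "ell_norm r (Suc n) (shift u n) \<le>
      (if n \<in> {n. \<not> chain_start n} then ell_norm r (Suc (n - gap n)) (u (n - gap n)) else 0) + ell_norm r (Suc n) (u n)" for n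
  proof (cases "chain_start n")
    case True
    then show ?thesis by (simp, intro ell_norm_mono) (auto simp: shift_def)
  next
    case False
    then have "shift u n = (\<lambda>i. (if i < width n then u (n - gap n) i else 0) + (if i < width n then 0 else u n i))"
      by (auto simp: shift_def)
    then have "ell_norm r (Suc n) (shift u n) \<le>
        ell_norm r (Suc n) (\<lambda>i. if i < width n then u (n - gap n) i else 0) +
        ell_norm r (Suc n) (\<lambda>i. if i < width n then 0 else u n i)"
      by (simp only:) (rule ell_norm_triangle, simp)
    moreover have "ell_norm r (Suc n) (\<lambda>i. if i < width n then u (n - gap n) i else 0) \<le> ell_norm r (Suc (n - gap n)) (u (n - gap n))"
      using width_le[of n] width_le[of "n - gap n"] width_previous[OF False] by (intro B_cut_row[OF u]) auto
    moreover have "ell_norm r (Suc n) (\<lambda>i. if i < width n then 0 else u n i) \<le> ell_norm r (Suc n) (u n)"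
      by (rule ell_norm_mono) auto
    ultimately show ?thesis using False by simp
  qed
  show "shift u \<in> B_carrier r" "B_norm r (shift u) \<le> 2 * B_norm r u"
    using B_dominated[OF u rows inj_previous le] by auto
qed

lemma freed_in_B: 
  assumes u: "u \<in> B_carrier r"
  shows "freed u \<in> B_carrier r"
proof (rule B_dominated(1)[OF u, of _ id "{}"])
  fix n
  show "freed u n \<in> ell_carrier (Suc n)"
    using B_carrier_row[OF u, of n] by (auto simp: ell_carrier_def freed_def)
  show "ell_norm r (Suc n) (freed u n) \<le> (if n \<in> {} then ell_norm r (Suc (id n)) (u (id n)) else 0) + ell_norm r (Suc n) (u n)"
    by (simp, intro ell_norm_mono) (auto simp: freed_def)
qed simp

end

text \<open>The dyadic blocks are used a second time here, to enumerate the bases of all l_r^N with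
  N = 2^k in one sequence: \<open>block k\<close> has exactly N indices, and the offset is the
  position inside that basis.\<close>

lemma offset_less: "m - lead (blk m) < 2 ^ blk m"
  using mem_block_iff[of m "blk m"] by (auto simp: block_altdef lead_Suc)

lemma lead_blk_le: "lead (blk m) \<le> m"
  using mem_block_iff[of m "blk m"] by (auto simp: block_altdef)

lemma blk_lead_add: "i < 2 ^ k \<Longrightarrow> blk (lead k + i) = k"
  using mem_block_iff[of "lead k + i" k] by (auto simp: block_altdef lead_Suc)

lemma block_initial_segment:
  "{..<M} \<inter> block k = (\<lambda>i. lead k + i) ` {..<min (2 ^ k) (M - lead k)}"
proof (intro equalityI subsetI)
  fix m assume m: "m \<in> {..<M} \<inter> block k"
  then have "lead k \<le> m" "m - lead k < min (2 ^ k) (M - lead k)"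
    by (auto simp: block_altdef lead_Suc)
  then show "m \<in> (\<lambda>i. lead k + i) ` {..<min (2 ^ k) (M - lead k)}"
    by (intro image_eqI[of _ _ "m - lead k"]) auto
qed (auto simp: block_altdef lead_Suc)

section \<open>Vectors and functionals on the freed coordinates\<close>

context ell_exponent
begin

text \<open>The freed coordinates of \<open>start_row k\<close> carry the conditional basis of \<open>\<ell>\<^sub>r\<^sup>N\<close>, \<open>N = 2\<^sup>k\<close>, whose
  members are the vectors \<open>svecB m\<close> with \<open>m \<in> block k\<close>, and the additional vector \<open>hvecB k\<close>, which
  contributes to the Hilbert space part.\<close>

definition hvecB :: "nat \<Rightarrow> nat \<Rightarrow> nat \<Rightarrow> 'k::real_or_complex" where
  "hvecB k n j = (if n = start_row k then if j = 2 ^ k then 1 else 0 else 0)"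

definition svecB :: "nat \<Rightarrow> nat \<Rightarrow> nat \<Rightarrow> 'k::real_or_complex" where
  "svecB m n j = (if n = start_row (blk m) then cvec r (2 ^ blk m) (m - lead (blk m)) j else 0)"

definition hfunB :: "nat \<Rightarrow> (nat \<Rightarrow> nat \<Rightarrow> 'k::real_or_complex) \<Rightarrow> 'k" where
  "hfunB k u = u (start_row k) (2 ^ k)"

definition sfunB :: "nat \<Rightarrow> (nat \<Rightarrow> nat \<Rightarrow> 'k::real_or_complex) \<Rightarrow> 'k" where
  "sfunB m u = cfun r (2 ^ blk m) (m - lead (blk m)) (u (start_row (blk m)))"

lemma cfun_0: "cfun r N i (\<lambda>j. 0) = 0"
  using cfun_scale[of N i 0 "\<lambda>j. 0"] by simp

lemma hfunB_add: "hfunB k (\<lambda>n i. u n i + v n i) = hfunB k u + hfunB k v"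
  and hfunB_scale: "hfunB k (\<lambda>n i. c * u n i) = c * hfunB k u"
  and sfunB_add: "sfunB m (\<lambda>n i. u n i + v n i) = sfunB m u + sfunB m v"
  and sfunB_scale: "sfunB m (\<lambda>n i. c * u n i) = c * sfunB m u"
  by (simp_all add: hfunB_def sfunB_def cfun_add cfun_scale)

lemma sfunB_svecB: "sfunB i (svecB j :: _ \<Rightarrow> _ \<Rightarrow> 'k::real_or_complex) = (if i = j then 1 else 0)"
proof (cases "blk i = blk j")
  case True
  have "svecB j (start_row (blk i)) = (cvec r (2 ^ blk i) (j - lead (blk i)) :: _ \<Rightarrow> 'k)"
    by (auto simp: svecB_def True)
  then have "sfunB i (svecB j :: _ \<Rightarrow> _ \<Rightarrow> 'k) = (if i - lead (blk i) = j - lead (blk i) then 1 else 0)"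
    using offset_less[of i] offset_less[of j] True by (simp add: sfunB_def cfun_cvec)
  then show ?thesis
    using lead_blk_le[of i] lead_blk_le[of j] True by auto
next
  case False
  then have "svecB j (start_row (blk i)) = (\<lambda>_. 0 :: 'k)" by (auto simp: svecB_def)
  then show ?thesis
    using False by (auto simp: sfunB_def cfun_0)
qed

lemma hfunB_hvecB: "hfunB i (hvecB j) = (if i = j then 1 else 0)"
  by (auto simp: hfunB_def hvecB_def)

lemma sfunB_0: "(\<And>j. j < 2 ^ blk m \<Longrightarrow> u (start_row (blk m)) j = 0) \<Longrightarrow> sfunB m u = 0"
  unfolding sfunB_def using cfun_cong[OF offset_less, of m "u (start_row (blk m))" "\<lambda>j. 0"]
  by (simp add: cfun_0)

lemma sfunB_hvecB: "sfunB i (hvecB j) = 0"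
  by (rule sfunB_0) (auto simp: hvecB_def)

lemma hfunB_svecB: "hfunB i (svecB j) = 0"
  by (auto simp: hfunB_def svecB_def cvec_0[OF offset_less])

lemma sfunB_shift: "sfunB i (shift u) = 0"
  by (rule sfunB_0) (simp add: shift_row width_row)

lemma hfunB_shift: "k \<notin> range lead \<Longrightarrow> hfunB k (shift u) = 0"
  by (simp add: hfunB_def shift_row width_row)

lemma freed_svecB: "freed (svecB m) = svecB m"
proof (intro ext)
  fix n i
  show "freed (svecB m) n i = svecB m n i"
    by (cases "i < 2 ^ blk m")
      (auto simp: freed_def svecB_def width_row chain_start_row cvec_0[OF offset_less])
qed

lemma freed_hvecB: "k \<notin> range lead \<Longrightarrow> freed (hvecB k) = hvecB k"
  by (intro ext) (auto simp: freed_def hvecB_def width_row chain_start_row)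

lemma svecB_in: "(svecB m :: _ \<Rightarrow> _ \<Rightarrow> 'k::real_or_complex) \<in> B_carrier r" and B_norm_svecB: "B_norm r (svecB m :: _ \<Rightarrow> _ \<Rightarrow> 'k::real_or_complex) \<le> 2"
proof -
  let ?w = "cvec r (2 ^ blk m) (m - lead (blk m)) :: nat \<Rightarrow> 'k"
  have w: "?w \<in> ell_carrier (Suc (start_row (blk m)))"
    using pow_less_row[of "blk m"] by (auto simp: ell_carrier_def cvec_0[OF offset_less])
  have eq: "svecB m = (\<lambda>n i. if n = start_row (blk m) then ?w i else 0)"
    by (intro ext) (simp add: svecB_def)
  show "(svecB m :: _ \<Rightarrow> _ \<Rightarrow> 'k) \<in> B_carrier r"
    unfolding eq by (rule B_carrier_single[OF w])
  have "B_norm r (svecB m :: _ \<Rightarrow> _ \<Rightarrow> 'k) = ell_norm r (Suc (start_row (blk m))) ?w"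
    unfolding eq by (rule B_carrier_single[OF w])
  also have "\<dots> = ell_norm r (2 ^ blk m) ?w"
    using pow_less_row[of "blk m"] by (intro ell_norm_extend) (auto simp: cvec_0[OF offset_less])
  also have "\<dots> \<le> 2" by (rule ell_norm_cvec_le[OF offset_less])
  finally show "B_norm r (svecB m :: _ \<Rightarrow> _ \<Rightarrow> 'k) \<le> 2" .
qed

text \<open>The vectors occupy one coordinate each, in different rows, so the outer l2 norm is the
  only one that acts.\<close>

lemma hvecB_sum:
  fixes a :: "nat \<Rightarrow> 'k::real_or_complex"
  assumes F: "finite F"
  shows "(\<lambda>n j. \<Sum>k\<in>F. a k * hvecB k n j) \<in> B_carrier r"
    "B_norm r (\<lambda>n j. \<Sum>k\<in>F. a k * hvecB k n j) \<le> sqrt (\<Sum>k\<in>F. (norm (a k))\<^sup>2)"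
proof -
  define v where "v n j = (\<Sum>k\<in>F. a k * hvecB k n j)" for n j
  have start_row: "v (start_row k) = (\<lambda>j. if j = 2 ^ k then if k \<in> F then a k else 0 else 0)" for k
  proof
    fix j
    have "v (start_row k) j = (\<Sum>l\<in>F. if l = k then if j = 2 ^ k then a k else 0 else 0)"
      unfolding v_def by (rule sum.cong) (auto simp: hvecB_def)
    then show "v (start_row k) j = (if j = 2 ^ k then if k \<in> F then a k else 0 else 0)"
      using F by simp
  qed
  have other: "v n = (\<lambda>j. 0)" if "n \<notin> start_row ` F" for n
    using that unfolding v_def by (intro ext sum.neutral) (auto simp: hvecB_def)
  have nrm: "ell_norm r (Suc (start_row k)) (v (start_row k)) = norm (a k)" if "k \<in> F" for k
    using that pow_less_row[of k] by (simp add: start_row ell_norm_single)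
  have "(\<Sum>n<M. (ell_norm r (Suc n) (v n))\<^sup>2) \<le> (sqrt (\<Sum>k\<in>F. (norm (a k))\<^sup>2))\<^sup>2" for M
  proof -
    have "(\<Sum>n<M. (ell_norm r (Suc n) (v n))\<^sup>2) = (\<Sum>n\<in>{..<M} \<inter> start_row ` F. (ell_norm r (Suc n) (v n))\<^sup>2)"
      by (rule sum.mono_neutral_right) (auto simp: other ell_norm_0)
    also have "\<dots> \<le> (\<Sum>n\<in>start_row ` F. (ell_norm r (Suc n) (v n))\<^sup>2)"
      using F by (intro sum_mono2) auto
    also have "\<dots> = (\<Sum>k\<in>F. (norm (a k))\<^sup>2)"
      using inj_row nrm by (simp add: sum.reindex inj_on_subset)
    finally show ?thesis by (simp add: sum_nonneg)
  qed
  moreover have "v n \<in> ell_carrier (Suc n)" for n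
  proof (cases "n \<in> start_row ` F")
    case True
    then obtain k where "n = start_row k" by blast
    then show ?thesis using pow_less_row[of k] by (auto simp: start_row ell_carrier_def)
  qed (simp add: other ell_carrier_def)
  ultimately show "(\<lambda>n j. \<Sum>k\<in>F. a k * hvecB k n j) \<in> B_carrier r"
    "B_norm r (\<lambda>n j. \<Sum>k\<in>F. a k * hvecB k n j) \<le> sqrt (\<Sum>k\<in>F. (norm (a k))\<^sup>2)"
    using B_carrierI[of v "sqrt (\<Sum>k\<in>F. (norm (a k))\<^sup>2)"] by (auto simp: v_def[abs_def] sum_nonneg)
qed

lemma hvecB_in: "hvecB k \<in> B_carrier r"
  using hvecB_sum(1)[of "{k}" "\<lambda>_. 1"] by simp

lemma norm_sfunB_le: 
  assumes "u \<in> B_carrier r"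
  shows "norm (sfunB m u) \<le> 2 * B_norm r u"
proof -
  let ?k = "blk m"
  have "norm (sfunB m u) \<le> 2 * ell_norm r (2 ^ ?k) (u (start_row ?k))"
    unfolding sfunB_def by (rule norm_cfun_le[OF offset_less])
  also have "ell_norm r (2 ^ ?k) (u (start_row ?k)) = ell_norm r (2 ^ ?k) (\<lambda>i. if i < 2 ^ ?k then u (start_row ?k) i else 0)"
    by (rule ell_norm_cong) simp
  also have "\<dots> = ell_norm r (Suc (start_row ?k)) (\<lambda>i. if i < 2 ^ ?k then u (start_row ?k) i else 0)"
    using pow_less_row[of ?k] by (intro ell_norm_extend[symmetric]) auto
  also have "\<dots> \<le> ell_norm r (Suc (start_row ?k)) (u (start_row ?k))"
    by (rule ell_norm_mono) auto
  also have "\<dots> \<le> B_norm r u" by (rule row_norm_le[OF assms])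
  finally show ?thesis by simp
qed

lemma sum_hfunB_le:
  assumes "u \<in> B_carrier r" "finite F"
  shows "(\<Sum>k\<in>F. (norm (hfunB k u))\<^sup>2) \<le> (B_norm r u)\<^sup>2"
proof -
  have "(\<Sum>k\<in>F. (norm (hfunB k u))\<^sup>2) \<le> (\<Sum>k\<in>F. (ell_norm r (Suc (start_row k)) (u (start_row k)))\<^sup>2)"
    unfolding hfunB_def using pow_less_row by (intro sum_mono power_mono norm_coordinate_le) auto
  also have "\<dots> = (\<Sum>n\<in>start_row ` F. (ell_norm r (Suc n) (u n))\<^sup>2)"
    using inj_row by (simp add: sum.reindex inj_on_subset)
  also have "\<dots> \<le> (B_norm r u)\<^sup>2" using assms by (intro sum_row_norms_le) auto
  finally show ?thesis .
qed

lemma svecB_sum_row: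
  "(\<Sum>m<M. a m * svecB m (start_row k) j) =
    (\<Sum>i<min (2 ^ k) (M - lead k). a (lead k + i) * cvec r (2 ^ k) i j)"
proof -
  have "(\<Sum>m<M. a m * svecB m (start_row k) j) = (\<Sum>m\<in>{..<M} \<inter> block k. a m * cvec r (2 ^ k) (m - lead k) j)"
    by (rule sum.mono_neutral_cong_right) (auto simp: svecB_def mem_block_iff)
  also have "\<dots> = (\<Sum>i<min (2 ^ k) (M - lead k). a (lead k + i) * cvec r (2 ^ k) i j)"
    unfolding block_initial_segment by (subst sum.reindex) (auto simp: inj_on_def)
  finally show ?thesis .
qed

lemma svecB_sum_other: "n \<notin> range start_row \<Longrightarrow> (\<Sum>m<M. a m * svecB m n j) = 0"
  by (rule sum.neutral) (auto simp: svecB_def)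

text \<open>In each start row an initial segment of the sequence induces a partial sum of the basis
  of that row: complete for early rows, empty for late ones. The bound is thus inherited row by
  row.\<close>

lemma svecB_partial_sum:
  assumes u: "u \<in> B_carrier r"
  shows "(\<lambda>n j. \<Sum>m<M. sfunB m u * svecB m n j) \<in> B_carrier r"
    "B_norm r (\<lambda>n j. \<Sum>m<M. sfunB m u * svecB m n j) \<le> 2 * B_norm r u"
proof -
  define v where "v n j = (\<Sum>m<M. sfunB m u * svecB m n j)" for n j
  have start_row: "v (start_row k) j = (\<Sum>i<min (2 ^ k) (M - lead k). cfun r (2 ^ k) i (u (start_row k)) * cvec r (2 ^ k) i j)" for k j
    unfolding v_def svecB_sum_row by (rule sum.cong) (auto simp: sfunB_def blk_lead_add)
  have zero: "v (start_row k) j = 0" if "2 ^ k \<le> j" for k j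
    unfolding start_row using that by (intro sum.neutral) (auto simp: cvec_0)
  have other: "v n = (\<lambda>j. 0)" if "n \<notin> range start_row" for n
    by (simp add: v_def[abs_def] svecB_sum_other[OF that])
  have rows: "v n \<in> ell_carrier (Suc n)" for n
  proof (cases "n \<in> range start_row")
    case True
    then obtain k where n: "n = start_row k" by blast
    show ?thesis using zero[of k] pow_less_row[of k] by (auto simp: n ell_carrier_def)
  qed (simp add: other ell_carrier_def)
  have le: "ell_norm r (Suc n) (v n) \<le> (if n \<in> {} then ell_norm r (Suc (id n)) (u (id n)) else 0) + ell_norm r (Suc n) (u n)" for n
  proof (cases "n \<in> range start_row")
    case True
    then obtain k where n: "n = start_row k" by blast
    have "ell_norm r (Suc (start_row k)) (v (start_row k)) = ell_norm r (2 ^ k) (v (start_row k))"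
      using zero pow_less_row[of k] by (intro ell_norm_extend) auto
    also have "\<dots> \<le> ell_norm r (2 ^ k) (u (start_row k))"
      unfolding start_row by (rule ell_norm_partial_sum_le) auto
    also have "\<dots> = ell_norm r (2 ^ k) (\<lambda>i. if i < 2 ^ k then u (start_row k) i else 0)"
      by (rule ell_norm_cong) simp
    also have "\<dots> = ell_norm r (Suc (start_row k)) (\<lambda>i. if i < 2 ^ k then u (start_row k) i else 0)"
      using pow_less_row[of k] by (intro ell_norm_extend[symmetric]) auto
    also have "\<dots> \<le> ell_norm r (Suc (start_row k)) (u (start_row k))"
      by (rule ell_norm_mono) auto
    finally show ?thesis by (simp add: n)
  qed (simp add: other ell_norm_0 ell_norm_nonneg)
  show "(\<lambda>n j. \<Sum>m<M. sfunB m u * svecB m n j) \<in> B_carrier r"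
    "B_norm r (\<lambda>n j. \<Sum>m<M. sfunB m u * svecB m n j) \<le> 2 * B_norm r u"
    using B_dominated[OF u rows inj_on_empty le] by (simp_all add: v_def[abs_def])
qed

text \<open>Truncating at the row \<open>lead (Suc M)\<close> keeps precisely the start rows with
  \<open>k < M\<close>, on which the finite-dimensional expansions are exact. It turns density of
  the span into a statement about tails.\<close>

lemma freed_truncated_eq:
  assumes u: "u \<in> B_carrier r"
  shows "(if n < lead (Suc M) then freed u n j else 0) =
    (\<Sum>m<lead M. sfunB m u * svecB m n j) + (\<Sum>k\<in>{..<M} - range lead. hfunB k u * hvecB k n j)"
proof (cases "n \<in> range start_row")
  case True
  then obtain k where n: "n = start_row k" by blast
  have less: "start_row k < lead (Suc M) \<longleftrightarrow> k < M"
    unfolding start_row_def by (simp add: less_lead_iff)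
  have h: "(\<Sum>l\<in>{..<M} - range lead. hfunB l u * hvecB l (start_row k) j) =
      (if k \<in> {..<M} - range lead \<and> j = 2 ^ k then u (start_row k) (2 ^ k) else 0)"
  proof -
    have "(\<Sum>l\<in>{..<M} - range lead. hfunB l u * hvecB l (start_row k) j) =
        (\<Sum>l\<in>{..<M} - range lead. if l = k then if j = 2 ^ k then u (start_row k) (2 ^ k) else 0 else 0)"
      by (rule sum.cong) (auto simp: hvecB_def hfunB_def)
    then show ?thesis by simp
  qed
  have s: "(\<Sum>m<lead M. sfunB m u * svecB m (start_row k) j) = (if k < M \<and> j < 2 ^ k then u (start_row k) j else 0)"
  proof -
    have "(\<Sum>m<lead M. sfunB m u * svecB m (start_row k) j) =
        (\<Sum>i<min (2 ^ k) (lead M - lead k). cfun r (2 ^ k) i (u (start_row k)) * cvec r (2 ^ k) i j)"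
      unfolding svecB_sum_row by (rule sum.cong) (auto simp: sfunB_def blk_lead_add)
    also have "\<dots> = (if k < M \<and> j < 2 ^ k then u (start_row k) j else 0)"
    proof (cases "k < M")
      case True
      then have "lead (Suc k) \<le> lead M" by (intro lead_mono) simp
      then have "min (2 ^ k) (lead M - lead k) = 2 ^ k" by (simp add: lead_Suc)
      then show ?thesis using True cvec_expansion[of j "2 ^ k" "u (start_row k)"]
        by (cases "j < 2 ^ k") (auto simp: cvec_0 intro!: sum.neutral)
    next
      case False
      then have "lead M \<le> lead k" by (intro lead_mono) simp
      then show ?thesis using False by simp
    qed
    finally show ?thesis .
  qed
  show ?thesis
    unfolding n s h by (auto simp: less freed_def width_row chain_start_row)
next
  case False
  have "freed u n j = 0"
    using False chain_start_cases[of n] by (force simp: freed_def)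
  moreover have "(\<Sum>k\<in>{..<M} - range lead. hfunB k u * hvecB k n j) = 0"
    using False by (intro sum.neutral) (auto simp: hvecB_def)
  ultimately show ?thesis using svecB_sum_other[OF False] by simp
qed

lemma svecB_block_conditional:
  obtains a :: "nat \<Rightarrow> 'k::real_or_complex" and A where "A \<subseteq> {..<2 ^ k}"
    "(\<lambda>n j. \<Sum>i<2 ^ k. a i * svecB (lead k + i) n j) \<in> B_carrier r"
    "B_norm r (\<lambda>n j. \<Sum>i<2 ^ k. a i * svecB (lead k + i) n j) = 1"
    "(\<lambda>n j. \<Sum>i\<in>A. a i * svecB (lead k + i) n j) \<in> B_carrier r"
    "2 ^ k \<le> 2 * B_norm r (\<lambda>n j. \<Sum>i\<in>A. a i * svecB (lead k + i) n j)"
proof -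
  obtain a :: "nat \<Rightarrow> 'k" and A where A: "A \<subseteq> {..<2 ^ k}"
    and 1: "ell_norm r (2 ^ k) (\<lambda>j. \<Sum>i<2 ^ k. a i * cvec r (2 ^ k) i j) = 1"
    and 2: "real (2 ^ k) \<le> 2 * ell_norm r (2 ^ k) (\<lambda>j. \<Sum>i\<in>A. a i * cvec r (2 ^ k) i j)"
    by (rule cvec_conditional[of "2 ^ k"]) (simp, blast)
  have *: "(\<lambda>n j. \<Sum>i\<in>F. a i * svecB (lead k + i) n j) \<in> B_carrier r \<and>
      B_norm r (\<lambda>n j. \<Sum>i\<in>F. a i * svecB (lead k + i) n j) = ell_norm r (2 ^ k) (\<lambda>j. \<Sum>i\<in>F. a i * cvec r (2 ^ k) i j)"
    if F: "F \<subseteq> {..<2 ^ k}" for F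
  proof -
    let ?w = "\<lambda>j. \<Sum>i\<in>F. a i * cvec r (2 ^ k) i j"
    have zero: "?w j = 0" if "2 ^ k \<le> j" for j
      using F that by (intro sum.neutral) (auto simp: cvec_0)
    then have w: "?w \<in> ell_carrier (Suc (start_row k))"
      using pow_less_row[of k] by (auto simp: ell_carrier_def)
    have eq: "(\<lambda>n j. \<Sum>i\<in>F. a i * svecB (lead k + i) n j) = (\<lambda>n j. if n = start_row k then ?w j else 0)"
      using F by (intro ext) (auto simp: svecB_def blk_lead_add subset_iff intro!: sum.cong sum.neutral)
    have "ell_norm r (Suc (start_row k)) ?w = ell_norm r (2 ^ k) ?w"
      using zero pow_less_row[of k] by (intro ell_norm_extend) auto
    then show ?thesis
      unfolding eq using B_carrier_single[OF w] by simp
  qed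
  show thesis
    by (rule that[of A a]) (use *[of "{..<2 ^ k}"] *[OF A] A 1 2 in simp_all)
qed

end

lemma sum_lessThan_parity:
  fixes g :: "nat \<Rightarrow> 'v::comm_monoid_add"
  shows "(\<Sum>n<M. g n) = (\<Sum>i<Suc M div 2. g (2 * i)) + (\<Sum>i<M div 2. g (2 * i + 1))"
proof (induction M)
  case (Suc M)
  show ?case
  proof (cases "even M")
    case True
    then obtain p where "M = 2 * p" by (elim evenE)
    then show ?thesis using Suc by (simp add: add_ac)
  next
    case False
    then obtain p where "M = 2 * p + 1" by (elim oddE)
    then show ?thesis using Suc by (simp add: add_ac)
  qed
qed simp

section \<open>Splitting the space along the freed coordinates\<close>

locale block_complement = banach_space_over smul + ell_exponent r
  for smul :: "'k::real_or_complex \<Rightarrow> 'a::banach \<Rightarrow> 'a" and r :: ereal +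
  fixes x :: "nat \<Rightarrow> 'a" and P :: "'a \<Rightarrow> 'a" and T :: "(nat \<Rightarrow> nat \<Rightarrow> 'k) \<Rightarrow> 'a"
  assumes basis: "schauder_basis smul x"
    and P_linear: "bounded_linear P" and P_smul: "P (smul c f) = smul c (P f)" and P_idem: "P (P f) = P f"
    and T_add: "u \<in> B_carrier r \<Longrightarrow> v \<in> B_carrier r \<Longrightarrow> T (\<lambda>n i. u n i + v n i) = T u + T v"
    and T_scale: "u \<in> B_carrier r \<Longrightarrow> T (\<lambda>n i. c * u n i) = smul c (T u)"
    and T_bounds: "\<exists>c C. 0 < c \<and> (\<forall>u\<in>B_carrier r. c * B_norm r u \<le> norm (T u) \<and> norm (T u) \<le> C * B_norm r u)"
    and T_range: "T ` B_carrier r = range P"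
begin

section \<open>The embedded copy of the space and its complement\<close>

lemma P_add: "P (f + g) = P f + P g" and P_diff: "P (f - g) = P f - P g"
  using P_linear by (simp_all add: bounded_linear.linear linear_add linear_diff)

lemma T_0: "T (\<lambda>n i. 0) = 0"
  using T_scale[OF B_carrier_0, of 0] by simp

lemma P_T: "u \<in> B_carrier r \<Longrightarrow> P (T u) = T u"
  using T_range P_idem by (metis image_eqI rangeE)

lemma T_sum:
  assumes "finite F" "\<And>y. y \<in> F \<Longrightarrow> w y \<in> B_carrier r"
  shows "(\<lambda>n j. \<Sum>y\<in>F. a y * w y n j) \<in> B_carrier r"
    and "T (\<lambda>n j. \<Sum>y\<in>F. a y * w y n j) = (\<Sum>y\<in>F. smul (a y) (T (w y)))"
proof -
  have "(\<lambda>n j. \<Sum>y\<in>F. a y * w y n j) \<in> B_carrier r \<and>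
    T (\<lambda>n j. \<Sum>y\<in>F. a y * w y n j) = (\<Sum>y\<in>F. smul (a y) (T (w y)))"
    using assms
  proof (induction F rule: finite_induct)
    case empty
    then show ?case by (simp add: B_carrier_0 T_0)
  next
    case (insert y F)
    have 1: "(\<lambda>n j. a y * w y n j) \<in> B_carrier r" "T (\<lambda>n j. a y * w y n j) = smul (a y) (T (w y))"
      using insert.prems by (auto intro: B_carrier_scale T_scale)
    show ?case
      using insert 1 B_carrier_add[OF 1(1)] T_add[OF 1(1)] by auto
  qed
  then show "(\<lambda>n j. \<Sum>y\<in>F. a y * w y n j) \<in> B_carrier r"
    "T (\<lambda>n j. \<Sum>y\<in>F. a y * w y n j) = (\<Sum>y\<in>F. smul (a y) (T (w y)))" by blast+
qed

lemma T_inj: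
  assumes u: "u \<in> B_carrier r" and v: "v \<in> B_carrier r" and eq: "T u = T v"
  shows "u = v"
proof (intro ext)
  fix n i
  define d where "d n i = u n i + - 1 * v n i" for n i
  have d: "d \<in> B_carrier r" unfolding d_def[abs_def] by (intro B_carrier_add B_carrier_scale u v)
  have "T d = 0"
    unfolding d_def[abs_def] using eq by (subst T_add[OF u B_carrier_scale[OF v]], subst T_scale[OF v]) simp
  then have "B_norm r d \<le> 0"
    using T_bounds d by (metis mult_le_0_iff norm_zero not_less)
  then have le: "ell_norm r (Suc n) (d n) \<le> 0" using row_norm_le[OF d, of n] by simp
  have "d n i = 0" if "i < Suc n"
  proof -
    have "norm (d n i) \<le> 0" using norm_coordinate_le[OF that, of "d n"] le by linarith
    then show ?thesis by simp
  qed
  moreover have "d n i = 0" if "\<not> i < Suc n"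
    using B_carrier_row[OF d, of n] that by (simp add: ell_carrier_def)
  ultimately show "u n i = v n i" by (auto simp: d_def)
qed

text \<open>The projection followed by the inverse of \<open>T\<close>; the choice is unique because
  \<open>T\<close> is injective on the carrier.\<close>

definition U :: "'a \<Rightarrow> nat \<Rightarrow> nat \<Rightarrow> 'k" where
  "U f = (SOME u. u \<in> B_carrier r \<and> T u = P f)"

lemma U_in: "U f \<in> B_carrier r" and T_U: "T (U f) = P f"
proof -
  have "P f \<in> T ` B_carrier r" using T_range by blast
  then have "\<exists>u. u \<in> B_carrier r \<and> T u = P f" by (metis imageE)
  from someI_ex[OF this] show "U f \<in> B_carrier r" "T (U f) = P f"
    unfolding U_def by blast+
qed

lemma U_eqI: "u \<in> B_carrier r \<Longrightarrow> T u = P f \<Longrightarrow> U f = u"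
  using T_inj[OF U_in] T_U by metis

lemma U_T: "u \<in> B_carrier r \<Longrightarrow> U (T u) = u"
  by (rule U_eqI) (simp_all add: P_T)

lemma U_add: "U (f + g) = (\<lambda>n i. U f n i + U g n i)"
  by (rule U_eqI) (simp_all add: B_carrier_add U_in T_add T_U P_add)

lemma U_smul: "U (smul c f) = (\<lambda>n i. c * U f n i)"
  by (rule U_eqI) (simp_all add: B_carrier_scale U_in T_scale T_U P_smul)

text \<open>The shift transported by \<open>T\<close> to the range of \<open>P\<close> and extended
  by the identity on the kernel of \<open>P\<close>. Its left inverse \<open>G\<close> is built
  likewise from \<open>unshift\<close>, so the range of \<open>J\<close> is a copy of the whole
  space, complemented by the freed vectors.\<close>

definition J :: "'a \<Rightarrow> 'a" where "J g = (g - P g) + T (shift (U g))"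

definition G :: "'a \<Rightarrow> 'a" where "G f = (f - P f) + T (unshift (U f))"

lemma shift_in: "shift (U f) \<in> B_carrier r" and unshift_in: "unshift (U f) \<in> B_carrier r"
  by (rule shift_bounded(1)[OF U_in], rule unshift_bounded(1)[OF U_in])

lemma J_add: "J (f + g) = J f + J g"
proof -
  have "shift (U (f + g)) = (\<lambda>n i. shift (U f) n i + shift (U g) n i)"
    by (intro ext) (simp add: U_add shift_def)
  then show ?thesis by (simp add: J_def P_add T_add shift_in)
qed

lemma J_smul: "J (smul c f) = smul c (J f)"
proof -
  have "shift (U (smul c f)) = (\<lambda>n i. c * shift (U f) n i)"
    by (intro ext) (simp add: U_smul shift_def)
  then show ?thesis by (simp add: J_def P_smul T_scale shift_in scale_right_distrib scale_right_diff_distrib)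
qed

lemma G_add: "G (f + g) = G f + G g"
proof -
  have "unshift (U (f + g)) = (\<lambda>n i. unshift (U f) n i + unshift (U g) n i)"
    by (intro ext) (simp add: U_add unshift_def)
  then show ?thesis by (simp add: G_def P_add T_add unshift_in)
qed

lemma G_smul: "G (smul c f) = smul c (G f)"
proof -
  have "unshift (U (smul c f)) = (\<lambda>n i. c * unshift (U f) n i)"
    by (intro ext) (simp add: U_smul unshift_def)
  then show ?thesis by (simp add: G_def P_smul T_scale unshift_in scale_right_distrib scale_right_diff_distrib)
qed

lemma U_J: "U (J g) = shift (U g)"
  by (rule U_eqI) (simp_all add: shift_in J_def P_add P_diff P_idem P_T)

lemma U_G: "U (G f) = unshift (U f)"
  by (rule U_eqI) (simp_all add: unshift_in G_def P_add P_diff P_idem P_T)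

lemma G_J: "G (J g) = g"
proof -
  have "P (J g) = T (shift (U g))" by (simp add: J_def P_add P_diff P_idem P_T shift_in)
  then show ?thesis by (simp add: G_def U_J unshift_shift T_U) (simp add: J_def)
qed

lemma J_G: "J (G f) + T (freed (U f)) = f"
proof -
  have "P (G f) = T (unshift (U f))" by (simp add: G_def P_add P_diff P_idem P_T unshift_in)
  then have "J (G f) = (f - P f) + T (shift (unshift (U f)))" by (simp add: J_def U_G) (simp add: G_def)
  moreover have "T (shift (unshift (U f))) + T (freed (U f)) = T (U f)"
    using T_add[OF shift_bounded(1)[OF unshift_in] freed_in_B[OF U_in], of f f]
    by (simp add: shift_unshift)
  ultimately show ?thesis by (simp add: T_U add.assoc)
qed

lemma G_T_freed: "u \<in> B_carrier r \<Longrightarrow> freed u = u \<Longrightarrow> G (T u) = 0"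
  using unshift_freed[of u] by (simp add: G_def P_T U_T T_0)

lemma bounds:
  obtains M where "1 \<le> M" "\<And>u. u \<in> B_carrier r \<Longrightarrow> norm (T u) \<le> M * B_norm r u"
    "\<And>u. u \<in> B_carrier r \<Longrightarrow> B_norm r u \<le> M * norm (T u)"
    "\<And>f. B_norm r (U f) \<le> M * norm f" "\<And>f. norm (J f) \<le> M * norm f" "\<And>f. norm (G f) \<le> M * norm f"
    "\<And>m f. norm (\<Sum>i<m. smul (coord smul x i f) (x i)) \<le> M * norm f"
proof -
  obtain c C where c: "0 < c" and le: "\<And>u. u \<in> B_carrier r \<Longrightarrow> c * B_norm r u \<le> norm (T u)"
    and ge: "\<And>u. u \<in> B_carrier r \<Longrightarrow> norm (T u) \<le> C * B_norm r u"
    using T_bounds by blast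
  obtain p where p: "\<And>f. norm (P f) \<le> norm f * p" "0 \<le> p"
    using bounded_linear.nonneg_bounded[OF P_linear] by blast
  obtain s where s: "\<And>m f. norm (\<Sum>i<m. smul (coord smul x i f) (x i)) \<le> s * norm f"
    using schauder_basis_partial_sums_bounded[OF basis] by blast
  define D where "D = max C 0"
  have T_le: "norm (T u) \<le> D * B_norm r u" if "u \<in> B_carrier r" for u
    using ge[OF that] mult_right_mono[of C D "B_norm r u"] B_norm_nonneg[OF that] by (simp add: D_def)
  have T_ge: "B_norm r u \<le> (1 / c) * norm (T u)" if "u \<in> B_carrier r" for u
    using le[OF that] c by (simp add: field_simps)
  have U_le: "B_norm r (U f) \<le> (p / c) * norm f" for f
  proof -
    have "B_norm r (U f) \<le> (1 / c) * norm (P f)" using T_ge[OF U_in, of f] by (simp add: T_U)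
    also have "\<dots> \<le> (1 / c) * (norm f * p)" using p c by (intro mult_left_mono) auto
    finally show ?thesis by (simp add: mult.commute)
  qed
  have D: "D \<ge> 0" by (simp add: D_def)
  have T_shift: "norm (T v) \<le> 2 * D * (p / c) * norm f"
    if "v \<in> B_carrier r" "B_norm r v \<le> 2 * B_norm r (U f)" for v f
  proof -
    have "norm (T v) \<le> D * B_norm r v" by (rule T_le[OF that(1)])
    also have "\<dots> \<le> D * (2 * ((p / c) * norm f))"
      using that(2) U_le[of f] D by (intro mult_left_mono) auto
    finally show ?thesis by (simp add: mult_ac)
  qed
  have id_P: "norm (f - P f) \<le> (1 + p) * norm f" for f
    using norm_triangle_ineq4[of f "P f"] p(1)[of f] by (simp add: algebra_simps)
  define E where "E = 1 + p + 2 * D * (p / c)"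
  have J_le: "norm (J f) \<le> E * norm f" for f
    using norm_triangle_mono[OF id_P[of f] T_shift[OF shift_bounded[OF U_in, of f]]] by (simp add: J_def E_def algebra_simps)
  have G_le: "norm (G f) \<le> E * norm f" for f
    using norm_triangle_mono[OF id_P[of f] T_shift[OF unshift_bounded[OF U_in, of f]]] by (simp add: G_def E_def algebra_simps)
  define M where "M = Max {1, D, 1 / c, p / c, E, s}"
  have M: "1 \<le> M" "D \<le> M" "1 / c \<le> M" "p / c \<le> M" "E \<le> M" "s \<le> M"
    by (auto simp: M_def)
  show thesis
  proof (rule that[of M])
    show "norm (T u) \<le> M * B_norm r u" if "u \<in> B_carrier r" for u
      using T_le[OF that] mult_right_mono[OF M(2) B_norm_nonneg[OF that]] by linarith
    show "B_norm r u \<le> M * norm (T u)" if "u \<in> B_carrier r" for u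
      using T_ge[OF that] mult_right_mono[OF M(3) norm_ge_zero] by (rule order_trans)
    show "B_norm r (U f) \<le> M * norm f" for f
      using U_le mult_right_mono[OF M(4) norm_ge_zero] by (rule order_trans)
    show "norm (J f) \<le> M * norm f" for f
      using J_le mult_right_mono[OF M(5) norm_ge_zero] by (rule order_trans)
    show "norm (G f) \<le> M * norm f" for f
      using G_le mult_right_mono[OF M(5) norm_ge_zero] by (rule order_trans)
    show "norm (\<Sum>i<m. smul (coord smul x i f) (x i)) \<le> M * norm f" for m f
      using s mult_right_mono[OF M(6) norm_ge_zero] by (rule order_trans)
  qed (rule M(1))
qed

text \<open>Interlacing: even positions carry the embedded basis, odd positions the conditional
  vectors. Dividing by the norm of \<open>x\<close> here and multiplying by it in \<open>z'\<close>
  secures the uniform bounds on vectors and functionals that the rotation requires.\<close>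

definition z :: "nat \<Rightarrow> 'a" where
  "z n = (if even n then smul (of_real (1 / norm (x (n div 2)))) (J (x (n div 2))) else T (svecB (n div 2)))"

definition z' :: "nat \<Rightarrow> 'a \<Rightarrow> 'k" where
  "z' n f = (if even n then of_real (norm (x (n div 2))) * coord smul x (n div 2) (G f) else sfunB (n div 2) (U f))"

text \<open>The l2 vectors keep their own index outside \<open>range lead\<close>, exactly where
  \<open>width\<close> frees a coordinate for them.\<close>

definition c :: "nat \<Rightarrow> 'a" where
  "c i = (if i \<in> range lead then z (blk i) else T (hvecB i))"

definition c' :: "nat \<Rightarrow> 'a \<Rightarrow> 'k" where
  "c' i f = (if i \<in> range lead then z' (blk i) f else hfunB i (U f))"

section \<open>The combined system satisfies the requirements of the rotation\<close>

lemma c_lead [simp]: "c (lead n) = z n" and c'_lead [simp]: "c' (lead n) = z' n"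
  by (auto simp: c_def c'_def)

lemma functional_c': "functional (c' i)"
  unfolding functional_def c'_def z'_def
  by (auto simp: G_add G_smul U_add U_smul sfunB_add sfunB_scale hfunB_add hfunB_scale
    functional_add[OF functional_coord[OF basis]] functional_smul[OF functional_coord[OF basis]] algebra_simps)

lemma coord_x: "coord smul x m (x n) = (if m = n then 1 else 0)"
proof -
  have "(\<lambda>i. if i = n then x i else 0) sums x n"
    using sums_single[of n x] by simp
  moreover have "(\<lambda>i. if i = n then x i else 0) = (\<lambda>i. smul (if i = n then 1 else 0) (x i))"
    by auto
  ultimately show ?thesis
    using coord_eqI[OF basis, of "\<lambda>i. if i = n then 1 else 0" "x n" m] by simp
qed

lemma x_nonzero: "norm (x n) > 0"
  using schauder_basis_nonzero[OF basis] by simp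

lemma coord_0: "coord smul x n 0 = 0"
  by (rule functional_0[OF functional_coord[OF basis]])

lemma biorthogonal_z: "z' m (z n) = (if m = n then 1 else 0)"
proof -
  consider "even m" "even n" | "even m" "odd n" | "odd m" "even n" | "odd m" "odd n" by blast
  then show ?thesis
  proof cases
    case 1
    have "m div 2 = n div 2 \<longleftrightarrow> m = n" using 1 by (metis dvd_mult_div_cancel)
    moreover have "of_real (norm (x (n div 2))) * of_real (1 / norm (x (n div 2))) = (1 :: 'k)"
      using x_nonzero[of "n div 2"] by (simp flip: of_real_mult)
    ultimately show ?thesis
      using 1 by (auto simp: z'_def z_def G_smul G_J coord_x functional_smul[OF functional_coord[OF basis]])
  next
    case 2
    then show ?thesis
      by (auto simp: z'_def z_def G_T_freed[OF svecB_in freed_svecB] coord_0)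
  next
    case 3
    then show ?thesis
      by (auto simp: z'_def z_def U_smul U_J sfunB_scale sfunB_shift simp del: of_real_divide)
  next
    case 4
    have "m div 2 = n div 2 \<longleftrightarrow> m = n" using 4 by (metis odd_two_times_div_two_succ)
    then show ?thesis
      using 4 by (simp add: z'_def z_def U_T svecB_in sfunB_svecB)
  qed
qed

lemma biorthogonal_c: "c' i (c j) = (if i = j then 1 else 0)"
proof -
  have eq: "blk i = blk j \<longleftrightarrow> i = j" if "i \<in> range lead" "j \<in> range lead"
    using that by auto
  have "z' (blk i) (T (hvecB j)) = 0" if "j \<notin> range lead"
    by (simp add: z'_def U_T hvecB_in sfunB_hvecB G_T_freed[OF hvecB_in freed_hvecB[OF that]] coord_0)
  moreover have "hfunB i (U (z (blk j))) = 0" if "i \<notin> range lead"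
    using that by (simp add: z_def U_smul U_J hfunB_scale hfunB_shift U_T svecB_in hfunB_svecB del: of_real_divide)
  ultimately show ?thesis
    using eq by (auto simp: c'_def c_def biorthogonal_z U_T hvecB_in hfunB_hvecB)
qed

lemma J_diff: "J (f - g) = J f - J g"
  using J_add[of "f - g" g] by simp

lemma J_0: "J 0 = 0"
  using J_diff[of 0 0] by simp

lemma J_sum: "J (sum h F) = (\<Sum>i\<in>F. J (h i))"
  by (induction F rule: infinite_finite_induct) (simp_all add: J_0 J_add)

text \<open>An initial segment of the interlaced sequence consists of initial segments of its two
  constituents; \<open>Suc M div 2\<close> counts the even numbers below \<open>M\<close>.\<close>

lemma z_sums:
  "(\<Sum>n<M. smul (z' n f) (z n)) =
    J (\<Sum>i<Suc M div 2. smul (coord smul x i (G f)) (x i)) +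
    T (\<lambda>n j. \<Sum>m<M div 2. sfunB m (U f) * svecB m n j)"
proof -
  have even: "smul (z' (2 * i) f) (z (2 * i)) = J (smul (coord smul x i (G f)) (x i))" for i
  proof -
    have "of_real (norm (x i)) * of_real (1 / norm (x i)) = (1 :: 'k)"
      using x_nonzero[of i] by (simp flip: of_real_mult)
    then have "of_real (norm (x i)) * coord smul x i (G f) * of_real (1 / norm (x i)) = coord smul x i (G f)"
      by (metis mult.assoc mult.commute mult_1_left)
    then show ?thesis by (simp only: z'_def z_def J_smul scale_scale) simp
  qed
  have odd: "smul (z' (2 * i + 1) f) (z (2 * i + 1)) = smul (sfunB i (U f)) (T (svecB i))" for i
    by (simp add: z'_def z_def)
  show ?thesis
    unfolding sum_lessThan_parity[of _ M] even odd J_sum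
    by (subst T_sum(2)) (auto simp: svecB_in)
qed

text \<open>Cutting off late rows leaves a finite combination of the system, and the norm of the
  discarded tail tends to 0.\<close>

lemma T_freed_in_closure: "T (freed (U f)) \<in> closure (span (range c))"
proof -
  obtain M where M: "\<And>u. u \<in> B_carrier r \<Longrightarrow> norm (T u) \<le> M * B_norm r u"
    by (rule bounds) (rule that)
  define u where "u = U f"
  have u: "u \<in> B_carrier r" by (simp add: u_def U_in)
  define v where "v L = (\<Sum>m<lead L. smul (sfunB m u) (T (svecB m))) +
      (\<Sum>k\<in>{..<L} - range lead. smul (hfunB k u) (T (hvecB k)))" for L
  have s_in: "T (svecB m) \<in> range c" for m
  proof -
    have "T (svecB m) = c (lead (2 * m + 1))" by (simp add: z_def)
    then show ?thesis by blast
  qed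
  have h_in: "T (hvecB k) \<in> range c" if "k \<notin> range lead" for k
  proof -
    have "T (hvecB k) = c k" using that by (simp add: c_def)
    then show ?thesis by blast
  qed
  have v_in: "v L \<in> span (range c)" for L
    unfolding v_def using s_in h_in by (intro span_add span_sum span_scale span_base) auto
  define t where "t L n i = (if n < lead (Suc L) then 0 else freed u n i)" for L n i
  have t: "t L \<in> B_carrier r" for L
    unfolding t_def[abs_def] by (rule B_tail(1)[OF freed_in_B[OF u]])
  have split: "T (freed u) = v L + T (t L)" for L
  proof -
    have 1: "(\<lambda>n j. \<Sum>m<lead L. sfunB m u * svecB m n j) \<in> B_carrier r"
      "T (\<lambda>n j. \<Sum>m<lead L. sfunB m u * svecB m n j) = (\<Sum>m<lead L. smul (sfunB m u) (T (svecB m)))"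
      by (rule T_sum; simp add: svecB_in)+
    have 2: "(\<lambda>n j. \<Sum>k\<in>{..<L} - range lead. hfunB k u * hvecB k n j) \<in> B_carrier r"
      "T (\<lambda>n j. \<Sum>k\<in>{..<L} - range lead. hfunB k u * hvecB k n j) =
        (\<Sum>k\<in>{..<L} - range lead. smul (hfunB k u) (T (hvecB k)))"
      by (rule T_sum; simp add: hvecB_in)+
    have "freed u = (\<lambda>n j. ((\<Sum>m<lead L. sfunB m u * svecB m n j) +
        (\<Sum>k\<in>{..<L} - range lead. hfunB k u * hvecB k n j)) + t L n j)"
      by (intro ext) (simp add: t_def flip: freed_truncated_eq[OF u])
    then have "T (freed u) = T (\<lambda>n j. ((\<Sum>m<lead L. sfunB m u * svecB m n j) +
        (\<Sum>k\<in>{..<L} - range lead. hfunB k u * hvecB k n j)) + t L n j)"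
      by (rule arg_cong)
    also have "\<dots> = v L + T (t L)"
      unfolding T_add[OF B_carrier_add[OF 1(1) 2(1)] t] T_add[OF 1(1) 2(1)] 1(2) 2(2) v_def ..
    finally show ?thesis .
  qed
  have "filterlim lead at_top sequentially"
    by (rule filterlim_at_top_mono[OF filterlim_ident]) (simp add: le_lead)
  then have "filterlim (\<lambda>L. lead (Suc L)) at_top sequentially"
    by (rule filterlim_compose[OF _ filterlim_Suc])
  from filterlim_compose[OF B_tail(2)[OF freed_in_B[OF u]] this]
  have "(\<lambda>L. B_norm r (t L)) \<longlonglongrightarrow> 0" unfolding t_def[abs_def] .
  then have "(\<lambda>L. M * B_norm r (t L)) \<longlonglongrightarrow> 0" by (rule tendsto_mult_right_zero)
  then have "(\<lambda>L. T (t L)) \<longlonglongrightarrow> 0"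
    by (rule Lim_null_comparison[rotated]) (simp add: M[OF t])
  then have "(\<lambda>L. T (freed u) - T (t L)) \<longlonglongrightarrow> T (freed u) - 0"
    by (intro tendsto_diff tendsto_const)
  moreover have "T (freed u) - T (t L) = v L" for L by (simp add: split[of L])
  ultimately have "v \<longlonglongrightarrow> T (freed u)" by simp
  then show ?thesis
    unfolding closure_sequential u_def[symmetric] using v_in by blast
qed

lemma dense_c: "closure (span (range c)) = UNIV"
proof -
  have "f \<in> closure (span (range c))" for f
  proof -
    obtain M where M: "\<And>f. norm (J f) \<le> M * norm f"
      by (rule bounds) (rule that)
    define s where "s m = J (\<Sum>i<m. smul (coord smul x i (G f)) (x i))" for m
    have J_x: "J (x i) \<in> span (range c)" for i
    proof -
      have "of_real (norm (x i)) * of_real (1 / norm (x i)) = (1 :: 'k)"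
        using x_nonzero[of i] by (simp flip: of_real_mult)
      then have "J (x i) = smul (of_real (norm (x i))) (c (lead (2 * i)))"
        by (simp only: c_lead z_def scale_scale) simp
      then show ?thesis by (simp only:) (intro span_scale span_base rangeI)
    qed
    have s_in: "s m \<in> span (range c)" for m
      unfolding s_def J_sum J_smul by (intro span_sum span_scale J_x)
    have "bounded_linear J"
      using M by (intro bounded_linear_intro[where K=M])
        (auto simp: J_add mult.commute J_smul simp flip: smul_of_real)
    then have "s \<longlonglongrightarrow> J (G f)"
      unfolding s_def using coord_sums[OF basis, of "G f"] unfolding sums_def
      by (rule bounded_linear.tendsto)
    then have "J (G f) \<in> closure (span (range c))"
      unfolding closure_sequential using s_in by blast
    then have "J (G f) + T (freed (U f)) \<in> closure (span (range c))"
      by (intro subspace_add[OF subspace_closure_span] T_freed_in_closure)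
    then show ?thesis by (simp add: J_G)
  qed
  then show ?thesis by blast
qed

lemma dkk_c:
  obtains K where "dkk smul c c' K"
proof -
  obtain M where M1: "1 \<le> M" and M: "\<And>u. u \<in> B_carrier r \<Longrightarrow> norm (T u) \<le> M * B_norm r u"
    "\<And>u. u \<in> B_carrier r \<Longrightarrow> B_norm r u \<le> M * norm (T u)"
    "\<And>f. B_norm r (U f) \<le> M * norm f" "\<And>f. norm (J f) \<le> M * norm f" "\<And>f. norm (G f) \<le> M * norm f"
    "\<And>m f. norm (\<Sum>i<m. smul (coord smul x i f) (x i)) \<le> M * norm f"
    by (rule bounds) (rule that)
  \<comment> \<open>The partial sums of \<open>z\<close> are the most expensive: \<open>G\<close>,
    the partial sums of \<open>x\<close> and \<open>J\<close> cost a factor \<open>M\<close> each,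
    and the conditional part adds \<open>2 * M^2\<close>.\<close>
  define K where "K = 4 * M ^ 3"
  have M2: "M \<le> M\<^sup>2" "M\<^sup>2 \<le> M ^ 3"
    using power_increasing[of 1 2 M] power_increasing[of 2 3 M] M1 by simp_all
  have M_K: "M \<le> K" "2 * M \<le> K" "2 * M\<^sup>2 \<le> K" "K \<ge> 0"
    using M2 M1 by (auto simp: K_def)
  have le_K: "y \<le> K * norm f" if "y \<le> d * norm f" "d \<le> K" for y d and f :: 'a
    using that mult_right_mono[of d K "norm f"] by simp
  have lower: "(\<Sum>i\<in>F. (norm (c' i f))\<^sup>2) \<le> (K * norm f)\<^sup>2"
    if F: "finite F" "F \<inter> range lead = {}" for F f
  proof -
    have "(\<Sum>i\<in>F. (norm (c' i f))\<^sup>2) = (\<Sum>i\<in>F. (norm (hfunB i (U f)))\<^sup>2)"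
      using F by (intro sum.cong) (auto simp: c'_def)
    also have "\<dots> \<le> (B_norm r (U f))\<^sup>2" by (rule sum_hfunB_le[OF U_in F(1)])
    also have "\<dots> \<le> (K * norm f)\<^sup>2"
      using le_K[OF M(3) M_K(1)] B_norm_nonneg[OF U_in] by (intro power_mono) auto
    finally show ?thesis .
  qed
  \<comment> \<open>The factor \<open>norm (x n)\<close> makes the left side the norm of one term of
    the expansion of \<open>G f\<close>, a difference of two consecutive partial sums.\<close>
  have Gc: "norm (of_real (norm (x n)) * coord smul x n (G f)) \<le> 2 * M\<^sup>2 * norm f" for n f
  proof -
    let ?S = "\<lambda>m. \<Sum>i<m. smul (coord smul x i (G f)) (x i)"
    have "norm (of_real (norm (x n)) * coord smul x n (G f)) = norm (?S (Suc n) - ?S n)"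
      by (simp add: norm_mult norm_smul)
    also have "\<dots> \<le> M * norm (G f) + M * norm (G f)"
      by (intro order_trans[OF norm_triangle_ineq4] add_mono M(6))
    also have "\<dots> \<le> M * (M * norm f) + M * (M * norm f)"
      using M1 M(5) by (intro add_mono mult_left_mono) auto
    finally show ?thesis by (simp add: power2_eq_square algebra_simps)
  qed
  have sU: "norm (sfunB m (U f)) \<le> 2 * M * norm f" for m f
    using norm_sfunB_le[OF U_in, of m f] M(3)[of f] by simp
  have lead_sums: "norm (\<Sum>n<L. smul (z' n f) (z n)) \<le> K * norm f" for L f
  proof -
    have "norm (\<Sum>n<L. smul (z' n f) (z n)) \<le> M ^ 3 * norm f + 2 * M\<^sup>2 * norm f"
      unfolding z_sums
    proof (rule norm_triangle_mono)
      have "norm (J (\<Sum>i<Suc L div 2. smul (coord smul x i (G f)) (x i))) \<le>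
          M * (M * (M * norm f))"
        using M1 M(5) by (intro order_trans[OF M(4)] mult_left_mono order_trans[OF M(6)]) auto
      then show "norm (J (\<Sum>i<Suc L div 2. smul (coord smul x i (G f)) (x i))) \<le> M ^ 3 * norm f"
        by (simp add: power3_eq_cube mult.assoc)
      have "norm (T (\<lambda>n j. \<Sum>m<L div 2. sfunB m (U f) * svecB m n j)) \<le> M * (2 * (M * norm f))"
        using M1 M(3)[of f]
        by (intro order_trans[OF M(1)] mult_left_mono order_trans[OF svecB_partial_sum(2)]
          svecB_partial_sum(1) U_in) auto
      then show "norm (T (\<lambda>n j. \<Sum>m<L div 2. sfunB m (U f) * svecB m n j)) \<le> 2 * M\<^sup>2 * norm f"
        by (simp add: power2_eq_square mult.assoc mult.left_commute)
    qed
    also have "\<dots> \<le> K * norm f"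
      unfolding distrib_right[symmetric] using M2 M1 by (intro mult_right_mono) (auto simp: K_def)
    finally show ?thesis .
  qed
  have "dkk smul c c' K"
  proof unfold_locales
    fix i j f
    show "functional (c' i)" by (rule functional_c')
    show "c' i (c j) = (if i = j then 1 else 0)" by (rule biorthogonal_c)
    show "norm (c' i f) \<le> K * norm f"
    proof (cases "i \<in> range lead")
      case True
      then show ?thesis
        using le_K[OF Gc M_K(3)] le_K[OF sU M_K(2)] by (simp add: c'_def z'_def)
    next
      case False
      have "(norm (c' i f))\<^sup>2 \<le> (K * norm f)\<^sup>2" using lower[of "{i}" f] False by simp
      then show ?thesis by (rule power2_le_imp_le) (use M_K in simp)
    qed
    show "norm (c i) \<le> K"
    proof -
      have 1: "norm (smul (of_real (1 / norm (x n))) (J (x n))) \<le> M" for n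
        using M(4)[of "x n"] x_nonzero[of n] by (simp add: norm_smul norm_divide divide_le_eq)
      have 2: "norm (T (svecB m)) \<le> 2 * M" for m
        using order_trans[OF M(1)[OF svecB_in] mult_left_mono[OF B_norm_svecB]] M1 by (simp add: mult.commute)
      have 3: "norm (T (hvecB k)) \<le> M" for k
      proof -
        have "B_norm r (hvecB k :: _ \<Rightarrow> _ \<Rightarrow> 'k) \<le> 1" using hvecB_sum(2)[of "{k}" "\<lambda>_. 1 :: 'k"] by simp
        then show ?thesis using order_trans[OF M(1)[OF hvecB_in] mult_left_mono] M1 by fastforce
      qed
      have "norm (z n) \<le> K" for n
        using 1[of "n div 2"] 2[of "n div 2"] M_K unfolding z_def by (simp only: split: if_split) linarith
      then show ?thesis
        using order_trans[OF 3 M_K(1)] by (simp add: c_def)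
    qed
  next
    fix F :: "nat set" and f
    assume "finite F" "F \<inter> range lead = {}"
    then show "(\<Sum>i\<in>F. (norm (c' i f))\<^sup>2) \<le> (K * norm f)\<^sup>2" by (rule lower)
  next
    fix F :: "nat set" and a :: "nat \<Rightarrow> 'k"
    assume F: "finite F" "F \<inter> range lead = {}"
    have "(\<Sum>i\<in>F. smul (a i) (c i)) = (\<Sum>i\<in>F. smul (a i) (T (hvecB i)))"
      using F by (intro sum.cong) (auto simp: c_def)
    also have "\<dots> = T (\<lambda>n j. \<Sum>i\<in>F. a i * hvecB i n j)"
      using F by (subst T_sum(2)) (auto simp: hvecB_in)
    also have "norm \<dots> \<le> K * sqrt (\<Sum>i\<in>F. (norm (a i))\<^sup>2)"
      using hvecB_sum[OF F(1), of a] M_K M1 B_norm_nonneg[OF hvecB_sum(1)[OF F(1), of a]]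
      by (intro order_trans[OF M(1)] mult_mono) auto
    finally show "norm (\<Sum>i\<in>F. smul (a i) (c i)) \<le> K * sqrt (\<Sum>i\<in>F. (norm (a i))\<^sup>2)" .
  next
    fix L f
    show "norm (\<Sum>n<L. smul (c' (lead n) f) (c (lead n))) \<le> K * norm f"
      using lead_sums by simp
  next
    show "closure (span (range c)) = UNIV" by (rule dense_c)
  qed
  then show thesis by (rule that)
qed

text \<open>Among the first \<open>k\<close> vectors a whole conditional basis of dimension
  comparable to \<open>k\<close> occurs at odd positions. Coefficients supported there show linear
  growth regardless of the given basis.\<close>

lemma z_conditional:
  obtains \<delta> :: real where "\<delta> > 0"
    "\<And>k. k \<ge> 1 \<Longrightarrow> \<exists>s A. A \<subseteq> {..<k} \<and> (\<Sum>n<k. smul (s n) (z n)) \<noteq> 0 \<and>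
      \<delta> * k * norm (\<Sum>n<k. smul (s n) (z n)) \<le> norm (\<Sum>n\<in>A. smul (s n) (z n))"
proof -
  obtain M where M1: "1 \<le> M" and M: "\<And>u. u \<in> B_carrier r \<Longrightarrow> norm (T u) \<le> M * B_norm r u"
    "\<And>u. u \<in> B_carrier r \<Longrightarrow> B_norm r u \<le> M * norm (T u)"
    by (rule bounds) (rule that)
  \<comment> \<open>The isomorphism costs \<open>M\<close> in each direction, the conditional basis
    a factor 2, and \<open>k < 8 * 2 ^ l\<close> a factor 8. For \<open>k < 4\<close> the single
    vector \<open>z 0\<close> suffices, as \<open>\<delta> * k\<close> is then below 1.\<close>
  define \<delta> where "\<delta> = 1 / (16 * M\<^sup>2)"
  have \<delta>: "\<delta> > 0" using M1 by (simp add: \<delta>_def)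
  have "1\<^sup>2 \<le> M\<^sup>2" using M1 by (intro power_mono) auto
  then have \<delta>_le: "\<delta> \<le> 1 / 16" unfolding \<delta>_def by (intro frac_le) auto
  have "\<exists>s A. A \<subseteq> {..<k} \<and> (\<Sum>n<k. smul (s n) (z n)) \<noteq> 0 \<and>
      \<delta> * k * norm (\<Sum>n<k. smul (s n) (z n)) \<le> norm (\<Sum>n\<in>A. smul (s n) (z n))"
    if k: "k \<ge> 1" for k
  proof (cases "k < 4")
    case True
    define s :: "nat \<Rightarrow> 'k" where "s n = (if n = 0 then 1 else 0)" for n
    have z0: "z 0 \<noteq> 0"
    proof
      assume "z 0 = 0"
      then have "z' 0 0 = 1" using biorthogonal_z[of 0 0] by simp
      then show False using functional_0[OF functional_c', of "lead 0"] by simp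
    qed
    have "(\<Sum>n<k. smul (s n) (z n)) = (\<Sum>n<k. if n = 0 then z n else 0)"
      by (rule sum.cong) (auto simp: s_def)
    then have 1: "(\<Sum>n<k. smul (s n) (z n)) = z 0" using k by simp
    have "\<delta> * k \<le> 1 / 16 * 4" using \<delta>_le \<delta> True by (intro mult_mono) auto
    then have "\<delta> * k * norm (z 0) \<le> 1 * norm (z 0)" by (intro mult_right_mono) auto
    then show ?thesis
      using 1 z0 k by (intro exI[of _ s] exI[of _ "{0}"]) (auto simp: s_def)
  next
    case False
    \<comment> \<open>One factor 2 is lost to the interlacing and another to the smaller blocks that
      precede \<open>block l\<close>: the last position in use is
      \<open>4 * 2 ^ l - 3\<close>.\<close>
    define l where "l = floor_log k - 2"
    have fl: "2 ^ floor_log k \<le> k" "k < 2 * 2 ^ floor_log k"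
      using False floor_log_exp2_le[of k] floor_log_exp2_gt[of k] by auto
    have "floor_log k \<ge> 2"
    proof (rule ccontr)
      assume "\<not> ?thesis"
      then have "2 ^ floor_log k \<le> (2::nat) ^ 1" by (intro power_increasing) auto
      then show False using fl False by simp
    qed
    then have l: "floor_log k = Suc (Suc l)" by (simp add: l_def)
    have kl: "4 * 2 ^ l \<le> k" "k < 8 * 2 ^ l" using fl unfolding l by auto
    obtain a :: "nat \<Rightarrow> 'k" and A where A: "A \<subseteq> {..<2 ^ l}"
      and full: "(\<lambda>n j. \<Sum>i<2 ^ l. a i * svecB (lead l + i) n j) \<in> B_carrier r"
        "B_norm r (\<lambda>n j. \<Sum>i<2 ^ l. a i * svecB (lead l + i) n j) = 1"
      and part: "(\<lambda>n j. \<Sum>i\<in>A. a i * svecB (lead l + i) n j) \<in> B_carrier r"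
        "2 ^ l \<le> 2 * B_norm r (\<lambda>n j. \<Sum>i\<in>A. a i * svecB (lead l + i) n j)"
      by (rule svecB_block_conditional[of l]) blast
    define e where "e i = 2 * (lead l + i) + 1" for i
    have e_less: "e i < k" if "i < 2 ^ l" for i
      using that kl(1) Suc_lead[of l] by (simp add: e_def)
    have inj_e: "inj_on e F" for F by (auto simp: e_def inj_on_def)
    define s where "s n = (if n \<in> e ` {..<2 ^ l} then a (inv_into {..<2 ^ l} e n) else 0)" for n
    have s_e: "s (e i) = a i" if "i < 2 ^ l" for i
      using that inv_into_f_f[OF inj_e, of i "{..<2 ^ l}"] by (simp add: s_def)
    have sum_e: "(\<Sum>n\<in>e ` F. smul (s n) (z n)) = T (\<lambda>n j. \<Sum>i\<in>F. a i * svecB (lead l + i) n j)"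
      if F: "F \<subseteq> {..<2 ^ l}" for F
    proof -
      have "(\<Sum>n\<in>e ` F. smul (s n) (z n)) = (\<Sum>i\<in>F. smul (s (e i)) (z (e i)))"
        by (simp add: sum.reindex[OF inj_e])
      also have "\<dots> = (\<Sum>i\<in>F. smul (a i) (T (svecB (lead l + i))))"
      proof (rule sum.cong[OF refl])
        fix i assume "i \<in> F"
        then have "i < 2 ^ l" using F by auto
        moreover have "z (e i) = T (svecB (lead l + i))" by (simp add: e_def z_def)
        ultimately show "smul (s (e i)) (z (e i)) = smul (a i) (T (svecB (lead l + i)))"
          by (simp only: s_e)
      qed
      also have "\<dots> = T (\<lambda>n j. \<Sum>i\<in>F. a i * svecB (lead l + i) n j)"
        using finite_subset[OF F] by (subst T_sum(2)) (auto simp: svecB_in)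
      finally show ?thesis .
    qed
    have "(\<Sum>n<k. smul (s n) (z n)) = (\<Sum>n\<in>e ` {..<2 ^ l}. smul (s n) (z n))"
      using e_less by (intro sum.mono_neutral_right) (auto simp: s_def)
    then have 1: "(\<Sum>n<k. smul (s n) (z n)) = T (\<lambda>n j. \<Sum>i<2 ^ l. a i * svecB (lead l + i) n j)"
      using sum_e[OF order_refl] by simp
    have 2: "norm (\<Sum>n<k. smul (s n) (z n)) \<le> M" "(\<Sum>n<k. smul (s n) (z n)) \<noteq> 0"
      using M(1)[OF full(1)] M(2)[OF full(1)] full(2) unfolding 1 by auto
    have "\<delta> * k * norm (\<Sum>n<k. smul (s n) (z n)) \<le> \<delta> * (8 * 2 ^ l) * M"
    proof (intro mult_mono 2)
      have "real k \<le> real (8 * 2 ^ l)" using kl(2) by (intro of_nat_mono) simp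
      then show "real k \<le> 8 * 2 ^ l" by simp
    qed (use \<delta> in auto)
    also have "\<dots> = 2 ^ l / (2 * M)" using M1 by (simp add: \<delta>_def power2_eq_square)
    also have "\<dots> \<le> (2 * (M * norm (T (\<lambda>n j. \<Sum>i\<in>A. a i * svecB (lead l + i) n j)))) / (2 * M)"
      using part(2) M(2)[OF part(1)] M1 by (intro divide_right_mono) auto
    also have "\<dots> = norm (\<Sum>n\<in>e ` A. smul (s n) (z n))"
      using M1 sum_e[OF A] by simp
    finally show ?thesis
      using 2(2) A e_less by (intro exI[of _ s] exI[of _ "e ` A"]) auto
  qed
  then show thesis using that \<delta> by blast
qed

lemma almost_greedy_basis:
  "\<exists>b. schauder_basis smul b \<and> almost_greedy smul b \<and>
    approx_on {1..} (fundamental_function b) (\<lambda>m. ennreal (real m powr (1 / 2))) \<and>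
    approx_on {2..} (conditionality_const smul b) (\<lambda>m. ennreal (ln (real m)))"
proof -
  obtain K where "dkk smul c c' K" by (rule dkk_c)
  then interpret dkk smul c c' K .
  obtain \<delta> :: real where \<delta>: "\<delta> > 0"
    "\<And>k. k \<ge> 1 \<Longrightarrow> \<exists>s A. A \<subseteq> {..<k} \<and> (\<Sum>n<k. smul (s n) (z n)) \<noteq> 0 \<and>
      \<delta> * k * norm (\<Sum>n<k. smul (s n) (z n)) \<le> norm (\<Sum>n\<in>A. smul (s n) (z n))"
    using z_conditional by blast
  show ?thesis
    using basis_b almost_greedy_b fundamental_function_b conditionality_const_b[OF \<delta>(1)] \<delta>(2) by auto
qed

end

theorem theorem3p7:
  fixes smul :: "'k::real_or_complex \<Rightarrow> 'a::banach \<Rightarrow> 'a"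
  assumes "banach_space_over smul"
    and "\<exists>x. schauder_basis smul x"
    and "(\<exists>Y. complemented_subspace smul Y \<and> B_isomorphic_to \<infinity> smul Y) \<or>
         (\<exists>Y. complemented_subspace smul Y \<and> B_isomorphic_to 1 smul Y)"
  shows "\<exists>b. schauder_basis smul b \<and> almost_greedy smul b \<and>
           approx_on {1..} (fundamental_function b) (\<lambda>m. ennreal (real m powr (1 / 2))) \<and>
           approx_on {2..} (conditionality_const smul b) (\<lambda>m. ennreal (ln (real m)))"
proof -
  obtain r Y where r: "r = 1 \<or> r = \<infinity>" and Y: "complemented_subspace smul Y" "B_isomorphic_to r smul Y"
    using assms(3) by blast
  obtain x where x: "schauder_basis smul x" using assms(2) by blast
  obtain P where P: "bounded_linear P" "\<And>c f. P (smul c f) = smul c (P f)" "P \<circ> P = P" "range P = Y"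
    using Y(1) unfolding complemented_subspace_def by blast
  obtain T :: "(nat \<Rightarrow> nat \<Rightarrow> 'k) \<Rightarrow> 'a" where T:
    "\<And>u v. u \<in> B_carrier r \<Longrightarrow> v \<in> B_carrier r \<Longrightarrow> T (\<lambda>n i. u n i + v n i) = T u + T v"
    "\<And>c u. u \<in> B_carrier r \<Longrightarrow> T (\<lambda>n i. c * u n i) = smul c (T u)"
    "\<exists>c C. 0 < c \<and> (\<forall>u\<in>B_carrier r. c * B_norm r u \<le> norm (T u) \<and> norm (T u) \<le> C * B_norm r u)"
    "T ` B_carrier r = Y"
    using Y(2) unfolding B_isomorphic_to_def by blast
  interpret banach_space_over smul by (rule assms(1))
  have P_idem: "P (P f) = P f" for f
    using fun_cong[OF P(3), of f] by simp
  have T_range: "T ` B_carrier r = range P"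
    using T(4) P(4) by simp
  interpret block_complement smul r x P T
    by (intro block_complement.intro assms(1) ell_exponent.intro[OF r] block_complement_axioms.intro)
      (rule x P(1,2) P_idem T(1-3) T_range; assumption)+
  show ?thesis by (rule almost_greedy_basis)
qed

end
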